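(* Let $\mathfrak{g}$ be a Riemannian metric on $\mathbb{C}^n$, $n>1$. For every proper holomorphic foliation $\mathcal{F}$ on $\mathbb{C}^n$ there is a holomorphic automorphism $\Phi\in\mathrm{Aut}(\mathbb{C}^n)$ such that the image foliation $\Phi_*\mathcal{F}$ with leaves $\Phi(\mathcal{F}_z)$ $(z\in\mathbb{C}^n)$ is $\mathfrak{g}$-complete.
   Context: $\mathrm{Aut}(X)$ is the group of holomorphic automorphisms of a complex manifold $X$. A (possibly singular) holomorphic foliation $\mathcal{F}$ is understood in the standard sense; its leaves partition the manifold, $\mathcal{F}_x$ denotes the leaf containing the point $x$, and different leaves may have different dimensions. Proper foliation: let $X$ be a connected Stein manifold of dimension $>1$. A (possibly singular) holomorphic foliation $\mathcal{F}$ on $X$ is proper if every leaf $\mathcal{F}_x$ $(x\in X)$ is closed and satisfies $\dim\mathcal{F}_x\ge 1$, and for every compact subset $K\subset X$ the set $\mathcal{F}(K):=\overline{\bigcup_{x\in K}\mathcal{F}_x}$ is such that $X\setminus\mathcal{F}(K)$ is nonempty and not relatively compact in $X$. Completeness: the Riemannian metric $\mathfrak{g}$ is arbitrary (not assumed complete). A locally closed complex subvariety $Y$ is $\mathfrak{g}$-complete if every smooth divergent path $\gamma:[0,1)\to Y$ (i.e., one leaving every compact subset of $Y$) has infinite $\mathfrak{g}$-length. A holomorphic foliation is $\mathfrak{g}$-complete if every leaf is $\mathfrak{g}$-complete. *)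

theory Defs
  imports "HOL-Analysis.Analysis"
begin

section \<open>Holomorphic maps and automorphisms of complex n-space\<close>

definition holo_fun_on :: "(complex ^ 'n \<Rightarrow> complex) \<Rightarrow> (complex ^ 'n) set \<Rightarrow> bool" where
  "holo_fun_on f U \<longleftrightarrow>
     (\<forall>z\<in>U. \<exists>D. (f has_derivative D) (at z) \<and> (\<forall>c v. D (c *s v) = c * D v))"

definition holo_map_on ::
  "(complex ^ 'n \<Rightarrow> complex ^ 'm) \<Rightarrow> (complex ^ 'n) set \<Rightarrow> bool" where
  "holo_map_on f U \<longleftrightarrow> (\<forall>i. holo_fun_on (\<lambda>z. f z $ i) U)"

definition holo_automorphism :: "(complex ^ 'n \<Rightarrow> complex ^ 'n) \<Rightarrow> bool" where
  "holo_automorphism \<Phi> \<longleftrightarrow>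
     bij \<Phi> \<and> holo_map_on \<Phi> UNIV \<and> holo_map_on (inv \<Phi>) UNIV"


section \<open>Singular holomorphic foliations\<close>

text \<open>A singular holomorphic foliation is a coherent involutive subsheaf of the tangent sheaf.
  The subsheaf is given by its sets of sections \<open>F U\<close> over the open sets \<open>U\<close>. A section over \<open>U\<close> is
  represented by a total function whose values off \<open>U\<close> are irrelevant; this is the reason for the
  first clause in the definition of a subsheaf. The values of \<open>F\<close> at non-open sets are not used.\<close>

type_synonym 'n vfield = "complex ^ 'n \<Rightarrow> complex ^ 'n"

type_synonym 'n vsheaf = "(complex ^ 'n) set \<Rightarrow> 'n vfield set"

definition lie_bracket :: "'n::finite vfield \<Rightarrow> 'n vfield \<Rightarrow> 'n vfield" where
  "lie_bracket V W =
     (\<lambda>z. frechet_derivative W (at z) (V z) - frechet_derivative V (at z) (W z))"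

definition tangent_subsheaf :: "'n::finite vsheaf \<Rightarrow> bool" where
  "tangent_subsheaf F \<longleftrightarrow>
     (\<forall>U V V'. open U \<and> V \<in> F U \<and> (\<forall>z\<in>U. V' z = V z) \<longrightarrow> V' \<in> F U) \<and>
     (\<forall>U V. open U \<and> V \<in> F U \<longrightarrow> holo_map_on V U) \<and>
     (\<forall>U U' V. open U \<and> open U' \<and> U' \<subseteq> U \<and> V \<in> F U \<longrightarrow> V \<in> F U') \<and>
     (\<forall>\<U> V. (\<forall>U\<in>\<U>. open U \<and> V \<in> F U) \<longrightarrow> V \<in> F (\<Union>\<U>)) \<and>
     (\<forall>U. open U \<longrightarrow> (\<lambda>z. 0) \<in> F U) \<and>
     (\<forall>U V W. open U \<and> V \<in> F U \<and> W \<in> F U \<longrightarrow> (\<lambda>z. V z + W z) \<in> F U) \<and>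
     (\<forall>U f V. open U \<and> holo_fun_on f U \<and> V \<in> F U \<longrightarrow> (\<lambda>z. f z *s V z) \<in> F U)"

text \<open>By Oka's theorem a subsheaf of the (locally free) tangent sheaf is coherent if and only if
  it is locally finitely generated.\<close>

definition locally_fin_gen :: "'n::finite vsheaf \<Rightarrow> bool" where
  "locally_fin_gen F \<longleftrightarrow>
     (\<forall>p. \<exists>U S. open U \<and> p \<in> U \<and> finite S \<and> S \<subseteq> F U \<and>
        (\<forall>q\<in>U. \<forall>W V. open W \<and> q \<in> W \<and> V \<in> F W \<longrightarrow>
           (\<exists>W' f. open W' \<and> q \<in> W' \<and> W' \<subseteq> U \<inter> W \<and> (\<forall>s\<in>S. holo_fun_on (f s) W') \<and>
              (\<forall>z\<in>W'. V z = (\<Sum>s\<in>S. f s z *s s z)))))"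

definition involutive :: "'n::finite vsheaf \<Rightarrow> bool" where
  "involutive F \<longleftrightarrow>
     (\<forall>U V W. open U \<and> V \<in> F U \<and> W \<in> F U \<longrightarrow> lie_bracket V W \<in> F U)"

definition holo_foliation :: "'n::finite vsheaf \<Rightarrow> bool" where
  "holo_foliation F \<longleftrightarrow> tangent_subsheaf F \<and> locally_fin_gen F \<and> involutive F"

text \<open>The leaf through \<open>x\<close> is the orbit of \<open>x\<close> under the local flows of sections of \<open>F\<close>, which by
  the theorem of Nagano is the maximal connected integral manifold through \<open>x\<close>. It suffices to use
  real time-one flows because \<open>F\<close> is closed under multiplication by complex constants. Note that
  it would not be enough to ask for a path whose velocity lies in the fibre of \<open>F\<close> at each point:
  such a path may cross from one leaf to another where the fibre dimension drops.\<close>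

definition flow_step :: "'n::finite vsheaf \<Rightarrow> complex ^ 'n \<Rightarrow> complex ^ 'n \<Rightarrow> bool" where
  "flow_step F x y \<longleftrightarrow>
     (\<exists>U V \<gamma>. open U \<and> V \<in> F U \<and> \<gamma> (0::real) = x \<and> \<gamma> 1 = y \<and>
        (\<forall>t\<in>{0..1}. \<gamma> t \<in> U \<and> (\<gamma> has_vector_derivative V (\<gamma> t)) (at t within {0..1})))"

definition leaf :: "'n::finite vsheaf \<Rightarrow> complex ^ 'n \<Rightarrow> (complex ^ 'n) set" where
  "leaf F x = {y. (flow_step F)\<^sup>*\<^sup>* x y}"

definition leaf_tangent :: "'n::finite vsheaf \<Rightarrow> complex ^ 'n \<Rightarrow> (complex ^ 'n) set" where
  "leaf_tangent F x = {V x | U V. open U \<and> x \<in> U \<and> V \<in> F U}"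

text \<open>Complex dimension of the leaf through \<open>x\<close>: its tangent space at \<open>x\<close> is the fibre
  \<open>leaf_tangent F x\<close>, and \<open>vec.dim\<close> is the dimension over the scalar field \<open>complex\<close>.\<close>

definition leaf_dim :: "'n::finite vsheaf \<Rightarrow> complex ^ 'n \<Rightarrow> nat" where
  "leaf_dim F x = vec.dim (leaf_tangent F x)"

definition leaf_hull :: "'n::finite vsheaf \<Rightarrow> (complex ^ 'n) set \<Rightarrow> (complex ^ 'n) set" where
  "leaf_hull F K = closure (\<Union>x\<in>K. leaf F x)"

definition proper_foliation :: "'n::finite vsheaf \<Rightarrow> bool" where
  "proper_foliation F \<longleftrightarrow>
     holo_foliation F \<and>
     (\<forall>x. closed (leaf F x) \<and> leaf_dim F x \<ge> 1) \<and>
     (\<forall>K. compact K \<longrightarrow> - leaf_hull F K \<noteq> {} \<and> \<not> compact (closure (- leaf_hull F K)))"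

definition image_foliation ::
  "(complex ^ 'n \<Rightarrow> complex ^ 'n) \<Rightarrow> 'n::finite vsheaf \<Rightarrow> 'n vsheaf" where
  "image_foliation \<Phi> F = (\<lambda>W. {V'. \<exists>V \<in> F (\<Phi> -` W).
     \<forall>z \<in> \<Phi> -` W. V' (\<Phi> z) = frechet_derivative \<Phi> (at z) (V z)})"


section \<open>Riemannian metrics and completeness\<close>

primrec Ck :: "nat \<Rightarrow> ('a::real_normed_vector \<Rightarrow> 'b::real_normed_vector) \<Rightarrow> bool" where
  "Ck 0 f \<longleftrightarrow> continuous_on UNIV f"
| "Ck (Suc k) f \<longleftrightarrow>
     (\<forall>x. f differentiable (at x)) \<and> (\<forall>v. Ck k (\<lambda>x. frechet_derivative f (at x) v))"

definition smooth :: "('a::real_normed_vector \<Rightarrow> 'b::real_normed_vector) \<Rightarrow> bool" where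
  "smooth f \<longleftrightarrow> (\<forall>k. Ck k f)"

definition riemannian_metric ::
  "(complex ^ 'n \<Rightarrow> complex ^ 'n \<Rightarrow> complex ^ 'n \<Rightarrow> real) \<Rightarrow> bool" where
  "riemannian_metric g \<longleftrightarrow>
     (\<forall>p. bilinear (g p) \<and> (\<forall>v w. g p v w = g p w v) \<and> (\<forall>v. v \<noteq> 0 \<longrightarrow> g p v v > 0)) \<and>
     (\<forall>v w. smooth (\<lambda>p. g p v w))"

text \<open>Smoothness on the half-open interval \<open>[0,1)\<close> uses one-sided derivatives of all orders at \<open>0\<close>;
  \<open>D k\<close> is the derivative of order \<open>k\<close>.\<close>

definition smooth_path :: "(real \<Rightarrow> complex ^ 'n) \<Rightarrow> bool" where
  "smooth_path \<gamma> \<longleftrightarrow>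
     (\<exists>D. D (0::nat) = \<gamma> \<and>
        (\<forall>k. \<forall>t\<in>{0..<1}. (D k has_vector_derivative D (Suc k) t) (at t within {0..<1})))"

definition divergent_path_in :: "(complex ^ 'n) set \<Rightarrow> (real \<Rightarrow> complex ^ 'n) \<Rightarrow> bool" where
  "divergent_path_in Y \<gamma> \<longleftrightarrow>
     \<gamma> ` {0..<1} \<subseteq> Y \<and>
     (\<forall>K. compact K \<and> K \<subseteq> Y \<longrightarrow> (\<forall>\<^sub>F t in at_left 1. \<gamma> t \<notin> K))"

definition metric_length ::
  "(complex ^ 'n \<Rightarrow> complex ^ 'n \<Rightarrow> complex ^ 'n \<Rightarrow> real) \<Rightarrow> (real \<Rightarrow> complex ^ 'n) \<Rightarrow> ennreal" where
  "metric_length g \<gamma> =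
     (\<integral>\<^sup>+ t \<in> {0..<1}. ennreal (sqrt (g (\<gamma> t)
        (vector_derivative \<gamma> (at t within {0..<1}))
        (vector_derivative \<gamma> (at t within {0..<1})))) \<partial>lborel)"

definition metric_complete ::
  "(complex ^ 'n \<Rightarrow> complex ^ 'n \<Rightarrow> complex ^ 'n \<Rightarrow> real) \<Rightarrow> (complex ^ 'n) set \<Rightarrow> bool" where
  "metric_complete g Y \<longleftrightarrow>
     (\<forall>\<gamma>. smooth_path \<gamma> \<and> divergent_path_in Y \<gamma> \<longrightarrow> metric_length g \<gamma> = \<infinity>)"

definition complete_foliation ::
  "(complex ^ 'n \<Rightarrow> complex ^ 'n \<Rightarrow> complex ^ 'n \<Rightarrow> real) \<Rightarrow> 'n::finite vsheaf \<Rightarrow> bool" where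
  "complete_foliation g F \<longleftrightarrow> (\<forall>x. metric_complete g (leaf F x))"

end

theory Submission imports Defs "HOL-Complex_Analysis.Complex_Analysis"
begin

text \<open>On a ball of radius \<open>R\<close> the metric \<open>g\<close> is bounded below by a multiple \<open>\<epsilon> R\<close> of the Euclidean
  metric. A path that leaves every ball therefore has infinite \<open>g\<close>-length as soon as, in infinitely
  many shells \<open>R \<le> \<bar>z\<bar> \<le> R + 1\<close>, it is forced to make a Euclidean detour whose length is large
  compared with \<open>1 / \<epsilon> R\<close>. Such a detour is forced by a labyrinth (\<open>labyrinth_exists\<close>): a finite
  union \<open>\<Gamma>\<close> of small flat discs tangent to concentric spheres, which every path that crosses the shell
  along a short route must hit.

  It suffices to find an automorphism \<open>\<Phi>\<close> such that the image of every leaf through the ball of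
  radius \<open>n\<close> misses a labyrinth \<open>\<Gamma> n\<close>. In terms of the inverse \<open>\<Psi>\<close> this says that \<open>\<Psi>\<close> maps \<open>\<Gamma> n\<close>
  into the complement \<open>W n\<close> of the hull of these leaves, and properness of the foliation gives exactly
  what is needed of \<open>W n\<close>: it is open and unbounded.

  The automorphism is an infinite composition. The discs of a labyrinth can be listed so that each
  is separated by a real hyperplane from the inner ball and from the discs before it, so the discs can
  be moved one at a time (\<open>push_stack_into_unbounded_open\<close>). To move one compact set \<open>G\<close> into an
  unbounded open set while nearly fixing a compact set \<open>C\<close> on the other side of a hyperplane
  (\<open>push_into_unbounded_open\<close>), a shear \<open>z + f(\<lambda>(z)) v\<close> with \<open>\<lambda>(v) = 0\<close> is used, where the polynomial
  \<open>f\<close> is almost \<open>0\<close> on \<open>\<lambda>(C)\<close> and almost \<open>1\<close> on \<open>\<lambda>(G)\<close>; with \<open>v\<close> large it takes \<open>G\<close> far from \<open>C\<close>. Then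
  some coordinate alone separates \<open>G\<close> from \<open>C\<close>, and maps that keep this coordinate and contract
  and translate the others (\<open>reach_coordinate\<close>) shrink \<open>G\<close> and bring it to the prescribed place.
  The polynomials come from Runge's theorem for two disjoint discs
  (\<open>polynomial_separating_discs\<close>). The errors are chosen so small that the partial compositions and
  their inverses both converge locally uniformly, which makes the limit an automorphism, and that the
  inclusions achieved at earlier steps survive in the limit (\<open>automorphism_pulling_labyrinths\<close>).\<close>

section \<open>Polynomial separation of two discs\<close>

text \<open>Membership in the uniform closure of the polynomials on \<open>K\<close>. On a compact set this is an algebra, and
  it is closed under pole pushing; together these facts give the special case of Runge's theorem that is needed.\<close>

definition poly_approx :: "complex set \<Rightarrow> (complex \<Rightarrow> complex) \<Rightarrow> bool" where
  "poly_approx K f \<longleftrightarrow> (\<forall>e>0. \<exists>p. \<forall>z\<in>K. cmod (f z - poly p z) < e)"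

lemma poly_approx_poly: "poly_approx K (poly p)"
  unfolding poly_approx_def by (intro allI impI exI[of _ p]) auto

lemma poly_approx_cong: "poly_approx K f \<Longrightarrow> (\<And>z. z \<in> K \<Longrightarrow> f z = g z) \<Longrightarrow> poly_approx K g"
  unfolding poly_approx_def by metis

lemma poly_approx_const: "poly_approx K (\<lambda>z. c)"
  using poly_approx_poly[of K "[:c:]"] by (rule poly_approx_cong) simp

lemma poly_approx_ident: "poly_approx K (\<lambda>z. z)"
  using poly_approx_poly[of K "[:0,1:]"] by (rule poly_approx_cong) simp

lemma poly_approx_closed:
  assumes "\<And>e. e > 0 \<Longrightarrow> \<exists>g. poly_approx K g \<and> (\<forall>z\<in>K. cmod (f z - g z) < e)"
  shows "poly_approx K f"
  unfolding poly_approx_def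
proof (intro allI impI)
  fix e :: real assume "e > 0"
  then obtain g where g: "poly_approx K g" "\<forall>z\<in>K. cmod (f z - g z) < e/2"
    using assms[of "e/2"] by auto
  then obtain p where p: "\<forall>z\<in>K. cmod (g z - poly p z) < e/2"
    unfolding poly_approx_def using \<open>e > 0\<close> by (meson half_gt_zero)
  have "cmod (f z - poly p z) < e" if "z \<in> K" for z
    using norm_triangle_ineq[of "f z - g z" "g z - poly p z"] g p that by fastforce
  thus "\<exists>p. \<forall>z\<in>K. cmod (f z - poly p z) < e" by blast
qed

lemma poly_approx_add:
  assumes "poly_approx K f" "poly_approx K g"
  shows "poly_approx K (\<lambda>z. f z + g z)"
  unfolding poly_approx_def
proof (intro allI impI)
  fix e :: real assume "e > 0"
  then obtain p q where p: "\<forall>z\<in>K. cmod (f z - poly p z) < e/2" and q: "\<forall>z\<in>K. cmod (g z - poly q z) < e/2"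
    using assms unfolding poly_approx_def by (meson half_gt_zero)
  have "cmod (f z + g z - poly (p+q) z) < e" if "z \<in> K" for z
    using norm_triangle_ineq[of "f z - poly p z" "g z - poly q z"] p q that
    by (fastforce simp: algebra_simps)
  thus "\<exists>p. \<forall>z\<in>K. cmod (f z + g z - poly p z) < e" by blast
qed

lemma poly_approx_bounded:
  assumes "compact K" "poly_approx K f"
  shows "\<exists>B>0. \<forall>z\<in>K. cmod (f z) \<le> B"
proof -
  obtain p where p: "\<forall>z\<in>K. cmod (f z - poly p z) < 1"
    using assms(2) unfolding poly_approx_def by (meson zero_less_one)
  have "compact (poly p ` K)"
    by (intro compact_continuous_image assms continuous_intros)
  then obtain B where "\<forall>z\<in>K. cmod (poly p z) \<le> B"
    using compact_imp_bounded bounded_iff by (metis (no_types, lifting) imageI)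
  hence "\<forall>z\<in>K. cmod (f z) \<le> \<bar>B\<bar> + 1"
    using p by (smt (verit) norm_triangle_sub)
  thus ?thesis by (intro exI[of _ "\<bar>B\<bar> + 1"]) auto
qed

lemma poly_approx_mult:
  assumes K: "compact K" and "poly_approx K f" "poly_approx K g"
  shows "poly_approx K (\<lambda>z. f z * g z)"
proof (rule poly_approx_closed)
  fix e :: real assume e: "e > 0"
  obtain B where B: "B > 0" "\<forall>z\<in>K. cmod (g z) \<le> B" using poly_approx_bounded[OF K assms(3)] by auto
  obtain p where p: "\<forall>z\<in>K. cmod (f z - poly p z) < e/(2*B)"
    using assms(2) e B unfolding poly_approx_def by (metis divide_pos_pos zero_less_mult_iff zero_less_numeral)
  obtain C where C: "C > 0" "\<forall>z\<in>K. cmod (poly p z) \<le> C"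
    using poly_approx_bounded[OF K poly_approx_poly] by auto
  obtain q where q: "\<forall>z\<in>K. cmod (g z - poly q z) < e/(2*C)"
    using assms(3) e C unfolding poly_approx_def by (metis divide_pos_pos zero_less_mult_iff zero_less_numeral)
  have "cmod (f z * g z - poly (p*q) z) < e" if z: "z \<in> K" for z
  proof -
    have "f z * g z - poly (p*q) z = (f z - poly p z) * g z + poly p z * (g z - poly q z)"
      by (simp add: algebra_simps)
    hence "cmod (f z * g z - poly (p*q) z) \<le> cmod (f z - poly p z) * cmod (g z) + cmod (poly p z) * cmod (g z - poly q z)"
      by (metis norm_mult norm_triangle_ineq)
    moreover have "cmod (f z - poly p z) * cmod (g z) \<le> cmod (f z - poly p z) * B"
      using B z by (intro mult_left_mono) auto
    moreover have "cmod (f z - poly p z) * B < e/(2*B) * B"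
      using p z B by (intro mult_strict_right_mono) auto
    moreover have "cmod (poly p z) * cmod (g z - poly q z) \<le> C * (e/(2*C))"
      using C q z by (intro mult_mono) (auto intro: less_imp_le)
    ultimately show ?thesis using B C by (simp add: field_simps)
  qed
  thus "\<exists>h. poly_approx K h \<and> (\<forall>z\<in>K. cmod (f z * g z - h z) < e)"
    using poly_approx_poly by blast
qed

lemma poly_approx_power: "compact K \<Longrightarrow> poly_approx K f \<Longrightarrow> poly_approx K (\<lambda>z. f z ^ n)"
  by (induction n) (auto intro: poly_approx_const poly_approx_mult)

lemma poly_approx_sum:
  "(\<And>i. i \<in> I \<Longrightarrow> poly_approx K (f i)) \<Longrightarrow> poly_approx K (\<lambda>z. \<Sum>i\<in>I. f i z)"
  by (induction I rule: infinite_finite_induct) (auto intro: poly_approx_const poly_approx_add)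

text \<open>Neumann series: the partial sums of \<open>\<Sum>k. g z ^ k\<close> converge uniformly because the ratio is bounded by \<open>q < 1\<close>.\<close>

lemma poly_approx_geometric:
  assumes K: "compact K" and g: "poly_approx K g" and q: "q < 1" "\<And>z. z \<in> K \<Longrightarrow> cmod (g z) \<le> q"
  shows "poly_approx K (\<lambda>z. 1 / (1 - g z))"
proof (rule poly_approx_closed)
  fix e :: real assume e: "e > 0"
  obtain n where n: "K = {} \<or> \<bar>q\<bar> ^ n < e * (1 - q)"
  proof (cases "K = {}")
    case False
    then have "q \<ge> 0" using q(2) by (meson ex_in_conv norm_ge_zero order_trans)
    then show ?thesis using real_arch_pow_inv[of "e * (1-q)" "\<bar>q\<bar>"] q e that by auto
  qed auto
  let ?h = "\<lambda>z. \<Sum>k<n. g z ^ k"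
  have "cmod (1 / (1 - g z) - ?h z) < e" if z: "z \<in> K" for z
  proof -
    have q0: "q \<ge> 0" using q(2)[OF z] norm_ge_zero order_trans by blast
    have ne: "g z \<noteq> 1" using q z by fastforce
    have "1 / (1 - g z) - ?h z = g z ^ n / (1 - g z)"
      using ne by (simp add: sum_gp_strict field_simps)
    hence "cmod (1 / (1 - g z) - ?h z) = cmod (g z) ^ n / cmod (1 - g z)"
      by (simp add: norm_divide norm_power)
    also have "\<dots> \<le> q ^ n / (1 - q)"
    proof (rule frac_le)
      show "cmod (g z) ^ n \<le> q ^ n" using q(2)[OF z] by (simp add: power_mono)
      show "1 - q \<le> cmod (1 - g z)" using q(2)[OF z] norm_triangle_ineq2[of 1 "g z"] by simp
    qed (use q q0 in auto)
    also have "\<dots> < e" using n z q q0 by (auto simp: field_simps)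
    finally show ?thesis .
  qed
  moreover have "poly_approx K ?h" by (intro poly_approx_sum poly_approx_power K g)
  ultimately show "\<exists>h. poly_approx K h \<and> (\<forall>z\<in>K. cmod (1 / (1 - g z) - h z) < e)" by blast
qed

lemma poly_approx_far_pole:
  assumes K: "compact K" "\<And>z. z \<in> K \<Longrightarrow> cmod z \<le> B" "cmod a > B" "B \<ge> 0"
  shows "poly_approx K (\<lambda>z. 1 / (z - a))"
proof -
  have a: "a \<noteq> 0" using assms by auto
  have "poly_approx K (\<lambda>z. 1 / (1 - (1/a) * z))"
  proof (rule poly_approx_geometric[OF K(1), where q = "B / cmod a"])
    show "poly_approx K (\<lambda>z. (1/a) * z)"
      by (intro poly_approx_mult poly_approx_const poly_approx_ident K)
    show "B / cmod a < 1" using assms(3) a by (simp add: divide_less_eq)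
    show "cmod (1 / a * z) \<le> B / cmod a" if "z \<in> K" for z
      using K(2)[OF that] by (simp add: norm_divide norm_mult divide_right_mono)
  qed
  hence "poly_approx K (\<lambda>z. (-1/a) * (1 / (1 - (1/a) * z)))"
    by (intro poly_approx_mult poly_approx_const K)
  thus ?thesis
  proof (rule poly_approx_cong)
    fix z assume "z \<in> K"
    hence "z \<noteq> a" using K by force
    thus "- 1 / a * (1 / (1 - 1 / a * z)) = 1 / (z - a)" using a by (simp add: field_simps)
  qed
qed

text \<open>A pole may be moved by less than its distance to \<open>K\<close>, since
  \<open>1 / (z - b) = 1 / (z - a) * 1 / (1 - (b - a) / (z - a))\<close> and the last factor is a geometric series.\<close>

lemma poly_approx_shift_pole:
  assumes K: "compact K" and a: "poly_approx K (\<lambda>z. 1 / (z - a))"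
    and d: "\<And>z. z \<in> K \<Longrightarrow> d \<le> dist z a" and b: "dist a b < d"
  shows "poly_approx K (\<lambda>z. 1 / (z - b))"
proof -
  have d0: "d > 0" using b zero_le_dist[of a b] by linarith
  have "poly_approx K (\<lambda>z. 1 / (1 - (b - a) * (1 / (z - a))))"
  proof (rule poly_approx_geometric[OF K, where q = "dist a b / d"])
    show "poly_approx K (\<lambda>z. (b - a) * (1 / (z - a)))"
      by (intro poly_approx_mult poly_approx_const a K)
    show "dist a b / d < 1" using b d0 by simp
    show "cmod ((b - a) * (1 / (z - a))) \<le> dist a b / d" if "z \<in> K" for z
      using d[OF that] d0 by (auto simp: norm_divide dist_norm norm_minus_commute intro!: divide_left_mono mult_pos_pos)
  qed
  hence "poly_approx K (\<lambda>z. 1 / (z - a) * (1 / (1 - (b - a) * (1 / (z - a)))))"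
    by (intro poly_approx_mult a K)
  thus ?thesis
  proof (rule poly_approx_cong)
    fix z assume "z \<in> K"
    hence "dist z a \<ge> d" by (rule d)
    hence "z \<noteq> a" "z \<noteq> b" using d0 b by (auto simp: dist_commute)
    thus "1 / (z - a) * (1 / (1 - (b - a) * (1 / (z - a)))) = 1 / (z - b)"
      by (simp add: divide_simps)
  qed
qed

text \<open>The ray keeps distance \<open>d\<close> from \<open>K\<close>, so the pole can be moved from a far point of the ray, where the
  geometric series in \<open>z / a\<close> converges, back to \<open>a\<close> in finitely many steps of length \<open>d / 2\<close>.\<close>

lemma poly_approx_ray_pole:
  assumes K: "compact K" and u: "cmod u = 1" and d: "d > 0"
    and ray: "\<And>z t. z \<in> K \<Longrightarrow> 0 \<le> t \<Longrightarrow> d \<le> dist z (a + of_real t * u)"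
  shows "poly_approx K (\<lambda>z. 1 / (z - a))"
proof -
  obtain B where B: "B > 0" "\<And>z. z \<in> K \<Longrightarrow> cmod z \<le> B"
    using compact_imp_bounded[OF K] bounded_pos by metis
  obtain n where n: "real n * (d/2) > B + cmod a"
    using d reals_Archimedean3[of "d/2"] by (meson half_gt_zero)
  have "poly_approx K (\<lambda>z. 1 / (z - (a + of_real (real (n - j) * (d/2)) * u)))" for j
  proof (induction j)
    case 0
    have "cmod (of_real (real n * (d/2)) * u) = real n * (d/2)"
      using u d by (simp only: norm_mult norm_of_real) simp
    moreover have "cmod (of_real (real n * (d/2)) * u) \<le> cmod (a + of_real (real n * (d/2)) * u) + cmod a"
      using norm_triangle_ineq4[of "a + of_real (real n * (d/2)) * u" a] by simp
    ultimately have "cmod (a + of_real (real n * (d/2)) * u) > B" using n by linarith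
    thus ?case using B by (intro poly_approx_far_pole[OF K]) auto
  next
    case (Suc j)
    show ?case
    proof (rule poly_approx_shift_pole[OF K Suc.IH])
      show "d \<le> dist z (a + complex_of_real (real (n - j) * (d / 2)) * u)" if "z \<in> K" for z
        using that d by (intro ray) auto
      have "dist (a + complex_of_real (real (n - j) * (d / 2)) * u) (a + complex_of_real (real (n - Suc j) * (d / 2)) * u)
        = cmod (of_real ((real (n - j) - real (n - Suc j)) * (d/2)) * u)"
        by (simp add: dist_norm algebra_simps)
      also have "\<dots> = \<bar>(real (n - j) - real (n - Suc j)) * (d/2)\<bar>"
        using u by (simp only: norm_mult norm_of_real)
      also have "\<dots> \<le> 1 * (d/2)" unfolding abs_mult using d by (intro mult_mono) auto
      finally show "dist (a + complex_of_real (real (n - j) * (d / 2)) * u) (a + complex_of_real (real (n - Suc j) * (d / 2)) * u) < d"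
        using d by simp
    qed
  qed
  from this[of n] show ?thesis by simp
qed

text \<open>The reciprocal of a polynomial is a product of simple poles, so approximating each of these is enough.\<close>

lemma poly_approx_inverse_poly:
  assumes K: "compact K" and p: "p \<noteq> 0"
    and roots: "\<And>a. poly p a = 0 \<Longrightarrow> poly_approx K (\<lambda>z. 1 / (z - a))"
  shows "poly_approx K (\<lambda>z. 1 / poly p z)"
  using p roots
proof (induction "degree p" arbitrary: p)
  case 0
  then obtain c where "p = [:c:]" by (metis degree_eq_zeroE)
  thus ?case using poly_approx_const[of K "1/c"] by simp
next
  case (Suc n)
  have "coeff p (degree p) \<noteq> 0" using Suc.prems(1) by simp
  moreover have "degree p \<in> {1..degree p}" using Suc.hyps(2) by auto
  ultimately have "\<exists>i\<in>{1..degree p}. coeff p i \<noteq> 0" by blast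
  then obtain a where "(\<Sum>i\<le>degree p. coeff p i * a ^ i) = 0"
    using fundamental_theorem_of_algebra[of "coeff p" "degree p"] by blast
  hence a: "poly p a = 0" by (simp add: poly_altdef)
  then obtain q where q: "p = [:-a,1:] * q" by (metis dvdE poly_eq_0_iff_dvd)
  have "q \<noteq> 0" using Suc.prems q by auto
  hence "degree p = Suc (degree q)" unfolding q by (subst degree_mult_eq) auto
  hence "poly_approx K (\<lambda>z. 1 / poly q z)"
    using Suc \<open>q \<noteq> 0\<close> q by (intro Suc.hyps(1)) auto
  hence "poly_approx K (\<lambda>z. 1 / (z - a) * (1 / poly q z))"
    using Suc.prems(2)[OF a] by (intro poly_approx_mult K)
  thus ?case unfolding q by (simp add: algebra_simps)
qed

text \<open>On the two discs the function \<open>1 / (1 - ((z - b) / \<rho>) ^ N)\<close> tends to \<open>0\<close> and \<open>1\<close>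
  if the circle of radius \<open>\<rho>\<close> about \<open>b\<close> passes between them. Its poles lie on that circle, and each of
  them can be pushed to infinity along a ray orthogonal to the line of centres that points away from
  \<open>b\<close>. Such a ray does not come nearer to \<open>b\<close>, and its projection to the line of centres stays outside
  the other disc.\<close>

lemma polynomial_separating_discs:
  fixes a b :: complex
  assumes disj: "r + s < dist a b" and "r \<ge> 0" "s \<ge> 0" and e: "e > 0"
  obtains p where "\<And>z. z \<in> cball a r \<Longrightarrow> cmod (poly p z) < e"
    and "\<And>z. z \<in> cball b s \<Longrightarrow> cmod (poly p z - 1) < e"
proof -
  define K where "K = cball a r \<union> cball b s"
  have K: "compact K" unfolding K_def by (intro compact_Un compact_cball)
  define \<rho> where "\<rho> = (s + (dist a b - r)) / 2"
  have \<rho>: "s < \<rho>" "\<rho> < dist a b - r" "\<rho> > 0" using assms unfolding \<rho>_def by auto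
  have ab: "a \<noteq> b" using assms by auto
  have pole: "poly_approx K (\<lambda>z. 1 / (z - c))" if c: "dist c b = \<rho>" for c
  proof -
    define w where "w = (b - a) / of_real (dist a b)"
    have w: "cmod w = 1" using ab unfolding w_def by (simp add: norm_divide dist_norm norm_minus_commute)
    have wab: "inner (b - a) w = dist a b"
    proof -
      have "b - a = dist a b *\<^sub>R w" using ab unfolding w_def by (simp add: scaleR_conv_of_real)
      hence "inner (b - a) w = dist a b * inner w w" by simp
      thus ?thesis using w by (simp add: dot_square_norm)
    qed
    define u where "u = (if inner (c - b) (\<i> * w) \<ge> 0 then \<i> * w else - (\<i> * w))"
    have u: "cmod u = 1" using w unfolding u_def by (auto simp: norm_mult)
    have uc: "inner (c - b) u \<ge> 0" unfolding u_def by auto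
    have uw: "inner u w = 0" unfolding u_def by (auto simp: inner_complex_def)
    define d where "d = min (\<rho> - s) (dist a b - \<rho> - r)"
    show ?thesis
    proof (rule poly_approx_ray_pole[OF K u, where d = d])
      show "d > 0" using \<rho> unfolding d_def by auto
      fix z :: complex and t :: real assume z: "z \<in> K" and t: "0 \<le> t"
      define y where "y = c + of_real t * u"
      have "\<rho>\<^sup>2 \<le> (dist y b)\<^sup>2"
      proof -
        have "y - b = (c - b) + t *\<^sub>R u" unfolding y_def by (simp add: scaleR_conv_of_real)
        then have "(dist y b)\<^sup>2 = inner ((c - b) + t *\<^sub>R u) ((c - b) + t *\<^sub>R u)"
          unfolding dist_norm power2_norm_eq_inner by metis
        also have "\<dots> = inner (c - b) (c - b) + 2 * t * inner (c - b) u + t\<^sup>2 * inner u u"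
          unfolding inner_add_left inner_add_right inner_scaleR_left inner_scaleR_right
          by (simp add: inner_commute power2_eq_square distrib_left mult.assoc)
        also have "inner (c - b) (c - b) = \<rho>\<^sup>2"
          using c unfolding power2_norm_eq_inner[symmetric] dist_norm by simp
        also have "\<rho>\<^sup>2 + 2 * t * inner (c - b) u + t\<^sup>2 * inner u u \<ge> \<rho>\<^sup>2" using t uc by simp
        finally show ?thesis .
      qed
      hence yb: "dist y b \<ge> \<rho>" using \<rho> by (metis power2_le_imp_le zero_le_dist)
      have ya: "dist y a \<ge> dist a b - \<rho>"
      proof -
        have "y - a = (c - b) + (b - a) + t *\<^sub>R u" unfolding y_def by (simp add: scaleR_conv_of_real)
        hence "inner (y - a) w = inner (c - b) w + dist a b" using uw wab by (simp only: inner_add_left inner_scaleR_left)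
        moreover have "\<bar>inner (c - b) w\<bar> \<le> \<rho>"
          using Cauchy_Schwarz_ineq2[of "c - b" w] w c by (simp add: dist_norm)
        moreover have "inner (y - a) w \<le> dist y a"
          using norm_cauchy_schwarz[of "y - a" w] w by (simp add: dist_norm)
        ultimately show ?thesis by linarith
      qed
      show "d \<le> dist z (c + of_real t * u)"
        using z ya yb dist_triangle[of y b z] dist_triangle[of y a z]
        unfolding y_def[symmetric] K_def d_def by (auto simp: dist_commute)
    qed
  qed
  define q where "q = max (s / \<rho>) (\<rho> / (dist a b - r))"
  have q: "q < 1" using \<rho> assms unfolding q_def by (auto simp: field_simps)
  have "0 \<le> s / \<rho>" using \<rho> assms by simp
  hence q0: "0 \<le> q" unfolding q_def by linarith
  define e' where "e' = min (e/4) (1/2)"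
  have e': "e' > 0" "e' \<le> e/4" "e' \<le> 1/2" using e unfolding e'_def by auto
  obtain N0 where N0: "q ^ N0 < e'" using real_arch_pow_inv[of e' q] q q0 e' by auto
  define N where "N = Suc N0"
  have N: "q ^ N < e'" using N0 q q0 power_decreasing[of N0 N q] unfolding N_def by simp
  define P where "P = 1 - ([:-b, 1:] * [:1/of_real \<rho>:]) ^ N"
  have P: "poly P z = 1 - ((z - b) / of_real \<rho>) ^ N" for z unfolding P_def by (simp add: algebra_simps diff_divide_distrib)
  have "poly P b = 1" unfolding P N_def by simp
  hence "P \<noteq> 0" by auto
  moreover have "dist c b = \<rho>" if "poly P c = 0" for c
  proof -
    have "(cmod (c - b) / \<rho>) ^ N = 1"
    proof -
      have "((c - b) / of_real \<rho>) ^ N = 1" using that unfolding P by simp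
      hence "cmod ((c - b) / of_real \<rho>) ^ N = 1" by (metis norm_one norm_power)
      thus ?thesis using \<rho> by (simp add: norm_divide)
    qed
    hence "cmod (c - b) / \<rho> = 1"
      using \<rho> power_inject_base[of "cmod (c - b) / \<rho>" N0 1] unfolding N_def by simp
    thus ?thesis using \<rho> by (simp add: dist_norm)
  qed
  ultimately have "poly_approx K (\<lambda>z. 1 / poly P z)"
    using pole by (intro poly_approx_inverse_poly K) auto
  then obtain p where p: "\<And>z. z \<in> K \<Longrightarrow> cmod (1 / poly P z - poly p z) < e/4"
    using e unfolding poly_approx_def by (meson divide_pos_pos zero_less_numeral)
  show thesis
  proof (rule that)
    fix z assume z: "z \<in> cball b s"
    define x where "x = ((z - b) / of_real \<rho>) ^ N"
    have "cmod ((z - b) / of_real \<rho>) \<le> s / \<rho>"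
      using z \<rho> by (simp add: norm_divide dist_norm norm_minus_commute divide_right_mono)
    hence "cmod ((z - b) / of_real \<rho>) \<le> q" unfolding q_def by linarith
    hence "cmod x \<le> q ^ N" unfolding x_def by (simp add: norm_power power_mono)
    hence x: "cmod x < e'" using N by linarith
    hence x1: "cmod (1 - x) \<ge> 1/2" using e' norm_triangle_ineq2[of 1 x] by simp
    have "1 / (1 - x) - 1 = x / (1 - x)" proof -
      have "1 - x \<noteq> 0" using x1 by auto
      thus ?thesis by (simp add: divide_simps)
    qed
    hence "cmod (1 / (1 - x) - 1) = cmod x / cmod (1 - x)" by (simp add: norm_divide)
    also have "\<dots> \<le> e' / (1/2)" using x x1 e' by (intro frac_le) auto
    finally have "cmod (1 / poly P z - 1) \<le> e/2" using e' unfolding P x_def by simp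
    thus "cmod (poly p z - 1) < e"
      using p[of z] z e norm_triangle_ineq4[of "1 / poly P z - 1" "1 / poly P z - poly p z"] unfolding K_def by simp
  next
    fix z assume z: "z \<in> cball a r"
    define x where "x = ((z - b) / of_real \<rho>) ^ N"
    have zb: "dist a b - r \<le> cmod (z - b)"
      using z dist_triangle[of a b z] by (simp add: dist_norm)
    have "1 \<le> cmod ((z - b) / of_real \<rho>) * q"
    proof -
      have "1 = (dist a b - r) / \<rho> * (\<rho> / (dist a b - r))" using \<rho> by simp
      also have "\<dots> \<le> cmod ((z - b) / of_real \<rho>) * q"
        unfolding q_def using zb \<rho> by (intro mult_mono) (auto simp: norm_divide divide_right_mono)
      finally show ?thesis .
    qed
    hence "1 \<le> (cmod ((z - b) / of_real \<rho>) * q) ^ N" by simp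
    also have "\<dots> = cmod x * q ^ N" unfolding x_def by (simp add: power_mult_distrib norm_power)
    also have "\<dots> \<le> cmod x * e'" using N by (intro mult_left_mono) auto
    finally have x: "1 / e' \<le> cmod x" using e' by (simp add: field_simps)
    have "2 \<le> 1 / e'" using e' by (simp add: field_simps)
    hence x1: "cmod (1 - x) \<ge> 1 / (2 * e')"
      using x norm_triangle_ineq2[of x 1] by (simp add: norm_minus_commute field_simps)
    have "cmod (1 / (1 - x)) = 1 / cmod (1 - x)" by (simp add: norm_divide)
    also have "\<dots> \<le> 1 / (1 / (2 * e'))" using x1 e' by (intro frac_le) auto
    finally have "cmod (1 / poly P z) \<le> e/2" using e' unfolding P x_def by simp
    thus "cmod (poly p z) < e"
      using p[of z] z e norm_triangle_ineq4[of "1 / poly P z" "1 / poly P z - poly p z"] unfolding K_def by simp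
  qed
qed


section \<open>Holomorphic maps of several variables and their limits\<close>

lemma holo_fun_on_const: "holo_fun_on (\<lambda>z. c) U"
  unfolding holo_fun_on_def by (intro ballI exI[of _ "\<lambda>_. 0"]) auto

lemma holo_fun_on_coord: "holo_fun_on (\<lambda>z. z $ i) U"
  unfolding holo_fun_on_def
  by (intro ballI exI[of _ "\<lambda>v. v $ i"]) (auto intro: bounded_linear_imp_has_derivative bounded_linear_vec_nth)

lemma holo_fun_on_add:
  assumes "holo_fun_on f U" "holo_fun_on g U"
  shows "holo_fun_on (\<lambda>z. f z + g z) U"
  unfolding holo_fun_on_def
proof
  fix z assume "z \<in> U"
  then obtain D E where "(f has_derivative D) (at z)" "\<forall>c v. D (c *s v) = c * D v"
    "(g has_derivative E) (at z)" "\<forall>c v. E (c *s v) = c * E v"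
    using assms unfolding holo_fun_on_def by meson
  thus "\<exists>D. ((\<lambda>z. f z + g z) has_derivative D) (at z) \<and> (\<forall>c v. D (c *s v) = c * D v)"
    by (intro exI[of _ "\<lambda>v. D v + E v"]) (auto intro: has_derivative_add simp: algebra_simps)
qed

lemma holo_fun_on_mult:
  assumes "holo_fun_on f U" "holo_fun_on g U"
  shows "holo_fun_on (\<lambda>z. f z * g z) U"
  unfolding holo_fun_on_def
proof
  fix z assume "z \<in> U"
  then obtain D E where "(f has_derivative D) (at z)" "\<forall>c v. D (c *s v) = c * D v"
    "(g has_derivative E) (at z)" "\<forall>c v. E (c *s v) = c * E v"
    using assms unfolding holo_fun_on_def by meson
  thus "\<exists>D. ((\<lambda>z. f z * g z) has_derivative D) (at z) \<and> (\<forall>c v. D (c *s v) = c * D v)"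
    by (intro exI[of _ "\<lambda>v. f z * E v + D v * g z"] conjI has_derivative_mult) (auto simp: algebra_simps)
qed

lemma holo_fun_on_sum:
  "(\<And>i. i \<in> I \<Longrightarrow> holo_fun_on (f i) U) \<Longrightarrow> holo_fun_on (\<lambda>z. \<Sum>i\<in>I. f i z) U"
  by (induction I rule: infinite_finite_induct) (auto intro: holo_fun_on_const holo_fun_on_add)

lemma holo_fun_on_entire:
  assumes "holo_fun_on f U" "g holomorphic_on UNIV"
  shows "holo_fun_on (\<lambda>z. g (f z)) U"
  unfolding holo_fun_on_def
proof
  fix z assume "z \<in> U"
  then obtain D where D: "(f has_derivative D) (at z)" "\<forall>c v. D (c *s v) = c * D v"
    using assms unfolding holo_fun_on_def by meson
  have "(g has_field_derivative deriv g (f z)) (at (f z))"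
    using assms(2) by (simp add: holomorphic_derivI)
  hence "(g has_derivative (\<lambda>w. deriv g (f z) * w)) (at (f z))"
    by (simp add: has_field_derivative_def)
  hence "((\<lambda>z. g (f z)) has_derivative (\<lambda>v. deriv g (f z) * D v)) (at z)"
    using D(1) has_derivative_compose by blast
  thus "\<exists>D. ((\<lambda>z. g (f z)) has_derivative D) (at z) \<and> (\<forall>c v. D (c *s v) = c * D v)"
    using D(2) by (intro exI[of _ "\<lambda>v. deriv g (f z) * D v"]) auto
qed

lemma has_derivative_vec_componentwise:
  fixes f :: "'a::real_normed_vector \<Rightarrow> complex ^ 'n"
  assumes "\<And>i. ((\<lambda>z. f z $ i) has_derivative (\<lambda>v. D v $ i)) (at z)"
  shows "(f has_derivative D) (at z)"
  unfolding has_derivative_componentwise_within[of f]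
proof
  fix b :: "complex ^ 'n" assume "b \<in> Basis"
  then obtain i u where b: "b = axis i u" by (auto simp: Basis_vec_def)
  show "((\<lambda>x. f x \<bullet> b) has_derivative (\<lambda>x. D x \<bullet> b)) (at z)"
    using has_derivative_inner_left[OF assms[of i], of u] unfolding b inner_axis .
qed

lemma holo_map_on_derivative:
  fixes f :: "complex ^ 'n \<Rightarrow> complex ^ 'm"
  assumes "holo_map_on f U" "z \<in> U"
  obtains D where "(f has_derivative D) (at z)" "\<And>c v. D (c *s v) = c *s D v"
proof -
  have "\<forall>i. \<exists>D. ((\<lambda>z. f z $ i) has_derivative D) (at z) \<and> (\<forall>c v. D (c *s v) = c * D v)"
    using assms unfolding holo_map_on_def holo_fun_on_def by blast
  then obtain D where D: "\<And>i. ((\<lambda>z. f z $ i) has_derivative D i) (at z)"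
    "\<And>i c v. D i (c *s v) = c * D i v" by metis
  have "(f has_derivative (\<lambda>v. \<chi> i. D i v)) (at z)"
    using D(1) by (intro has_derivative_vec_componentwise) simp
  moreover have "(\<chi> i. D i (c *s v)) = c *s (\<chi> i. D i v)" for c v
    using D(2) by (simp add: vec_eq_iff)
  ultimately show thesis using that by blast
qed

lemma holo_map_on_imp_continuous_on:
  fixes f :: "complex ^ 'n \<Rightarrow> complex ^ 'm"
  shows "holo_map_on f UNIV \<Longrightarrow> continuous_on S f"
  by (metis UNIV_I continuous_at_imp_continuous_on has_derivative_continuous holo_map_on_derivative)

lemma holo_map_on_compose:
  assumes "holo_map_on f UNIV" "holo_map_on g UNIV"
  shows "holo_map_on (\<lambda>z. f (g z)) UNIV"
  unfolding holo_map_on_def holo_fun_on_def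
proof (intro allI ballI)
  fix i z
  obtain D where D: "(g has_derivative D) (at z)" "\<And>c v. D (c *s v) = c *s D v"
    using holo_map_on_derivative[OF assms(2)] by blast
  obtain E where E: "((\<lambda>z. f z $ i) has_derivative E) (at (g z))" "\<And>c v. E (c *s v) = c * E v"
    using assms(1) unfolding holo_map_on_def holo_fun_on_def by blast
  show "\<exists>D. ((\<lambda>z. f (g z) $ i) has_derivative D) (at z) \<and> (\<forall>c v. D (c *s v) = c * D v)"
    using has_derivative_compose[OF D(1) E(1)] D(2) E(2) by (intro exI[of _ "\<lambda>v. E (D v)"]) auto
qed

lemma holo_fun_on_line:
  fixes f :: "complex ^ 'n \<Rightarrow> complex"
  assumes "(f has_derivative D) (at (z + t *s v))" "\<And>c v. D (c *s v) = c * D v"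
  shows "((\<lambda>t. f (z + t *s v)) has_field_derivative D v) (at t)"
proof -
  have "((\<lambda>t. z + t *s v) has_derivative (\<lambda>t. t *s v)) (at t)"
    by (rule has_derivative_vec_componentwise) (auto intro!: derivative_eq_intros)
  from has_derivative_compose[OF this assms(1)]
  show ?thesis unfolding has_field_derivative_def assms(2) by (simp only: mult_commute_abs)
qed

lemma norm_vector_smult_complex: "norm (c *s (v :: complex ^ 'n)) = cmod c * norm v"
  unfolding norm_vec_def by (simp add: norm_mult L2_set_right_distrib)

text \<open>Cauchy's estimate on the complex line through \<open>z\<close> in direction \<open>v\<close>.\<close>

lemma holo_derivative_bound:
  fixes f :: "complex ^ 'n \<Rightarrow> complex"
  assumes f: "holo_fun_on f UNIV" and D: "(f has_derivative D) (at z)" "\<And>c v. D (c *s v) = c * D v"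
    and B: "\<And>w. w \<in> cball z 1 \<Longrightarrow> cmod (f w) \<le> B"
  shows "cmod (D v) \<le> B * norm v"
proof (cases "v = 0")
  case True
  then show ?thesis using D(2)[of 0 v] by simp
next
  case False
  define \<phi> where "\<phi> = (\<lambda>t. f (z + t *s v))"
  define r where "r = 1 / norm v"
  have r: "r > 0" using False unfolding r_def by simp
  have der: "\<phi> field_differentiable (at t)" for t
  proof -
    obtain E where "(f has_derivative E) (at (z + t *s v))" "\<And>c v. E (c *s v) = c * E v"
      using f unfolding holo_fun_on_def by blast
    from holo_fun_on_line[OF this] show ?thesis unfolding \<phi>_def field_differentiable_def by blast
  qed
  hence hol: "\<phi> holomorphic_on S" for S
    by (simp add: field_differentiable_at_within holomorphic_on_def)
  have bd: "cmod (\<phi> t) \<le> B" if "cmod (0 - t) = r" for t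
  proof -
    have "norm (t *s v) = 1" using that False unfolding norm_vector_smult_complex r_def by simp
    thus ?thesis unfolding \<phi>_def by (intro B) (simp add: dist_norm)
  qed
  have "cmod ((deriv ^^ 1) \<phi> 0) \<le> fact 1 * B / r ^ 1"
    by (rule Cauchy_inequality[OF hol holomorphic_on_imp_continuous_on[OF hol] r bd])
  moreover have "deriv \<phi> 0 = D v"
    unfolding \<phi>_def by (rule DERIV_imp_deriv, rule holo_fun_on_line) (use D in auto)
  ultimately show ?thesis unfolding r_def by simp
qed

text \<open>Weierstrass' theorem in several variables: by Cauchy's estimate the derivatives converge uniformly
  near each point, so the limit is differentiable with the limit of the derivatives as its derivative, and
  complex linearity passes to the limit.\<close>

lemma holo_fun_on_uniform_limit:
  fixes f :: "nat \<Rightarrow> complex ^ 'n \<Rightarrow> complex"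
  assumes hol: "\<And>n. holo_fun_on (f n) UNIV"
    and lim: "\<And>R. uniform_limit (cball 0 R) f g sequentially"
  shows "holo_fun_on g UNIV"
  unfolding holo_fun_on_def
proof
  fix z0 :: "complex ^ 'n"
  obtain D where D: "\<And>n z. (f n has_derivative D n z) (at z)" "\<And>n z c v. D n z (c *s v) = c * D n z v"
    using hol unfolding holo_fun_on_def by (metis UNIV_I)
  define S where "S = ball z0 1"
  have cau: "\<exists>N. \<forall>m\<ge>N. \<forall>n\<ge>N. \<forall>z\<in>S. \<forall>v. cmod (D m z v - D n z v) \<le> e * norm v" if e: "e > 0" for e
  proof -
    have "uniformly_Cauchy_on (cball 0 (norm z0 + 2)) f"
      using lim uniformly_convergent_Cauchy uniformly_convergent_on_def by blast
    then obtain N where N: "\<And>x m n. x \<in> cball 0 (norm z0 + 2) \<Longrightarrow> m \<ge> N \<Longrightarrow> n \<ge> N \<Longrightarrow> dist (f m x) (f n x) < e"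
      using e unfolding uniformly_Cauchy_on_def by meson
    have "cmod (D m z v - D n z v) \<le> e * norm v" if mn: "m \<ge> N" "n \<ge> N" and z: "z \<in> S" for m n z v
    proof (rule holo_derivative_bound[where f = "\<lambda>z. f m z - f n z" and D = "\<lambda>v. D m z v - D n z v"])
      have "holo_fun_on (\<lambda>z. f m z + (-1) * f n z) UNIV"
        by (intro holo_fun_on_add holo_fun_on_mult holo_fun_on_const hol)
      thus "holo_fun_on (\<lambda>z. f m z - f n z) UNIV" by simp
      show "((\<lambda>z. f m z - f n z) has_derivative (\<lambda>v. D m z v - D n z v)) (at z)"
        by (intro has_derivative_diff D)
      show "D m z (c *s v) - D n z (c *s v) = c * (D m z v - D n z v)" for c v
        by (simp add: D algebra_simps)
      fix w assume "w \<in> cball z 1"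
      hence "norm w \<le> norm z0 + 2"
        using z norm_triangle_sub[of w z] norm_triangle_sub[of z z0] unfolding S_def
        by (auto simp: dist_norm norm_minus_commute)
      thus "cmod (f m w - f n w) \<le> e" using N[of w m n] mn by (auto simp: dist_norm intro: less_imp_le)
    qed
    thus ?thesis by blast
  qed
  have conv: "\<exists>L. (\<lambda>n. D n z v) \<longlonglongrightarrow> L" if z: "z \<in> S" for z v
  proof -
    have "Cauchy (\<lambda>n. D n z v)"
    proof (rule CauchyI)
      fix e :: real assume e: "e > 0"
      have "e / (norm v + 1) > 0" using e by (simp add: add_nonneg_pos)
      then obtain N where N: "\<forall>m\<ge>N. \<forall>n\<ge>N. \<forall>z\<in>S. \<forall>v'. cmod (D m z v' - D n z v') \<le> e / (norm v + 1) * norm v'"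
        using cau by blast
      have "e / (norm v + 1) * norm v < e"
      proof -
        have "norm v + 1 > 0" by (simp add: add_nonneg_pos)
        thus ?thesis using e by (simp add: divide_less_eq)
      qed
      thus "\<exists>M. \<forall>m\<ge>M. \<forall>n\<ge>M. norm (D m z v - D n z v) < e"
        using N z by (meson order_le_less_trans)
    qed
    thus ?thesis by (meson convergent_def Cauchy_convergent)
  qed
  then obtain E where E: "\<And>z v. z \<in> S \<Longrightarrow> (\<lambda>n. D n z v) \<longlonglongrightarrow> E z v" by metis
  have "\<exists>g'. \<forall>x\<in>S. (\<lambda>n. f n x) \<longlonglongrightarrow> g' x \<and> (g' has_derivative E x) (at x within S)"
  proof (rule has_derivative_sequence)
    show "convex S" unfolding S_def by simp
    show "\<And>n x. x \<in> S \<Longrightarrow> (f n has_derivative D n x) (at x within S)"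
      using D(1) has_derivative_at_withinI by blast
    show "z0 \<in> S" unfolding S_def by simp
    show "(\<lambda>n. f n z0) \<longlonglongrightarrow> g z0"
      using tendsto_uniform_limitI[OF lim[of "norm z0"]] by simp
    fix e :: real assume "e > 0"
    then obtain N where N: "\<forall>m\<ge>N. \<forall>n\<ge>N. \<forall>z\<in>S. \<forall>v'. cmod (D m z v' - D n z v') \<le> e * norm v'"
      using cau by blast
    have "cmod (D n x h - E x h) \<le> e * norm h" if n: "n \<ge> N" and x: "x \<in> S" for n x h
    proof (rule tendsto_upperbound)
      show "(\<lambda>m. cmod (D n x h - D m x h)) \<longlonglongrightarrow> cmod (D n x h - E x h)"
        by (intro tendsto_intros E x)
      show "\<forall>\<^sub>F m in sequentially. cmod (D n x h - D m x h) \<le> e * norm h"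
        using N n x unfolding eventually_sequentially by blast
    qed auto
    thus "\<forall>\<^sub>F n in sequentially. \<forall>x\<in>S. \<forall>h. norm (D n x h - E x h) \<le> e * norm h"
      by (auto simp: eventually_sequentially)
  qed
  then obtain g' where g': "\<And>x. x \<in> S \<Longrightarrow> (\<lambda>n. f n x) \<longlonglongrightarrow> g' x \<and> (g' has_derivative E x) (at x within S)" by blast
  have "g' x = g x" if "x \<in> S" for x
    using g'[OF that] tendsto_uniform_limitI[OF lim[of "norm x"], of x] LIMSEQ_unique by auto
  moreover have z0: "z0 \<in> S" and opS: "open S" unfolding S_def by auto
  ultimately have "(g has_derivative E z0) (at z0)"
    using g'[OF z0] has_derivative_transform_within_open[of g' "E z0" z0 UNIV S g] at_within_open[OF z0 opS] by auto
  moreover have "E z0 (c *s v) = c * E z0 v" for c v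
  proof (rule LIMSEQ_unique[OF E[OF z0]])
    show "(\<lambda>n. D n z0 (c *s v)) \<longlonglongrightarrow> c * E z0 v" unfolding D(2) by (intro tendsto_intros E z0)
  qed
  ultimately show "\<exists>D. (g has_derivative D) (at z0) \<and> (\<forall>c v. D (c *s v) = c * D v)" by blast
qed

text \<open>The inverse is carried along as a function of its own because every estimate below is needed for
  both directions.\<close>

definition aut_pair :: "(complex ^ 'n \<Rightarrow> complex ^ 'n) \<Rightarrow> (complex ^ 'n \<Rightarrow> complex ^ 'n) \<Rightarrow> bool" where
  "aut_pair \<Phi> \<Psi> \<longleftrightarrow> holo_map_on \<Phi> UNIV \<and> holo_map_on \<Psi> UNIV \<and> (\<forall>z. \<Psi> (\<Phi> z) = z) \<and> (\<forall>z. \<Phi> (\<Psi> z) = z)"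

lemma aut_pair_imp_automorphism:
  assumes "aut_pair \<Phi> \<Psi>"
  shows "holo_automorphism \<Phi>"
proof -
  have i: "inv \<Phi> = \<Psi>" using assms unfolding aut_pair_def by (intro inv_equality) auto
  have "bij \<Phi>" using assms unfolding aut_pair_def by (metis bij_iff)
  thus ?thesis using assms i unfolding aut_pair_def holo_automorphism_def by auto
qed

lemma aut_pair_id: "aut_pair (\<lambda>z. z) (\<lambda>z. z)"
  unfolding aut_pair_def holo_map_on_def by (auto intro: holo_fun_on_coord)

lemma aut_pair_compose:
  "aut_pair \<Phi> \<Psi> \<Longrightarrow> aut_pair \<Phi>' \<Psi>' \<Longrightarrow> aut_pair (\<lambda>z. \<Phi>' (\<Phi> z)) (\<lambda>z. \<Psi> (\<Psi>' z))"
  unfolding aut_pair_def by (auto intro: holo_map_on_compose)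

lemma aut_pair_sym: "aut_pair \<Phi> \<Psi> \<Longrightarrow> aut_pair \<Psi> \<Phi>"
  unfolding aut_pair_def by auto

lemma aut_pair_continuous:
  assumes "aut_pair \<Phi> \<Psi>" shows "continuous_on S \<Phi>" "continuous_on S \<Psi>"
  using assms holo_map_on_imp_continuous_on unfolding aut_pair_def by auto

lemma uniform_limit_vec_nth:
  fixes f :: "nat \<Rightarrow> 'a \<Rightarrow> complex ^ 'n"
  assumes "uniform_limit S f g F"
  shows "uniform_limit S (\<lambda>n z. f n z $ i) (\<lambda>z. g z $ i) F"
  using bounded_linear.uniform_limit[OF bounded_linear_vec_nth assms] .

lemma holo_map_on_uniform_limit:
  fixes f :: "nat \<Rightarrow> complex ^ 'n \<Rightarrow> complex ^ 'm"
  assumes "\<And>n. holo_map_on (f n) UNIV"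
    and "\<And>R. uniform_limit (cball 0 R) f g sequentially"
  shows "holo_map_on g UNIV"
  unfolding holo_map_on_def
proof
  fix i
  show "holo_fun_on (\<lambda>z. g z $ i) UNIV"
  proof (rule holo_fun_on_uniform_limit[where f = "\<lambda>n z. f n z $ i"])
    show "holo_fun_on (\<lambda>z. f n z $ i) UNIV" for n
      using assms(1)[of n] unfolding holo_map_on_def by blast
    show "uniform_limit (cball 0 R) (\<lambda>n z. f n z $ i) (\<lambda>z. g z $ i) sequentially" for R
      by (rule uniform_limit_vec_nth[OF assms(2)])
  qed
qed

text \<open>Continuous convergence; this is what allows the limit of a composition to be taken in both factors at once.\<close>

lemma tendsto_uniform_limit_compose:
  fixes f :: "nat \<Rightarrow> 'a::real_normed_vector \<Rightarrow> 'b::real_normed_vector"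
  assumes lim: "\<And>R. uniform_limit (cball 0 R) f g sequentially" and g: "continuous_on UNIV g"
    and x: "x \<longlonglongrightarrow> a"
  shows "(\<lambda>n. f n (x n)) \<longlonglongrightarrow> g a"
proof -
  have "(\<lambda>n. g (x n)) \<longlonglongrightarrow> g a"
    using g x by (metis continuous_on_tendsto_compose UNIV_I eventually_sequentiallyI)
  moreover have "(\<lambda>n. f n (x n) - g (x n)) \<longlonglongrightarrow> 0"
  proof (rule LIMSEQ_I)
    fix e :: real assume e: "e > 0"
    obtain B where B: "\<And>n. norm (x n) \<le> B"
      using convergent_imp_Bseq[OF convergentI[OF x]] by (auto elim!: BseqE)
    obtain N where "\<And>n. n \<ge> N \<Longrightarrow> \<forall>y\<in>cball 0 B. dist (f n y) (g y) < e"
      using lim[of B] e unfolding uniform_limit_iff eventually_sequentially by meson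
    hence "\<forall>n\<ge>N. norm (f n (x n) - g (x n) - 0) < e"
      using B by (simp add: dist_norm)
    thus "\<exists>N. \<forall>n\<ge>N. norm (f n (x n) - g (x n) - 0) < e" ..
  qed
  ultimately show ?thesis using tendsto_add[of "\<lambda>n. g (x n)" "g a" sequentially "\<lambda>n. f n (x n) - g (x n)" 0] by simp
qed

text \<open>If the inverses converge locally uniformly as well, the identities \<open>\<Psi>s n (\<Phi>s n z) = z\<close> and
  \<open>\<Phi>s n (\<Psi>s n z) = z\<close> pass to the limit.\<close>

lemma aut_pair_limit:
  assumes pair: "\<And>n. aut_pair (\<Phi>s n) (\<Psi>s n)"
    and \<Phi>: "\<And>R. uniform_limit (cball 0 R) \<Phi>s \<Phi> sequentially"
    and \<Psi>: "\<And>R. uniform_limit (cball 0 R) \<Psi>s \<Psi> sequentially"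
  shows "aut_pair \<Phi> \<Psi>"
proof -
  have h: "holo_map_on \<Phi> UNIV" "holo_map_on \<Psi> UNIV"
  proof -
    have p: "holo_map_on (\<Phi>s n) UNIV" "holo_map_on (\<Psi>s n) UNIV" for n
      using pair[of n] unfolding aut_pair_def by blast+
    show "holo_map_on \<Phi> UNIV" by (rule holo_map_on_uniform_limit[OF p(1) \<Phi>])
    show "holo_map_on \<Psi> UNIV" by (rule holo_map_on_uniform_limit[OF p(2) \<Psi>])
  qed
  have "\<Psi> (\<Phi> z) = z" for z
  proof -
    have "(\<lambda>n. \<Phi>s n z) \<longlonglongrightarrow> \<Phi> z"
      using tendsto_uniform_limitI[OF \<Phi>[of "norm z"]] by simp
    hence "(\<lambda>n. \<Psi>s n (\<Phi>s n z)) \<longlonglongrightarrow> \<Psi> (\<Phi> z)"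
      by (rule tendsto_uniform_limit_compose[OF \<Psi> holo_map_on_imp_continuous_on[OF h(2)]])
    moreover have "\<Psi>s n (\<Phi>s n z) = z" for n using pair[of n] unfolding aut_pair_def by blast
    ultimately show ?thesis by (simp add: LIMSEQ_const_iff)
  qed
  moreover have "\<Phi> (\<Psi> z) = z" for z
  proof -
    have "(\<lambda>n. \<Psi>s n z) \<longlonglongrightarrow> \<Psi> z"
      using tendsto_uniform_limitI[OF \<Psi>[of "norm z"]] by simp
    hence "(\<lambda>n. \<Phi>s n (\<Psi>s n z)) \<longlonglongrightarrow> \<Phi> (\<Psi> z)"
      by (rule tendsto_uniform_limit_compose[OF \<Phi> holo_map_on_imp_continuous_on[OF h(1)]])
    moreover have "\<Phi>s n (\<Psi>s n z) = z" for n using pair[of n] unfolding aut_pair_def by blast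
    ultimately show ?thesis by (simp add: LIMSEQ_const_iff)
  qed
  ultimately show ?thesis using h unfolding aut_pair_def by auto
qed


section \<open>Automorphisms that move a compact set into an unbounded open set\<close>

text \<open>\<open>G\<close> can be moved into \<open>G'\<close> by automorphisms that, together with their inverses, are
  arbitrarily close to the identity on any given compact part of \<open>U\<close>. Because \<open>U\<close> is open, a compact
  set can be enlarged slightly inside \<open>U\<close>, and this makes the relation transitive.\<close>

definition reach :: "(complex ^ 'n) set \<Rightarrow> (complex ^ 'n) set \<Rightarrow> (complex ^ 'n) set \<Rightarrow> bool" where
  "reach U G G' \<longleftrightarrow> (\<forall>C e. compact C \<and> C \<subseteq> U \<and> e > 0 \<longrightarrow>
     (\<exists>\<phi> \<psi>. aut_pair \<phi> \<psi> \<and> (\<forall>z\<in>C. dist (\<phi> z) z < e \<and> dist (\<psi> z) z < e) \<and> \<phi> ` G \<subseteq> G'))"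

lemma reach_mono: "reach U G G' \<Longrightarrow> V \<subseteq> U \<Longrightarrow> reach V G G'"
  unfolding reach_def by (meson subset_trans)

lemma compact_closed_neighbourhood:
  fixes C :: "'a::euclidean_space set"
  assumes "compact C"
  shows "compact (\<Union>x\<in>C. cball x d)"
proof -
  have "(\<Union>x\<in>C. cball x d) = {x + y | x y. x \<in> C \<and> y \<in> cball 0 d}"
    by (auto simp: dist_norm) (metis add_diff_cancel_left' diff_add_cancel norm_minus_commute add.commute)
  thus ?thesis using compact_sums[OF assms compact_cball[of 0 d]] by simp
qed

lemma compact_open_margin:
  fixes C :: "'a::euclidean_space set"
  assumes "compact C" "open U" "C \<subseteq> U"
  obtains d where "d > 0" "(\<Union>x\<in>C. cball x d) \<subseteq> U"
  using compact_subset_open_imp_cball_epsilon_subset[OF assms] by metis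

lemma reach_trans:
  fixes U :: "(complex ^ 'n) set"
  assumes U: "open U" and r1: "reach U G G'" and r2: "reach U G' G''"
  shows "reach U G G''"
  unfolding reach_def
proof (intro allI impI, elim conjE)
  fix C :: "(complex ^ 'n) set" and e :: real assume C: "compact C" "C \<subseteq> U" and e: "e > 0"
  obtain d where d: "d > 0" "(\<Union>x\<in>C. cball x d) \<subseteq> U" using compact_open_margin[OF C(1) U C(2)] .
  define C' where "C' = (\<Union>x\<in>C. cball x d)"
  define e' where "e' = min (e/2) d"
  have C': "compact C'" "C' \<subseteq> U" "C \<subseteq> C'"
    using compact_closed_neighbourhood[OF C(1)] d unfolding C'_def by (auto intro: bexI)
  have e': "e' > 0" "e' \<le> e/2" "e' \<le> d" using e d unfolding e'_def by auto
  obtain \<phi>1 \<psi>1 where 1: "aut_pair \<phi>1 \<psi>1" "\<And>z. z \<in> C' \<Longrightarrow> dist (\<phi>1 z) z < e' \<and> dist (\<psi>1 z) z < e'" "\<phi>1 ` G \<subseteq> G'"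
    using r1 C' e' unfolding reach_def by meson
  obtain \<phi>2 \<psi>2 where 2: "aut_pair \<phi>2 \<psi>2" "\<And>z. z \<in> C' \<Longrightarrow> dist (\<phi>2 z) z < e' \<and> dist (\<psi>2 z) z < e'" "\<phi>2 ` G' \<subseteq> G''"
    using r2 C' e' unfolding reach_def by meson
  have near: "y \<in> C'" if "z \<in> C" "dist y z < e'" for y z
    using that e' unfolding C'_def by (auto simp: dist_commute intro!: bexI[of _ z])
  have "dist (\<phi>2 (\<phi>1 z)) z < e \<and> dist (\<psi>1 (\<psi>2 z)) z < e" if z: "z \<in> C" for z
  proof -
    have zC: "z \<in> C'" using z C' by auto
    have a: "dist (\<phi>1 z) z < e'" "dist (\<psi>2 z) z < e'" using 1(2)[OF zC] 2(2)[OF zC] by auto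
    have "dist (\<phi>2 (\<phi>1 z)) (\<phi>1 z) < e'" "dist (\<psi>1 (\<psi>2 z)) (\<psi>2 z) < e'"
      using 1(2)[OF near[OF z a(2)]] 2(2)[OF near[OF z a(1)]] by auto
    thus ?thesis using a e' dist_triangle[of "\<phi>2 (\<phi>1 z)" z "\<phi>1 z"] dist_triangle[of "\<psi>1 (\<psi>2 z)" z "\<psi>2 z"] by linarith
  qed
  moreover have "(\<lambda>z. \<phi>2 (\<phi>1 z)) ` G \<subseteq> G''" using 1(3) 2(3) by auto
  ultimately show "\<exists>\<phi> \<psi>. aut_pair \<phi> \<psi> \<and> (\<forall>z\<in>C. dist (\<phi> z) z < e \<and> dist (\<psi> z) z < e) \<and> \<phi> ` G \<subseteq> G''"
    using aut_pair_compose[OF 1(1) 2(1)] by blast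
qed

definition polydisc :: "real \<Rightarrow> (complex ^ 'n) set" where
  "polydisc R = {z. \<forall>k. cmod (z $ k) < R}"

text \<open>The radii may differ from coordinate to coordinate because the moves treat the coordinates differently.\<close>

definition cpolydisc :: "complex ^ 'n \<Rightarrow> ('n \<Rightarrow> real) \<Rightarrow> (complex ^ 'n) set" where
  "cpolydisc c r = {z. \<forall>k. cmod (z $ k - c $ k) \<le> r k}"

lemma norm_le_card_times_component_bound:
  fixes z :: "complex ^ 'n"
  assumes "\<And>k. cmod (z $ k) \<le> d"
  shows "norm z \<le> real CARD('n) * d"
proof -
  have "norm z \<le> (\<Sum>k\<in>UNIV. cmod (z $ k))" unfolding norm_vec_def by (rule L2_set_le_sum) auto
  also have "\<dots> \<le> (\<Sum>k\<in>(UNIV :: 'n set). d)" by (intro sum_mono assms)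
  finally show ?thesis by simp
qed

lemma open_polydisc: "open (polydisc R :: (complex ^ 'n) set)"
proof -
  have "polydisc R = (\<Inter>k. {z :: complex ^ 'n. cmod (z $ k) < R})" unfolding polydisc_def by auto
  moreover have "open \<dots>" by (intro open_INT ballI open_Collect_less continuous_intros) auto
  ultimately show ?thesis by simp
qed

lemma aut_pair_coordinate_move:
  fixes c :: "complex ^ 'n"
  shows "aut_pair (\<lambda>z. \<chi> k. if k = i then z $ i else exp (- L * poly p (z $ i)) * z $ k + poly p (z $ i) * c $ k)
     (\<lambda>z. \<chi> k. if k = i then z $ i else exp (L * poly p (z $ i)) * (z $ k + - 1 * (poly p (z $ i) * c $ k)))"
proof -
  have ent: "(\<lambda>w. exp (M * poly p w)) holomorphic_on UNIV" "poly p holomorphic_on UNIV" for M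
    by (intro holomorphic_intros)+
  have ent': "holo_fun_on (\<lambda>z. exp (M * poly p (z $ i))) UNIV" "holo_fun_on (\<lambda>z. poly p (z $ i)) UNIV" for M
    using holo_fun_on_entire[OF holo_fun_on_coord ent(1)] holo_fun_on_entire[OF holo_fun_on_coord ent(2)] by auto
  have A: "holo_fun_on (\<lambda>z. exp (- L * poly p (z $ i)) * z $ k + poly p (z $ i) * c $ k) UNIV"
   and B: "holo_fun_on (\<lambda>z. exp (L * poly p (z $ i)) * (z $ k + - 1 * (poly p (z $ i) * c $ k))) UNIV" for k
    by (intro holo_fun_on_add holo_fun_on_mult holo_fun_on_coord holo_fun_on_const ent')+
  have E: "exp (- (L * w)) * (exp (L * w) * x) = x" "exp (L * w) * (exp (- (L * w)) * x) = x" for w x :: complex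
    by (simp_all flip: mult.assoc exp_add)
  show ?thesis
    unfolding aut_pair_def holo_map_on_def vec_lambda_beta
  proof (intro conjI allI)
    fix k
    show "holo_fun_on (\<lambda>z. if k = i then z $ i else exp (- L * poly p (z $ i)) * z $ k + poly p (z $ i) * c $ k) UNIV"
      by (cases "k = i") (use A holo_fun_on_coord in auto)
    show "holo_fun_on (\<lambda>z. if k = i then z $ i else exp (L * poly p (z $ i)) * (z $ k + - 1 * (poly p (z $ i) * c $ k))) UNIV"
      by (cases "k = i") (use B holo_fun_on_coord in auto)
  qed (auto simp: vec_eq_iff E)
qed

text \<open>Take a polynomial \<open>f\<close> that is almost \<open>0\<close> on the disc of radius \<open>R\<close> and almost \<open>1\<close> on the disc
  about \<open>c $ i\<close>. The map that keeps \<open>z $ i\<close> and sends the other coordinates to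
  \<open>exp (- L * f (z $ i)) * z $ k + f (z $ i) * c' $ k\<close> is almost the identity where \<open>\<bar>z $ i\<bar> < R\<close>, and
  over the second disc it is almost the contraction by \<open>exp (- L)\<close> followed by the translation by
  \<open>c'\<close>. Large \<open>L\<close> makes the image as thin as desired in the coordinates other than \<open>i\<close>.\<close>

lemma reach_coordinate:
  fixes c c' :: "complex ^ 'n"
  assumes R: "R > 0" and sep: "R + r i < cmod (c $ i)" and r: "\<And>k. r k \<ge> 0"
    and ci: "c' $ i = c $ i" "r i \<le> r' i" and r': "\<And>k. k \<noteq> i \<Longrightarrow> r' k > 0"
  shows "reach (polydisc R) (cpolydisc c r) (cpolydisc c' r')"
  unfolding reach_def
proof (intro allI impI, elim conjE)
  fix C :: "(complex ^ 'n) set" and e :: real assume C: "compact C" "C \<subseteq> polydisc R" and e: "e > 0"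
  define B where "B = R + (\<Sum>k\<in>UNIV. cmod (c $ k) + r k + cmod (c' $ k)) + 1"
  have "cmod (c $ k) + r k + cmod (c' $ k) \<le> (\<Sum>k\<in>UNIV. cmod (c $ k) + r k + cmod (c' $ k))" for k
    using r by (intro member_le_sum) auto
  hence B: "R \<le> B" "B > 0" "cmod (c' $ k) \<le> B" "cmod (c $ k) + r k \<le> B" for k
    using R r[of k] norm_ge_zero[of "c $ k"] norm_ge_zero[of "c' $ k"] unfolding B_def by smt+
  define \<delta> where "\<delta> = Min (insert 1 (r' ` (UNIV - {i})))"
  have \<delta>: "\<delta> > 0" "\<And>k. k \<noteq> i \<Longrightarrow> \<delta> \<le> r' k" unfolding \<delta>_def using r' by (auto intro: Min_le)
  \<comment> \<open>chosen such that \<open>exp (- L) * B = \<delta> / 2\<close>, where \<open>B\<close> bounds all coordinates involved\<close>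
  define L where "L = - ln (\<delta> / (2 * B)) "
  have L: "exp (- L) * B = \<delta> / 2" unfolding L_def using \<delta> B by simp
  \<comment> \<open>the norm is at most the dimension times the largest modulus of a coordinate\<close>
  define e0 where "e0 = e / (real CARD('n) + 1)"
  have e0: "e0 > 0" "real CARD('n) * e0 < e" using e unfolding e0_def by (auto simp: field_simps)
  let ?L = "of_real L :: complex"
  define h where "h = (\<lambda>w. cmod (exp (- ?L * w) - 1) * B + cmod w * B + cmod (exp (?L * w) - 1) * B + cmod (exp (?L * w)) * (cmod w * B))"
  define h1 where "h1 = (\<lambda>w. cmod (exp (- ?L * w) - exp (- ?L)) * B + cmod (w - 1) * B)"
  \<comment> \<open>\<open>h\<close> and \<open>h1\<close> bound the deviations of the map from the identity and from the contraction in terms of the value \<open>w\<close> of the polynomial\<close>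
  have "isCont h 0" "isCont h1 1" unfolding h_def h1_def by (intro continuous_intros)+
  hence "h \<midarrow>0\<rightarrow> 0" "h1 \<midarrow>1\<rightarrow> 0" unfolding isCont_def by (simp_all add: h_def h1_def)
  then obtain \<eta>0 \<eta>1 where \<eta>0: "\<eta>0 > 0" "\<And>w. w \<noteq> 0 \<Longrightarrow> dist w 0 < \<eta>0 \<Longrightarrow> dist (h w) 0 < e0"
    and \<eta>1: "\<eta>1 > 0" "\<And>w. w \<noteq> 1 \<Longrightarrow> dist w 1 < \<eta>1 \<Longrightarrow> dist (h1 w) 0 < \<delta>/2"
    using e0(1) \<delta>(1) half_gt_zero[OF \<delta>(1)] unfolding LIM_def by metis
  have h: "h w < e0" if "cmod w < \<eta>0" for w
  proof (cases "w = 0")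
    case False
    hence "dist (h w) 0 < e0" using \<eta>0(2)[of w] that by simp
    thus ?thesis using abs_ge_self[of "h w"] by (simp add: dist_real_def)
  qed (use e0 in \<open>simp add: h_def\<close>)
  have h1: "h1 w < \<delta>/2" if "cmod (w - 1) < \<eta>1" for w
  proof (cases "w = 1")
    case False
    hence "dist (h1 w) 0 < \<delta>/2" using \<eta>1(2)[of w] that by (simp add: dist_norm)
    thus ?thesis using abs_ge_self[of "h1 w"] unfolding dist_real_def diff_0_right by linarith
  qed (use \<delta> in \<open>simp add: h1_def\<close>)
  obtain p where p0: "\<And>w. w \<in> cball 0 R \<Longrightarrow> cmod (poly p w) < min \<eta>0 \<eta>1"
    and p1: "\<And>w. w \<in> cball (c $ i) (r i) \<Longrightarrow> cmod (poly p w - 1) < min \<eta>0 \<eta>1"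
    using polynomial_separating_discs[of R "r i" 0 "c $ i" "min \<eta>0 \<eta>1"] sep R r[of i] \<eta>0(1) \<eta>1(1)
    by (auto simp: dist_norm)
  define \<phi> where "\<phi> = (\<lambda>z :: complex ^ 'n. \<chi> k. if k = i then z $ i else exp (- ?L * poly p (z $ i)) * z $ k + poly p (z $ i) * c' $ k)"
  define \<psi> where "\<psi> = (\<lambda>z :: complex ^ 'n. \<chi> k. if k = i then z $ i else exp (?L * poly p (z $ i)) * (z $ k + - 1 * (poly p (z $ i) * c' $ k)))"
  have "aut_pair \<phi> \<psi>" unfolding \<phi>_def \<psi>_def by (rule aut_pair_coordinate_move)
  moreover have "dist (\<phi> z) z < e \<and> dist (\<psi> z) z < e" if z: "z \<in> C" for z
  proof -
    define w where "w = poly p (z $ i)"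
    have zR: "cmod (z $ k) < R" for k using C(2) z unfolding polydisc_def by blast
    have zk: "cmod (z $ k) \<le> B" for k using zR[of k] B(1) by linarith
    have zi: "cmod (z $ i) \<le> R" using zR[of i] by simp
    have w: "h w < e0" unfolding w_def using p0[of "z $ i"] zi by (intro h) auto
    have "cmod ((\<phi> z - z) $ k) \<le> e0 \<and> cmod ((\<psi> z - z) $ k) \<le> e0" for k
    proof (cases "k = i")
      case False
      have "cmod ((\<phi> z - z) $ k) = cmod ((exp (- ?L * w) - 1) * z $ k + w * c' $ k)"
        using False unfolding \<phi>_def w_def by (simp add: algebra_simps)
      also have "\<dots> \<le> cmod (exp (- ?L * w) - 1) * cmod (z $ k) + cmod w * cmod (c' $ k)"
        by (metis norm_mult norm_triangle_ineq)
      also have "\<dots> \<le> cmod (exp (- ?L * w) - 1) * B + cmod w * B"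
        by (intro add_mono mult_left_mono B zk) auto
      also have "\<dots> \<le> h w" unfolding h_def using B by simp
      finally have 1: "cmod ((\<phi> z - z) $ k) \<le> h w" .
      have "cmod ((\<psi> z - z) $ k) = cmod ((exp (?L * w) - 1) * z $ k - exp (?L * w) * (w * c' $ k))"
        using False unfolding \<psi>_def w_def by (simp add: algebra_simps)
      also have "\<dots> \<le> cmod (exp (?L * w) - 1) * cmod (z $ k) + cmod (exp (?L * w)) * (cmod w * cmod (c' $ k))"
        by (metis norm_mult norm_triangle_ineq4)
      also have "\<dots> \<le> cmod (exp (?L * w) - 1) * B + cmod (exp (?L * w)) * (cmod w * B)"
        by (intro add_mono mult_left_mono B zk) auto
      also have "\<dots> \<le> h w" unfolding h_def using B by simp
      finally show ?thesis using 1 w by simp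
    qed (use e0 in \<open>auto simp: \<phi>_def \<psi>_def\<close>)
    hence "norm (\<phi> z - z) \<le> real CARD('n) * e0" "norm (\<psi> z - z) \<le> real CARD('n) * e0"
      by (auto intro: norm_le_card_times_component_bound)
    thus ?thesis using e0 by (simp add: dist_norm)
  qed
  moreover have "\<phi> z \<in> cpolydisc c' r'" if z: "z \<in> cpolydisc c r" for z
    unfolding cpolydisc_def
  proof (intro CollectI allI)
    fix k
    show "cmod (\<phi> z $ k - c' $ k) \<le> r' k"
    proof (cases "k = i")
      case True
      have "cmod (z $ i - c $ i) \<le> r i" using z unfolding cpolydisc_def by blast
      then show ?thesis using True ci unfolding \<phi>_def by simp
    next
      case False
      define w where "w = poly p (z $ i)"
      have "cmod (z $ i - c $ i) \<le> r i" "cmod (z $ k - c $ k) \<le> r k" using z unfolding cpolydisc_def by blast+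
      hence zk: "cmod (z $ k) \<le> B" and "cmod (w - 1) < \<eta>1"
        using p1[of "z $ i"] B(4)[of k] norm_triangle_sub[of "z $ k" "c $ k"] unfolding w_def
        by (auto simp: dist_norm norm_minus_commute)
      hence w: "h1 w < \<delta>/2" by (intro h1)
      have "cmod (\<phi> z $ k - c' $ k) = cmod ((exp (- ?L * w) - exp (- ?L)) * z $ k + (w - 1) * c' $ k + exp (- ?L) * z $ k)"
        using False unfolding \<phi>_def w_def by (simp add: algebra_simps)
      also have "\<dots> \<le> cmod (exp (- ?L * w) - exp (- ?L)) * cmod (z $ k) + cmod (w - 1) * cmod (c' $ k) + cmod (exp (- ?L)) * cmod (z $ k)"
        unfolding norm_mult[symmetric] by (meson add_mono norm_triangle_ineq order_refl order_trans)
      also have "\<dots> \<le> cmod (exp (- ?L * w) - exp (- ?L)) * B + cmod (w - 1) * B + exp (- L) * B"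
        by (intro add_mono mult_mono B zk) auto
      also have "\<dots> = h1 w + \<delta>/2" unfolding h1_def L by simp
      also have "\<dots> \<le> r' k" using w \<delta>(2)[OF False] by simp
      finally show ?thesis .
    qed
  qed
  ultimately show "\<exists>\<phi> \<psi>. aut_pair \<phi> \<psi> \<and> (\<forall>z\<in>C. dist (\<phi> z) z < e \<and> dist (\<psi> z) z < e) \<and> \<phi> ` cpolydisc c r \<subseteq> cpolydisc c' r'"
    by blast
qed

definition lin_form :: "complex ^ 'n \<Rightarrow> complex ^ 'n \<Rightarrow> complex" where
  "lin_form a z = (\<Sum>k\<in>UNIV. a $ k * z $ k)"

lemma lin_form_add: "lin_form a (z + w) = lin_form a z + lin_form a w"
  unfolding lin_form_def by (simp add: distrib_left sum.distrib)

lemma lin_form_smult: "lin_form a (c *s z) = c * lin_form a z"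
  unfolding lin_form_def by (simp add: sum_distrib_left algebra_simps)

lemma aut_pair_shear:
  assumes v: "lin_form a v = 0"
  shows "aut_pair (\<lambda>z. z + poly p (lin_form a z) *s v) (\<lambda>z. z + poly (-p) (lin_form a z) *s v)"
proof -
  have "holo_fun_on (lin_form a) UNIV"
    unfolding lin_form_def by (intro holo_fun_on_sum holo_fun_on_mult holo_fun_on_const holo_fun_on_coord)
  hence "holo_fun_on (\<lambda>z. poly q (lin_form a z)) UNIV" for q
    by (rule holo_fun_on_entire) (intro holomorphic_intros)
  hence maps: "holo_map_on (\<lambda>z. z + poly q (lin_form a z) *s v) UNIV" for q
    unfolding holo_map_on_def by (auto intro!: holo_fun_on_add holo_fun_on_mult holo_fun_on_const holo_fun_on_coord)
  have lin: "lin_form a (z + c *s v) = lin_form a z" for z c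
    by (simp add: lin_form_add lin_form_smult v)
  have "lin_form a (z - c *s v) = lin_form a z" for z c
    using lin[of z "-c"] by simp
  moreover have "(z + c *s v) + (- c) *s v = z" "(z + (- c) *s v) + c *s v = z" for z c
    by (simp_all add: vec_eq_iff)
  ultimately show ?thesis
    using maps[of p] maps[of "-p"] lin unfolding aut_pair_def poly_minus by simp
qed

text \<open>The discs of radius \<open>T\<close> about \<open>s - T\<close> exhaust the half-plane \<open>Re w < s\<close>. This turns separation by a
  line into separation by discs.\<close>

lemma compact_half_plane_subset_disc:
  assumes K: "compact K" "\<And>w. w \<in> K \<Longrightarrow> Re w < s"
  obtains T \<rho> where "0 \<le> \<rho>" "\<rho> < T" "K \<subseteq> cball (of_real (s - T)) \<rho>"
proof (cases "K = {}")
  case True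
  thus thesis using that[of 0 1] by auto
next
  case False
  have "continuous_on K Re" by (intro continuous_intros)
  then obtain w0 where w0: "w0 \<in> K" "\<And>w. w \<in> K \<Longrightarrow> Re w \<le> Re w0"
    using continuous_attains_sup[OF K(1) False] by blast
  define \<tau> where "\<tau> = s - Re w0"
  have \<tau>: "\<tau> > 0" "\<And>w. w \<in> K \<Longrightarrow> Re w \<le> s - \<tau>" using K(2)[OF w0(1)] w0(2) unfolding \<tau>_def by auto
  obtain B where B: "B > 0" "\<And>w. w \<in> K \<Longrightarrow> cmod w \<le> B" using compact_imp_bounded[OF K(1)] bounded_pos by metis
  \<comment> \<open>the last summand is what \<open>(T - \<tau>)\<^sup>2 + B\<^sup>2 < T\<^sup>2\<close> requires\<close>
  define T where "T = \<bar>s\<bar> + B + \<tau> + (\<tau>\<^sup>2 + B\<^sup>2) / (2 * \<tau>)"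
  define \<rho> where "\<rho> = sqrt ((T - \<tau>)\<^sup>2 + B\<^sup>2)"
  have T: "T \<ge> \<bar>s\<bar> + B + \<tau>" "T > (\<tau>\<^sup>2 + B\<^sup>2) / (2 * \<tau>)" using \<tau> B unfolding T_def by (auto intro!: add_pos_pos)
  have "(T - \<tau>)\<^sup>2 + B\<^sup>2 < T\<^sup>2"
    using T(2) \<tau> by (simp add: field_simps power2_eq_square)
  hence "\<rho> < T" unfolding \<rho>_def using T(1) B \<tau> by (simp add: real_less_lsqrt)
  moreover have "0 \<le> \<rho>" unfolding \<rho>_def by simp
  moreover have "w \<in> cball (of_real (s - T)) \<rho>" if w: "w \<in> K" for w
  proof -
    have "\<bar>Re w\<bar> \<le> B" "\<bar>Im w\<bar> \<le> B" using B(2)[OF w] abs_Re_le_cmod[of w] abs_Im_le_cmod[of w] by auto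
    hence "0 \<le> Re w - (s - T)" "Re w - (s - T) \<le> T - \<tau>" "\<bar>Im w\<bar> \<le> B" using T(1) \<tau>(2)[OF w] \<tau>(1) by auto
    hence "(Re w - (s - T))\<^sup>2 \<le> (T - \<tau>)\<^sup>2" "(Im w)\<^sup>2 \<le> B\<^sup>2"
      using B(1) by (auto intro: power_mono simp: power2_le_iff_abs_le)
    hence "(Re w - (s - T))\<^sup>2 + (Im w)\<^sup>2 \<le> (T - \<tau>)\<^sup>2 + B\<^sup>2" by linarith
    hence "cmod (w - of_real (s - T)) \<le> \<rho>" unfolding \<rho>_def cmod_def by (simp add: real_sqrt_le_mono)
    thus ?thesis by (simp add: dist_norm norm_minus_commute)
  qed
  ultimately show thesis using that by blast
qed

lemma continuous_on_lin_form: "continuous_on S (lin_form a)"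
  unfolding lin_form_def by (intro continuous_intros)

text \<open>The shear \<open>z + f(\<lambda>(z)) v\<close>, with \<open>\<lambda>(v) = 0\<close> and a polynomial \<open>f\<close> that is almost \<open>0\<close> on one side of the
  separating line and almost \<open>1\<close> on the other, translates \<open>G\<close> by almost \<open>v\<close>. Since \<open>\<lambda>\<close> is invariant, the
  inverse is the shear with \<open>-f\<close>.\<close>

lemma reach_shear:
  fixes v :: "complex ^ 'n"
  assumes v: "lin_form a v = 0" and U: "\<And>z. z \<in> U \<Longrightarrow> Re (lin_form a z) < s"
    and G: "compact G" "\<And>z. z \<in> G \<Longrightarrow> s < Re (lin_form a z)"
    and G': "d > 0" "\<And>z y. z \<in> G \<Longrightarrow> dist y (z + v) < d \<Longrightarrow> y \<in> G'"
  shows "reach U G G'"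
  unfolding reach_def
proof (intro allI impI, elim conjE)
  fix C :: "(complex ^ 'n) set" and e :: real assume C: "compact C" "C \<subseteq> U" and e: "e > 0"
  have "compact (lin_form a ` C)" "compact ((\<lambda>z. - lin_form a z) ` G)"
    using C G by (auto intro!: compact_continuous_image continuous_on_minus continuous_on_lin_form)
  moreover have "\<And>w. w \<in> lin_form a ` C \<Longrightarrow> Re w < s" "\<And>w. w \<in> (\<lambda>z. - lin_form a z) ` G \<Longrightarrow> Re w < - s"
    using U C G by auto
  ultimately obtain T \<rho> T' \<rho>' where 1: "0 \<le> \<rho>" "\<rho> < T" "lin_form a ` C \<subseteq> cball (of_real (s - T)) \<rho>"
    and 2: "0 \<le> \<rho>'" "\<rho>' < T'" "(\<lambda>z. - lin_form a z) ` G \<subseteq> cball (of_real (- s - T')) \<rho>'"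
    using compact_half_plane_subset_disc by metis
  define \<eta> where "\<eta> = min e d / (norm v + 1)"
  have nv: "norm v + 1 > 0" by (simp add: add_nonneg_pos)
  have \<eta>: "\<eta> > 0" using e G' nv unfolding \<eta>_def by simp
  have small: "norm (x *s v) < min e d" if "cmod x < \<eta>" for x
  proof -
    have "cmod x * norm v \<le> cmod x * (norm v + 1)" by (intro mult_left_mono) auto
    also have "\<dots> < \<eta> * (norm v + 1)" using that nv by (intro mult_strict_right_mono)
    also have "\<dots> = min e d" unfolding \<eta>_def using nv by simp
    finally show ?thesis by (simp add: norm_vector_smult_complex)
  qed
  have "dist (of_real (s - T)) (of_real (s + T') :: complex) = T + T'"
    using 1 2 unfolding dist_of_real by (simp add: dist_real_def)
  then obtain p where p0: "\<And>w. w \<in> cball (of_real (s - T)) \<rho> \<Longrightarrow> cmod (poly p w) < \<eta>"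
    and p1: "\<And>w. w \<in> cball (of_real (s + T')) \<rho>' \<Longrightarrow> cmod (poly p w - 1) < \<eta>"
    using polynomial_separating_discs[of \<rho> \<rho>' "of_real (s - T)" "of_real (s + T')" \<eta>] 1 2 \<eta> by auto
  have "aut_pair (\<lambda>z. z + poly p (lin_form a z) *s v) (\<lambda>z. z + poly (-p) (lin_form a z) *s v)"
    by (rule aut_pair_shear[OF v])
  moreover have "dist (z + poly p (lin_form a z) *s v) z < e \<and> dist (z + poly (-p) (lin_form a z) *s v) z < e"
    if "z \<in> C" for z
  proof -
    have "cmod (poly p (lin_form a z)) < \<eta>" using 1(3) that by (intro p0) auto
    thus ?thesis using small[of "poly p (lin_form a z)"] small[of "poly (-p) (lin_form a z)"] by (simp add: dist_norm)
  qed
  moreover have "z + poly p (lin_form a z) *s v \<in> G'" if z: "z \<in> G" for z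
  proof (rule G'(2)[OF z])
    have "- lin_form a z \<in> cball (of_real (- s - T')) \<rho>'" using 2(3) z by blast
    hence "lin_form a z \<in> cball (of_real (s + T')) \<rho>'"
      by (simp add: dist_norm) (metis add.commute add_diff_eq diff_minus_eq_add norm_minus_commute add_uminus_conv_diff minus_diff_eq uminus_add_conv_diff)
    hence "norm ((poly p (lin_form a z) - 1) *s v) < d" using p1 small by fastforce
    thus "dist (z + poly p (lin_form a z) *s v) (z + v) < d"
      by (simp add: dist_norm vector_sub_rdistrib algebra_simps)
  qed
  ultimately show "\<exists>\<phi> \<psi>. aut_pair \<phi> \<psi> \<and> (\<forall>z\<in>C. dist (\<phi> z) z < e \<and> dist (\<psi> z) z < e) \<and> \<phi> ` G \<subseteq> G'"
    by blast
qed

text \<open>A real hyperplane is a level set of the real part of a complex linear form; complex linearity of the form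
  is what makes the shears holomorphic.\<close>

lemma lin_form_cnj_eq_inner:
  fixes \<nu> z :: "complex ^ 'n"
  shows "Re (lin_form (\<chi> k. cnj (\<nu> $ k)) z) = z \<bullet> \<nu>"
  unfolding lin_form_def inner_vec_def by (simp add: inner_complex_def algebra_simps)

lemma lin_form_kernel_nonzero:
  fixes a :: "complex ^ 'n"
  assumes "CARD('n) > 1"
  obtains v :: "complex ^ 'n" and i where "lin_form a v = 0" "v $ i \<noteq> 0"
proof -
  obtain k1 k2 :: 'n where k: "k1 \<noteq> k2" using assms by (metis card_1_singleton_iff card_le_Suc0_iff_eq UNIV_I finite One_nat_def leD)
  have ax: "lin_form a (axis k 1) = a $ k" for k
  proof -
    have "lin_form a (axis k 1) = (\<Sum>j\<in>UNIV. if j = k then a $ j else 0)"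
      unfolding lin_form_def axis_def by (intro sum.cong) auto
    thus ?thesis by simp
  qed
  show thesis
  proof (cases "a $ k1 = 0")
    case True
    thus thesis using that[of "axis k1 1" k1] by (simp add: ax)
  next
    case False
    show thesis
    proof (rule that[of "a $ k2 *s axis k1 1 + (- (a $ k1)) *s axis k2 1" k2])
      show "lin_form a (a $ k2 *s axis k1 1 + (- (a $ k1)) *s axis k2 1) = 0"
        by (simp only: lin_form_add lin_form_smult ax) simp
      show "(a $ k2 *s axis k1 1 + - a $ k1 *s axis k2 1) $ k2 \<noteq> 0"
        using False k by (simp add: axis_def)
    qed
  qed
qed

lemma bounded_subset_polydisc:
  fixes S :: "(complex ^ 'n) set"
  assumes "bounded S"
  obtains R where "R > 0" "S \<subseteq> polydisc R"
proof -
  obtain B where "B > 0" "\<And>z. z \<in> S \<Longrightarrow> norm z \<le> B" using assms bounded_pos by metis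
  hence "cmod (z $ k) < B + 1" if "z \<in> S" for z :: "complex ^ 'n" and k
    using that Finite_Cartesian_Product.norm_nth_le[of z k] by fastforce
  hence "S \<subseteq> polydisc (B + 1)" unfolding polydisc_def by blast
  thus thesis using that[of "B + 1"] \<open>B > 0\<close> by auto
qed

text \<open>Four moves bring \<open>G\<close> to a small polydisc about a point \<open>q\<close> of \<open>W\<close> that has a large coordinate \<open>j\<close>. A shear
  translates \<open>G\<close> far in some coordinate \<open>i\<close>. A move controlled by coordinate \<open>i\<close> makes all other
  coordinates almost constant and gives a second coordinate \<open>k\<close> a large value. A move controlled by
  coordinate \<open>k\<close> makes the remaining ones almost constant, equal to those of \<open>q\<close>. If \<open>k\<close> differs
  from \<open>j\<close>, a last move controlled by coordinate \<open>j\<close> corrects coordinate \<open>k\<close>. Two different coordinates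
  exist because the dimension exceeds one.\<close>

lemma push_into_unbounded_open:
  fixes C G W :: "(complex ^ 'n) set"
  assumes n: "CARD('n) > 1" and C: "compact C" and G: "compact G"
    and sep: "\<And>z. z \<in> C \<Longrightarrow> z \<bullet> \<nu> < s" "\<And>z. z \<in> G \<Longrightarrow> s \<le> z \<bullet> \<nu>"
    and W: "open W" "\<not> bounded W" and e: "e > 0"
  obtains \<phi> \<psi> where "aut_pair \<phi> \<psi>" "\<And>z. z \<in> C \<Longrightarrow> dist (\<phi> z) z < e" "\<And>z. z \<in> C \<Longrightarrow> dist (\<psi> z) z < e" "\<phi> ` G \<subseteq> W"
proof -
  define a where "a = (\<chi> k. cnj (\<nu> $ k))"
  have a: "Re (lin_form a z) = z \<bullet> \<nu>" for z unfolding a_def by (rule lin_form_cnj_eq_inner)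
  obtain s' where s': "\<And>z. z \<in> C \<Longrightarrow> z \<bullet> \<nu> < s'" "s' < s"
  proof (cases "C = {}")
    case True
    thus thesis using that[of "s - 1"] by auto
  next
    case False
    have "continuous_on C (\<lambda>z. z \<bullet> \<nu>)" by (intro continuous_intros)
    then obtain z0 where "z0 \<in> C" "\<And>z. z \<in> C \<Longrightarrow> z \<bullet> \<nu> \<le> z0 \<bullet> \<nu>"
      using continuous_attains_sup[OF C False] by blast
    thus thesis using sep(1)[of z0] by (intro that[of "(z0 \<bullet> \<nu> + s) / 2"]) force+
  qed
  obtain R where R: "R > 0" "C \<union> G \<subseteq> polydisc R"
    using bounded_subset_polydisc[of "C \<union> G"] C G compact_imp_bounded by (metis bounded_Un)
  obtain q where q: "q \<in> W" "norm q > real CARD('n) * (R + 1)"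
    using W(2) unfolding bounded_iff by (meson not_le)
  then obtain j where j: "cmod (q $ j) > R + 1"
    using norm_le_card_times_component_bound[of q "R + 1"] by (meson not_le)
  obtain d where d: "d > 0" "cball q d \<subseteq> W" using W(1) q(1) open_contains_cball by blast
  define \<delta> where "\<delta> = min (1/2) (d / (real CARD('n)))"
  have \<delta>: "\<delta> > 0" "\<delta> < 1" "real CARD('n) * \<delta> \<le> d" using d unfolding \<delta>_def by (auto simp: min_def field_simps)
  have target: "cpolydisc q (\<lambda>_. \<delta>) \<subseteq> W"
  proof
    fix z assume "z \<in> cpolydisc q (\<lambda>_. \<delta>)"
    hence "norm (z - q) \<le> real CARD('n) * \<delta>"
      unfolding cpolydisc_def by (intro norm_le_card_times_component_bound) auto
    thus "z \<in> W" using \<delta> d by (auto simp: dist_norm norm_minus_commute)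
  qed
  obtain v0 :: "complex ^ 'n" and i where v0: "lin_form a v0 = 0" "v0 $ i \<noteq> 0" using lin_form_kernel_nonzero[OF n] .
  define v where "v = (of_real (2 * R + 3) / v0 $ i) *s v0"
  have v: "lin_form a v = 0" "v $ i = of_real (2 * R + 3)" using v0 unfolding v_def by (auto simp: lin_form_smult)
  have vi: "cmod (v $ i) = 2 * R + 3" unfolding v(2) norm_of_real using R by simp
  obtain k where k: "k \<noteq> i" using n by (metis card_1_singleton_iff card_le_Suc0_iff_eq UNIV_I finite One_nat_def leD)
  define U where "U = polydisc R \<inter> {z. Re (lin_form a z) < s'}"
  have U: "open U" unfolding U_def a by (intro open_Int open_polydisc open_Collect_less continuous_intros)
  have UR: "U \<subseteq> polydisc R" unfolding U_def by auto
  have r1: "reach U G (cpolydisc v (\<lambda>_. R + 1))"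
  proof (rule reach_shear[OF v(1) _ G, where d = 1])
    fix z y assume z: "z \<in> G" and y: "dist y (z + v) < 1"
    show "y \<in> cpolydisc v (\<lambda>_. R + 1)" unfolding cpolydisc_def
    proof (intro CollectI allI)
      fix k
      have "cmod ((y - (z + v)) $ k) < 1" using y Finite_Cartesian_Product.norm_nth_le[of "y - (z + v)" k] by (simp add: dist_norm)
      moreover have "cmod (z $ k) < R" using R(2) z unfolding polydisc_def by blast
      moreover have "y $ k - v $ k = (y - (z + v)) $ k + z $ k" by simp
      ultimately show "cmod (y $ k - v $ k) \<le> R + 1"
        using norm_triangle_ineq[of "(y - (z + v)) $ k" "z $ k"] by simp
    qed
  qed (use sep(2) s'(2) a in \<open>force simp: U_def\<close>)+
  \<comment> \<open>if \<open>j = k\<close>, coordinate \<open>k\<close> of \<open>q\<close> is itself large and can be installed at once\<close>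
  define c1 :: "complex ^ 'n" where "c1 = (\<chi> l. if l = i then v $ i else if l = k then (if j = k then q $ k else of_real (R + 2)) else 0)"
  have c1k: "cmod (c1 $ k) > R + 1"
    using k j R unfolding c1_def by (auto simp del: of_real_add)
  have r2: "reach U (cpolydisc v (\<lambda>_. R + 1)) (cpolydisc c1 (\<lambda>l. if l = i then R + 1 else \<delta>))"
    by (rule reach_mono[OF reach_coordinate[where i = i] UR]) (use R vi \<delta> in \<open>auto simp: c1_def\<close>)
  define c2 :: "complex ^ 'n" where "c2 = (\<chi> l. if l = k then c1 $ k else q $ l)"
  have r3: "reach U (cpolydisc c1 (\<lambda>l. if l = i then R + 1 else \<delta>)) (cpolydisc c2 (\<lambda>_. \<delta>))"
    by (rule reach_mono[OF reach_coordinate[where i = k] UR]) (use R c1k k \<delta> in \<open>auto simp: c2_def\<close>)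
  have r4: "reach U (cpolydisc v (\<lambda>_. R + 1)) (cpolydisc c2 (\<lambda>_. \<delta>))" by (rule reach_trans[OF U r2 r3])
  have r5: "reach U (cpolydisc v (\<lambda>_. R + 1)) (cpolydisc q (\<lambda>_. \<delta>))"
  proof (cases "j = k")
    case True
    hence "c2 = q" using k unfolding c2_def c1_def by (auto simp: vec_eq_iff)
    thus ?thesis using r4 by simp
  next
    case False
    have "reach U (cpolydisc c2 (\<lambda>_. \<delta>)) (cpolydisc q (\<lambda>_. \<delta>))"
      by (rule reach_mono[OF reach_coordinate[where i = j] UR]) (use R j False \<delta> in \<open>auto simp: c2_def\<close>)
    from reach_trans[OF U r4 this] show ?thesis .
  qed
  have r: "reach U G (cpolydisc q (\<lambda>_. \<delta>))" by (rule reach_trans[OF U r1 r5])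
  have "C \<subseteq> U" using R(2) s'(1) a unfolding U_def by auto
  then obtain \<phi> \<psi> where "aut_pair \<phi> \<psi>" "\<forall>z\<in>C. dist (\<phi> z) z < e \<and> dist (\<psi> z) z < e" "\<phi> ` G \<subseteq> cpolydisc q (\<lambda>_. \<delta>)"
    using r C e unfolding reach_def by meson
  thus thesis using that target by (meson subset_trans)
qed

text \<open>A union of compact sets added one after another so that each is cut off from \<open>B\<close> and from all earlier ones by a
  real hyperplane.\<close>

inductive stacked :: "'a::real_inner set \<Rightarrow> 'a set \<Rightarrow> bool" for B where
  empty: "stacked B {}"
| step: "stacked B \<Gamma> \<Longrightarrow> compact G \<Longrightarrow> (\<And>z. z \<in> B \<union> \<Gamma> \<Longrightarrow> z \<bullet> \<nu> < s) \<Longrightarrow> (\<And>z. z \<in> G \<Longrightarrow> s \<le> z \<bullet> \<nu>) \<Longrightarrow> stacked B (\<Gamma> \<union> G)"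

lemma stacked_compact: "stacked B \<Gamma> \<Longrightarrow> compact \<Gamma>"
  by (induction rule: stacked.induct) auto

lemma aut_pair_vimage_open:
  fixes W :: "(complex ^ 'n) set"
  assumes "aut_pair \<Phi> \<Psi>" "open W" shows "open (\<Psi> -` W)"
  using assms(2) aut_pair_continuous(2)[OF assms(1), of UNIV] by (simp add: open_vimage)

lemma aut_pair_vimage_unbounded:
  fixes W :: "(complex ^ 'n) set"
  assumes "aut_pair \<Phi> \<Psi>" "\<not> bounded W" shows "\<not> bounded (\<Psi> -` W)"
proof
  assume "bounded (\<Psi> -` W)"
  hence "compact (closure (\<Psi> -` W))" by simp
  hence "compact (\<Psi> ` closure (\<Psi> -` W))"
    by (intro compact_continuous_image aut_pair_continuous(2)[OF assms(1)])
  moreover have "W \<subseteq> \<Psi> ` closure (\<Psi> -` W)"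
  proof
    fix w assume "w \<in> W"
    moreover have "w = \<Psi> (\<Phi> w)" using assms(1) unfolding aut_pair_def by simp
    ultimately show "w \<in> \<Psi> ` closure (\<Psi> -` W)"
      using closure_subset by (metis image_eqI subsetD vimageI)
  qed
  ultimately show False using assms(2) bounded_subset compact_imp_bounded by blast
qed

text \<open>The newest set is moved first, into \<open>\<theta>' -` W\<close>, by an automorphism so close to the identity on \<open>\<Gamma>\<close>
  that the inclusion of \<open>\<theta>' ` \<Gamma>\<close> in the open set \<open>W\<close> persists. Since \<open>\<theta>'\<close> is a homeomorphism, \<open>\<theta>' -` W\<close> is
  again open and unbounded.\<close>

lemma push_stack_into_unbounded_open:
  fixes \<Gamma> W :: "(complex ^ 'n) set"
  assumes n: "CARD('n) > 1" and st: "stacked (cball 0 R) \<Gamma>"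
    and W: "open W" "\<not> bounded W" and e: "e > 0" and R': "R' < R"
  shows "\<exists>\<theta> \<theta>'. aut_pair \<theta> \<theta>' \<and> (\<forall>z\<in>cball 0 R'. dist (\<theta> z) z < e \<and> dist (\<theta>' z) z < e) \<and> \<theta>' ` \<Gamma> \<subseteq> W"
  using st e R'
proof (induction arbitrary: e R' rule: stacked.induct)
  case empty
  show ?case using aut_pair_id empty.prems by (intro exI[of _ "\<lambda>z. z"]) auto
next
  case (step \<Gamma> G \<nu> s)
  define R1 where "R1 = (R' + R) / 2"
  have R1: "R' < R1" "R1 < R" using step.prems unfolding R1_def by auto
  obtain \<theta> \<theta>' where \<theta>: "aut_pair \<theta> \<theta>'" "\<And>z. z \<in> cball 0 R1 \<Longrightarrow> dist (\<theta> z) z < min (e/2) (R - R1) \<and> dist (\<theta>' z) z < min (e/2) (R - R1)"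
    "\<theta>' ` \<Gamma> \<subseteq> W"
    using step.IH[of "min (e/2) (R - R1)" R1] R1 step.prems by auto
  have \<Gamma>: "compact \<Gamma>" by (rule stacked_compact[OF step.hyps(1)])
  have "\<Gamma> \<subseteq> \<theta>' -` W" using \<theta>(3) by auto
  then obtain d where d: "d > 0" "(\<Union>x\<in>\<Gamma>. cball x d) \<subseteq> \<theta>' -` W"
    using compact_open_margin[OF \<Gamma> aut_pair_vimage_open[OF \<theta>(1) W(1)]] by blast
  \<comment> \<open>the bound \<open>R1 - R\'\<close> keeps \<open>\<phi> z\<close> in the ball on which \<open>\<theta>\'\<close> is controlled\<close>
  define e1 where "e1 = min (min (e/2) d) (R1 - R')"
  have e1: "e1 > 0" "e1 \<le> e/2" "e1 \<le> d" "e1 \<le> R1 - R'"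
    using step.prems d R1 unfolding e1_def by linarith+
  obtain \<phi> \<psi> where \<phi>: "aut_pair \<phi> \<psi>" "\<And>z. z \<in> cball 0 R \<union> \<Gamma> \<Longrightarrow> dist (\<phi> z) z < e1"
    "\<And>z. z \<in> cball 0 R \<union> \<Gamma> \<Longrightarrow> dist (\<psi> z) z < e1" "\<phi> ` G \<subseteq> \<theta>' -` W"
  proof (rule push_into_unbounded_open[OF n _ step.hyps(2) step.hyps(3,4) aut_pair_vimage_open[OF \<theta>(1) W(1)] aut_pair_vimage_unbounded[OF \<theta>(1) W(2)] e1(1)])
    show "compact (cball 0 R \<union> \<Gamma>)" using \<Gamma> by auto
  qed auto
  have "aut_pair (\<lambda>z. \<psi> (\<theta> z)) (\<lambda>z. \<theta>' (\<phi> z))" using aut_pair_compose[OF \<theta>(1) aut_pair_sym[OF \<phi>(1)]] .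
  moreover have "dist (\<psi> (\<theta> z)) z < e \<and> dist (\<theta>' (\<phi> z)) z < e" if z: "z \<in> cball 0 R'" for z
  proof -
    have nz: "norm z \<le> R'" using z by simp
    have 1: "dist (\<theta> z) z < e/2" "dist (\<theta> z) z < R - R1" using \<theta>(2)[of z] nz R1 by auto
    hence "norm (\<theta> z) \<le> R" using nz R1 norm_triangle_sub[of "\<theta> z" z] by (simp add: dist_norm)
    hence 2: "dist (\<psi> (\<theta> z)) (\<theta> z) < e1" using \<phi>(3)[of "\<theta> z"] by simp
    have 3: "dist (\<phi> z) z < e1" using \<phi>(2)[of z] nz R1 by simp
    hence "norm (\<phi> z) \<le> R1" using nz e1 norm_triangle_sub[of "\<phi> z" z] by (simp add: dist_norm)
    hence 4: "dist (\<theta>' (\<phi> z)) (\<phi> z) < e/2" using \<theta>(2)[of "\<phi> z"] by simp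
    show ?thesis using 1 2 3 4 e1 dist_triangle[of "\<psi> (\<theta> z)" z "\<theta> z"] dist_triangle[of "\<theta>' (\<phi> z)" z "\<phi> z"] by linarith
  qed
  moreover have "\<theta>' (\<phi> z) \<in> W" if "z \<in> \<Gamma> \<union> G" for z
  proof (cases "z \<in> G")
    case False
    hence z: "z \<in> \<Gamma>" using that by auto
    hence "dist (\<phi> z) z < d" using \<phi>(2)[of z] e1 by auto
    hence "\<phi> z \<in> (\<Union>x\<in>\<Gamma>. cball x d)" using z by (auto simp: dist_commute intro!: bexI[of _ z])
    hence "\<phi> z \<in> \<theta>' -` W" using d(2) by (rule subsetD[rotated])
    thus ?thesis by simp
  qed (use \<phi>(4) in auto)
  ultimately show ?case by (intro exI[of _ "\<lambda>z. \<psi> (\<theta> z)"] exI[of _ "\<lambda>z. \<theta>' (\<phi> z)"]) auto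
qed


section \<open>Labyrinths in Euclidean space\<close>

text \<open>Pick a point of the unit sphere in every cell of a cubic lattice that meets the sphere, and colour
  the cells by the residues of their indices modulo \<open>m\<close>. Points in different cells of the same colour are at
  least \<open>m - 1\<close> cell sides apart in some coordinate. The number \<open>J\<close> of colours depends on the dimension
  and on \<open>K\<close> but not on \<open>\<kappa>\<close>, and the count of layers in the labyrinth relies on this.\<close>

lemma coloured_sphere_net:
  fixes K :: real
  assumes K: "K \<ge> 0"
  shows "\<exists>J>0. \<forall>\<kappa>>0. \<exists>D :: nat \<Rightarrow> 'a::euclidean_space set.
    (\<forall>c<J. finite (D c) \<and> D c \<subseteq> sphere 0 1 \<and> (\<forall>p\<in>D c. \<forall>q\<in>D c. p \<noteq> q \<longrightarrow> K * \<kappa> < dist p q)) \<and>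
    (\<forall>u\<in>sphere 0 1. \<exists>c<J. \<exists>p\<in>D c. dist u p \<le> \<kappa>)"
proof -
  obtain m where m: "real m > K * real DIM('a) + 1" using reals_Archimedean2 by blast
  have "K * real DIM('a) \<ge> 0" using K by simp
  hence m0: "m > 0" using m by (intro gr0I) auto
  define Q where "Q = (Basis :: 'a set) \<rightarrow>\<^sub>E {0..<int m}"
  have finQ: "finite Q" unfolding Q_def by (intro finite_PiE) auto
  have "(\<lambda>b\<in>(Basis :: 'a set). 0) \<in> Q" using m0 unfolding Q_def by auto
  hence J0: "card Q > 0" using finQ card_gt_0_iff by blast
  obtain h where h: "bij_betw h {0..<card Q} Q" using ex_bij_betw_nat_finite[OF finQ] by blast
  have "\<exists>D :: nat \<Rightarrow> 'a set.
    (\<forall>c<card Q. finite (D c) \<and> D c \<subseteq> sphere 0 1 \<and> (\<forall>p\<in>D c. \<forall>q\<in>D c. p \<noteq> q \<longrightarrow> K * \<kappa> < dist p q)) \<and>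
    (\<forall>u\<in>sphere 0 1. \<exists>c<card Q. \<exists>p\<in>D c. dist u p \<le> \<kappa>)" if \<kappa>: "\<kappa> > 0" for \<kappa>
  proof -
    define a where "a = \<kappa> / real DIM('a)"
    have a: "a > 0" "real DIM('a) * a = \<kappa>" using \<kappa> unfolding a_def by auto
    define q where "q = (\<lambda>x :: 'a. \<lambda>b\<in>Basis. \<lfloor>x \<bullet> b / a\<rfloor>)"
    define rep where "rep = (\<lambda>k. SOME x. x \<in> sphere 0 1 \<and> q x = k)"
    have rep: "rep (q x) \<in> sphere 0 1 \<and> q (rep (q x)) = q x" if "x \<in> sphere 0 1" for x
      unfolding rep_def by (rule someI[of _ x]) (use that in auto)
    define col where "col = (\<lambda>x :: 'a. \<lambda>b\<in>Basis. q x b mod int m)"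
    have col: "col x \<in> Q" for x unfolding col_def Q_def using m0 by auto
    define D where "D = (\<lambda>c. (\<lambda>x. rep (q x)) ` {x \<in> sphere 0 1. col x = h c})"
    have qfl: "q x b \<le> x \<bullet> b / a" "x \<bullet> b / a < q x b + 1" if "b \<in> Basis" for x b
      using that unfolding q_def by (auto simp: floor_correct)
    have "finite (q ` sphere 0 1)"
    proof (rule finite_subset)
      show "finite ((Basis :: 'a set) \<rightarrow>\<^sub>E {- (\<lceil>1/a\<rceil> + 1) .. \<lceil>1/a\<rceil> + 1})" by (intro finite_PiE) auto
      have "q x \<in> (Basis :: 'a set) \<rightarrow>\<^sub>E {- (\<lceil>1/a\<rceil> + 1) .. \<lceil>1/a\<rceil> + 1}" if x: "x \<in> sphere 0 1" for x
      proof (rule PiE_I)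
        fix b :: 'a assume b: "b \<in> Basis"
        have "\<bar>x \<bullet> b\<bar> \<le> 1" using Basis_le_norm[OF b, of x] x by simp
        hence "\<bar>x \<bullet> b / a\<bar> \<le> 1 / a" using a by (simp add: divide_right_mono)
        hence "q x b \<le> 1/a" "- (1/a) < q x b + 1" using qfl[OF b, of x] by linarith+
        moreover have "1/a \<le> \<lceil>1/a\<rceil>" by simp
        ultimately show "q x b \<in> {- (\<lceil>1/a\<rceil> + 1) .. \<lceil>1/a\<rceil> + 1}" unfolding atLeastAtMost_iff by linarith
      qed (auto simp: q_def)
      thus "q ` sphere 0 1 \<subseteq> (Basis :: 'a set) \<rightarrow>\<^sub>E {- (\<lceil>1/a\<rceil> + 1) .. \<lceil>1/a\<rceil> + 1}" by blast
    qed
    hence "finite (rep ` q ` sphere 0 1)" by simp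
    hence fin: "finite (D c)" for c by (rule rev_finite_subset) (auto simp: D_def)
    have sub: "D c \<subseteq> sphere 0 1" for c unfolding D_def using rep by auto
    have sep: "K * \<kappa> < dist p p'" if p: "p \<in> D c" "p' \<in> D c" "p \<noteq> p'" for c p p'
    proof -
      obtain x x' where x: "x \<in> sphere 0 1" "col x = h c" "p = rep (q x)" "x' \<in> sphere 0 1" "col x' = h c" "p' = rep (q x')"
        using p unfolding D_def by auto
      have qp: "q p = q x" "q p' = q x'" using rep x by auto
      have "q x \<noteq> q x'" using x p by auto
      have "\<exists>b\<in>Basis. q x b \<noteq> q x' b"
      proof (rule ccontr)
        assume "\<not> ?thesis"
        hence "q x b = q x' b" for b by (cases "b \<in> Basis") (auto simp: q_def)
        thus False using \<open>q x \<noteq> q x'\<close> by blast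
      qed
      then obtain b where b: "b \<in> Basis" "q x b \<noteq> q x' b" by blast
      have "col x b = col x' b" using x by simp
      hence "q x b mod int m = q x' b mod int m" using b unfolding col_def by simp
      hence "int m dvd q x b - q x' b" by (simp add: mod_eq_dvd_iff)
      hence "int m \<le> \<bar>q x b - q x' b\<bar>" using b by (intro zdvd_imp_le) auto
      hence "real m \<le> \<bar>real_of_int (q p b) - real_of_int (q p' b)\<bar>" unfolding qp by linarith
      hence "real m - 1 \<le> \<bar>p \<bullet> b / a - p' \<bullet> b / a\<bar>"
        using qfl[OF b(1), of p] qfl[OF b(1), of p'] by linarith
      also have "\<dots> = \<bar>(p - p') \<bullet> b\<bar> / a" using a by (simp add: inner_diff_left diff_divide_distrib[symmetric])
      also have "\<dots> \<le> dist p p' / a" unfolding dist_norm using a b by (intro divide_right_mono Basis_le_norm) auto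
      finally have "K * real DIM('a) < dist p p' / a" using m by linarith
      hence "K * real DIM('a) * a < dist p p'" using a by (simp add: field_simps)
      thus ?thesis using a by (simp add: mult.assoc)
    qed
    have cover: "\<exists>c<card Q. \<exists>p\<in>D c. dist u p \<le> \<kappa>" if u: "u \<in> sphere 0 1" for u
    proof -
      obtain c where c: "c < card Q" "h c = col u" using h col[of u] unfolding bij_betw_def by (metis atLeastLessThan_iff imageE)
      have "rep (q u) \<in> D c" unfolding D_def using u c by auto
      moreover have "dist u (rep (q u)) \<le> \<kappa>"
      proof -
        define p where "p = rep (q u)"
        have qp: "q p = q u" unfolding p_def using rep u by auto
        have "norm (u - p) \<le> (\<Sum>b\<in>Basis. \<bar>(u - p) \<bullet> b\<bar>)" by (rule norm_le_l1)
        also have "\<dots> \<le> (\<Sum>b\<in>(Basis :: 'a set). a)"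
        proof (rule sum_mono)
          fix b :: 'a assume b: "b \<in> Basis"
          have "\<bar>u \<bullet> b / a - p \<bullet> b / a\<bar> \<le> 1" using qfl[OF b, of u] qfl[OF b, of p] unfolding qp by linarith
          hence "\<bar>(u - p) \<bullet> b\<bar> / a \<le> 1" using a by (simp add: inner_diff_left diff_divide_distrib[symmetric])
          thus "\<bar>(u - p) \<bullet> b\<bar> \<le> a" using a by (simp add: field_simps)
        qed
        finally show ?thesis using a unfolding p_def dist_norm by simp
      qed
      ultimately show ?thesis using c by blast
    qed
    show ?thesis using fin sub sep cover by (intro exI[of _ D]) blast
  qed
  thus ?thesis using J0 by blast
qed

text \<open>For a unit vector \<open>p\<close>: the flat disc of radius \<open>r\<close> that touches the sphere of radius \<open>s\<close> at \<open>s *\<^sub>R p\<close>.\<close>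

definition tangent_disc :: "real \<Rightarrow> 'a::real_inner \<Rightarrow> real \<Rightarrow> 'a set" where
  "tangent_disc s p r = {x. x \<bullet> p = s \<and> dist x (s *\<^sub>R p) \<le> r}"

lemma compact_tangent_disc: "compact (tangent_disc s (p :: 'a::euclidean_space) r)"
proof -
  have "tangent_disc s p r = cball (s *\<^sub>R p) r \<inter> {x. x \<bullet> p = s}"
    unfolding tangent_disc_def by (auto simp: dist_commute)
  moreover have "closed {x. x \<bullet> p = s}" by (intro closed_Collect_eq continuous_intros)
  ultimately show ?thesis by (simp add: compact_Int_closed)
qed

text \<open>By Pythagoras the disc lies within the sphere of radius \<open>sqrt (s\<^sup>2 + r\<^sup>2)\<close>. The excess over \<open>s\<close> is
  quadratic in \<open>r\<close>, which is why many layers of discs fit into a shell of thickness one.\<close>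

lemma tangent_disc_norm_less:
  fixes p :: "'a::real_inner"
  assumes p: "norm p = 1" and s: "s \<ge> 1" and r: "r > 0" and x: "x \<in> tangent_disc s p r"
  shows "norm x < s + r\<^sup>2"
proof -
  have pp: "p \<bullet> p = 1" using p by (simp add: norm_eq_1)
  have "(dist x (s *\<^sub>R p))\<^sup>2 = (norm x)\<^sup>2 - s\<^sup>2"
  proof -
    have "(dist x (s *\<^sub>R p))\<^sup>2 = x \<bullet> x - 2 * s * (x \<bullet> p) + s * s * (p \<bullet> p)"
      unfolding dist_norm power2_norm_eq_inner by (simp add: inner_diff_left inner_diff_right inner_commute algebra_simps)
    moreover have "x \<bullet> x = (norm x)\<^sup>2" by (simp add: power2_norm_eq_inner)
    ultimately show ?thesis using x pp unfolding tangent_disc_def by (simp add: power2_eq_square)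
  qed
  moreover have "(dist x (s *\<^sub>R p))\<^sup>2 \<le> r\<^sup>2" using x unfolding tangent_disc_def by (simp add: power_mono)
  moreover have "s\<^sup>2 + r\<^sup>2 < (s + r\<^sup>2)\<^sup>2"
  proof -
    have r2: "r\<^sup>2 > 0" using r by simp
    hence "r\<^sup>2 \<le> s * r\<^sup>2" "0 < (r\<^sup>2)\<^sup>2" using s by simp_all
    moreover have "(s + r\<^sup>2)\<^sup>2 = s\<^sup>2 + (r\<^sup>2)\<^sup>2 + 2 * (s * r\<^sup>2)" by (simp add: power2_sum)
    ultimately show ?thesis using r2 by linarith
  qed
  ultimately have "(norm x)\<^sup>2 < (s + r\<^sup>2)\<^sup>2" by linarith
  thus ?thesis using s r by (intro power_less_imp_less_base[of "norm x" 2]) auto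
qed

text \<open>A point of the disc at \<open>q\<close> differs from \<open>s *\<^sub>R q\<close> by a vector orthogonal to \<open>q\<close>, whose inner product with
  \<open>p\<close> is at most \<open>r * dist p q\<close>, whereas \<open>s * (q \<bullet> p) = s - s * (dist p q)\<^sup>2 / 2\<close>. For \<open>dist p q > 2 * r\<close> and \<open>s \<ge> 1\<close> the loss exceeds the gain.\<close>

lemma tangent_disc_separated:
  fixes p q :: "'a::real_inner"
  assumes p: "norm p = 1" and q: "norm q = 1" and s: "s \<ge> 1" and pq: "2 * r < dist p q" and r: "r > 0"
    and x: "x \<in> tangent_disc s q r"
  shows "x \<bullet> p < s"
proof -
  have pp: "p \<bullet> p = 1" "q \<bullet> q = 1" using p q by (simp_all add: norm_eq_1)
  define d where "d = dist p q"
  have d: "d\<^sup>2 = 2 - 2 * (q \<bullet> p)"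
    unfolding d_def dist_norm by (simp add: power2_norm_eq_inner inner_diff_left inner_diff_right pp inner_commute)
  have d0: "2 * r < d" "0 < d" using pq r unfolding d_def by auto
  have "(x - s *\<^sub>R q) \<bullet> q = 0" using x pp unfolding tangent_disc_def by (simp add: inner_diff_left)
  hence "(x - s *\<^sub>R q) \<bullet> p = (x - s *\<^sub>R q) \<bullet> (p - q)" by (simp add: inner_diff_right)
  also have "\<dots> \<le> norm (x - s *\<^sub>R q) * norm (p - q)" by (rule norm_cauchy_schwarz)
  also have "\<dots> \<le> r * d" unfolding d_def dist_norm using x by (intro mult_right_mono) (auto simp: tangent_disc_def dist_norm)
  finally have "x \<bullet> p \<le> s * (q \<bullet> p) + r * d" by (simp add: inner_diff_left)
  also have "s * (q \<bullet> p) = s - s * d\<^sup>2 / 2" unfolding d by (simp add: field_simps)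
  also have "r * d < d\<^sup>2 / 2" using d0 by (simp add: power2_eq_square)
  also have "d\<^sup>2 / 2 \<le> s * d\<^sup>2 / 2" using s by (simp add: mult_right_mono[of 1 s "d\<^sup>2", simplified])
  finally show ?thesis by simp
qed

lemma stacked_add_layer:
  fixes D :: "'a::euclidean_space set"
  assumes st: "stacked B \<Gamma>" and nb: "\<And>x. x \<in> B \<union> \<Gamma> \<Longrightarrow> norm x < s" and s: "s \<ge> 1" and r: "r > 0"
    and D: "finite D" "D \<subseteq> sphere 0 1" "\<And>p q. p \<in> D \<Longrightarrow> q \<in> D \<Longrightarrow> p \<noteq> q \<Longrightarrow> 2 * r < dist p q"
  shows "stacked B (\<Gamma> \<union> (\<Union>p\<in>D. tangent_disc s p r))"
  using D
proof (induction D rule: finite_induct)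
  case empty
  then show ?case using st by simp
next
  case (insert p D)
  have p: "norm p = 1" using insert.prems by auto
  have "stacked B ((\<Gamma> \<union> (\<Union>p\<in>D. tangent_disc s p r)) \<union> tangent_disc s p r)"
  proof (rule stacked.step[where \<nu> = p and s = s])
    show "stacked B (\<Gamma> \<union> (\<Union>p\<in>D. tangent_disc s p r))" using insert by auto
    show "compact (tangent_disc s p r)" by (rule compact_tangent_disc)
    show "s \<le> z \<bullet> p" if "z \<in> tangent_disc s p r" for z using that unfolding tangent_disc_def by auto
    fix z assume z: "z \<in> B \<union> (\<Gamma> \<union> (\<Union>p\<in>D. tangent_disc s p r))"
    show "z \<bullet> p < s"
    proof (cases "z \<in> B \<union> \<Gamma>")
      case True
      then show ?thesis using nb[OF True] norm_cauchy_schwarz[of z p] p by simp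
    next
      case False
      then obtain q where q: "q \<in> D" "z \<in> tangent_disc s q r" using z by auto
      hence "norm q = 1" "2 * r < dist p q" using insert by auto
      thus ?thesis using tangent_disc_separated[OF p _ s _ r q(2)] by auto
    qed
  qed
  thus ?case by (simp add: Un_ac)
qed

text \<open>A path that stays within \<open>r / 4\<close> of its starting point while crossing \<open>J\<close> layers keeps almost the
  same direction. The net contains a point \<open>p\<close> near this direction, of some colour \<open>c\<close>. The
  path starts below and ends above the hyperplane of the disc at \<open>p\<close> in layer \<open>c\<close>, and it meets this
  hyperplane inside the disc.\<close>

lemma path_crossing_discs:
  fixes \<gamma> :: "real \<Rightarrow> 'a::euclidean_space"
  assumes \<gamma>: "continuous_on {t0..t1} \<gamma>" and t: "t0 \<le> t1"
    and \<sigma>: "1 \<le> \<sigma>" "\<sigma> + real J * r\<^sup>2 \<le> S" and r: "r > 0" "real J * r\<^sup>2 \<le> r / 4"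
    and ends: "norm (\<gamma> t0) = \<sigma>" "norm (\<gamma> t1) = \<sigma> + real J * r\<^sup>2"
    and net: "\<And>u. u \<in> sphere 0 1 \<Longrightarrow> \<exists>c<J. \<exists>p\<in>D c. dist u p \<le> r / (4 * S)"
    and D: "\<And>c. c < J \<Longrightarrow> D c \<subseteq> sphere 0 1"
    and avoid: "\<And>t c p. t \<in> {t0..t1} \<Longrightarrow> c < J \<Longrightarrow> p \<in> D c \<Longrightarrow> \<gamma> t \<notin> tangent_disc (\<sigma> + real c * r\<^sup>2) p r"
  shows "\<exists>t\<in>{t0..t1}. r / 4 \<le> dist (\<gamma> t) (\<gamma> t0)"
proof (rule ccontr)
  assume "\<not> ?thesis"
  hence close: "dist (\<gamma> t) (\<gamma> t0) < r / 4" if "t \<in> {t0..t1}" for t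
    using that by (meson not_le)
  define x0 where "x0 = \<gamma> t0"
  have "0 \<le> real J * r\<^sup>2" by simp
  hence S: "S \<ge> 1" "\<sigma> \<le> S" using \<sigma> by linarith+
  have "x0 /\<^sub>R \<sigma> \<in> sphere 0 1" using ends \<sigma> unfolding x0_def by simp
  then obtain c p where c: "c < J" and p: "p \<in> D c" and up: "dist (x0 /\<^sub>R \<sigma>) p \<le> r / (4 * S)" using net by blast
  have np: "norm p = 1" using D[OF c] p by auto
  hence pp: "p \<bullet> p = 1" by (simp add: norm_eq_1)
  define s where "s = \<sigma> + real c * r\<^sup>2"
  have "real c + 1 \<le> real J" using c by linarith
  hence "(real c + 1) * r\<^sup>2 \<le> real J * r\<^sup>2" by (intro mult_right_mono) auto
  hence s: "\<sigma> \<le> s" "s + r\<^sup>2 \<le> \<sigma> + real J * r\<^sup>2" unfolding s_def by (auto simp: algebra_simps)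
  have x0p: "dist x0 (\<sigma> *\<^sub>R p) \<le> r / 4"
  proof -
    have "x0 - \<sigma> *\<^sub>R p = \<sigma> *\<^sub>R (x0 /\<^sub>R \<sigma> - p)" using \<sigma> by (simp add: algebra_simps)
    hence "dist x0 (\<sigma> *\<^sub>R p) = \<sigma> * dist (x0 /\<^sub>R \<sigma>) p" using \<sigma> unfolding dist_norm by simp
    also have "\<dots> \<le> S * (r / (4 * S))" using up S \<sigma> by (intro mult_mono) auto
    finally show ?thesis using S by simp
  qed
  have near: "dist (\<gamma> t) (\<rho> *\<^sub>R p) < r" if t: "t \<in> {t0..t1}" and \<rho>: "\<sigma> \<le> \<rho>" "\<rho> \<le> \<sigma> + real J * r\<^sup>2" for t \<rho>
  proof -
    have "dist (\<sigma> *\<^sub>R p) (\<rho> *\<^sub>R p) = \<bar>\<sigma> - \<rho>\<bar>"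
      using np unfolding dist_norm scaleR_diff_left[symmetric] by simp
    also have "\<dots> \<le> r / 4" using \<rho> r by linarith
    finally have "dist (\<sigma> *\<^sub>R p) (\<rho> *\<^sub>R p) \<le> r / 4" .
    moreover have "dist (\<gamma> t) (\<rho> *\<^sub>R p) \<le> dist (\<gamma> t) x0 + dist x0 (\<sigma> *\<^sub>R p) + dist (\<sigma> *\<^sub>R p) (\<rho> *\<^sub>R p)"
      using dist_triangle[of "\<gamma> t" "\<rho> *\<^sub>R p" x0] dist_triangle[of x0 "\<rho> *\<^sub>R p" "\<sigma> *\<^sub>R p"] by linarith
    ultimately show ?thesis using close[OF t] x0p r unfolding x0_def by linarith
  qed
  have "\<gamma> t0 \<bullet> p \<le> s" using norm_cauchy_schwarz[of "\<gamma> t0" p] ends np s by simp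
  moreover have "s \<le> \<gamma> t1 \<bullet> p"
  proof -
    define \<rho> where "\<rho> = \<sigma> + real J * r\<^sup>2"
    have \<rho>: "\<rho> \<ge> 1" "s + r\<^sup>2 \<le> \<rho>" "norm (\<gamma> t1) = \<rho>"
      using s \<sigma> ends \<open>0 \<le> real J * r\<^sup>2\<close> unfolding \<rho>_def by linarith+
    have "dist (\<gamma> t1) (\<rho> *\<^sub>R p) < r" using t s unfolding \<rho>_def by (intro near) auto
    hence "(dist (\<gamma> t1) (\<rho> *\<^sub>R p))\<^sup>2 \<le> r\<^sup>2" by (simp add: power_mono)
    moreover have "(dist (\<gamma> t1) (\<rho> *\<^sub>R p))\<^sup>2 = 2 * \<rho> * (\<rho> - \<gamma> t1 \<bullet> p)"
    proof -
      have "(dist (\<gamma> t1) (\<rho> *\<^sub>R p))\<^sup>2 = \<gamma> t1 \<bullet> \<gamma> t1 - 2 * \<rho> * (\<gamma> t1 \<bullet> p) + \<rho> * \<rho> * (p \<bullet> p)"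
        unfolding dist_norm power2_norm_eq_inner by (simp add: inner_diff_left inner_diff_right inner_commute algebra_simps)
      also have "\<gamma> t1 \<bullet> \<gamma> t1 = \<rho> * \<rho>" using \<rho>(3) by (metis dot_square_norm power2_eq_square)
      finally show ?thesis using pp by (simp add: algebra_simps)
    qed
    ultimately have *: "2 * \<rho> * (\<rho> - \<gamma> t1 \<bullet> p) \<le> r\<^sup>2" by simp
    show ?thesis
    proof (rule ccontr)
      assume "\<not> ?thesis"
      hence "r\<^sup>2 < \<rho> - \<gamma> t1 \<bullet> p" using \<rho> by simp
      moreover have "0 < r\<^sup>2" using r by simp
      ultimately have "0 \<le> \<rho> - \<gamma> t1 \<bullet> p" by linarith
      hence "1 * (\<rho> - \<gamma> t1 \<bullet> p) \<le> 2 * \<rho> * (\<rho> - \<gamma> t1 \<bullet> p)"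
        using \<rho>(1) by (intro mult_right_mono) auto
      from order_trans[OF this *] show False using \<open>r\<^sup>2 < \<rho> - \<gamma> t1 \<bullet> p\<close> by simp
    qed
  qed
  moreover have "continuous_on {t0..t1} (\<lambda>t. \<gamma> t \<bullet> p)" using \<gamma> by (intro continuous_intros)
  ultimately obtain \<tau> where \<tau>: "\<tau> \<in> {t0..t1}" "\<gamma> \<tau> \<bullet> p = s"
    using IVT'[of "\<lambda>t. \<gamma> t \<bullet> p" t0 s t1] t by auto
  moreover have "dist (\<gamma> \<tau>) (s *\<^sub>R p) \<le> r" using near[OF \<tau>(1), of s] s zero_le_power2[of r] by (simp add: less_imp_le)
  ultimately have "\<gamma> \<tau> \<in> tangent_disc s p r" unfolding tangent_disc_def by simp
  thus False using avoid[OF \<tau>(1) c p] unfolding s_def by simp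
qed

text \<open>A path that crosses the shell from radius \<open>R\<close> to radius \<open>R + 1\<close> and avoids \<open>\<Gamma>\<close> has length at least \<open>M\<close>.
  Arc length is replaced by any function \<open>A\<close> whose increments dominate the displacements, so that
  paths need only be continuous here.\<close>

definition lengthening :: "real \<Rightarrow> real \<Rightarrow> 'a::real_normed_vector set \<Rightarrow> bool" where
  "lengthening R M \<Gamma> \<longleftrightarrow> (\<forall>\<gamma> A (b :: real). continuous_on {0..b} \<gamma> \<and> 0 \<le> b \<and> norm (\<gamma> 0) \<le> R \<and> R + 1 \<le> norm (\<gamma> b) \<and>
      \<gamma> ` {0..b} \<inter> \<Gamma> = {} \<and> (\<forall>t t'. 0 \<le> t \<and> t \<le> t' \<and> t' \<le> b \<longrightarrow> dist (\<gamma> t) (\<gamma> t') \<le> A t' - A t) \<longrightarrow>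
      M \<le> A b - (A 0 :: real))"

lemma lengtheningD:
  fixes \<gamma> :: "real \<Rightarrow> 'a::real_normed_vector"
  assumes "lengthening R M \<Gamma>" "continuous_on {0..b} \<gamma>" "0 \<le> b" "norm (\<gamma> 0) \<le> R" "R + 1 \<le> norm (\<gamma> b)"
    "\<gamma> ` {0..b} \<inter> \<Gamma> = {}" "\<And>t t'. 0 \<le> t \<Longrightarrow> t \<le> t' \<Longrightarrow> t' \<le> b \<Longrightarrow> dist (\<gamma> t) (\<gamma> t') \<le> A t' - A t"
  shows "M \<le> A b - A 0"
  using assms unfolding lengthening_def by blast

text \<open>A layer of discs of radius \<open>r\<close> needs thickness \<open>r\<^sup>2\<close>, so a shell of thickness one contains about
  \<open>1 / (J * r\<^sup>2)\<close> groups of \<open>J\<close> layers, one layer for each colour. Crossing a group costs length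
  \<open>r / 4\<close>. The total is of order \<open>1 / (J * r)\<close> and becomes arbitrarily large for small \<open>r\<close>.\<close>

lemma labyrinth_exists:
  fixes R M :: real
  assumes R: "R \<ge> 1"
  obtains \<Gamma> :: "'a::euclidean_space set"
  where "stacked (cball 0 R) \<Gamma>" "\<Gamma> \<subseteq> cball 0 (R + 1)" "lengthening R M \<Gamma>"
proof -
  \<comment> \<open>used with \<open>\<kappa> = r / (4 * (R + 1))\<close>, for which the separation \<open>8 * (R + 1) * \<kappa>\<close> is \<open>2 * r\<close>\<close>
  obtain J where J: "J > 0" and net: "\<And>\<kappa>. \<kappa> > 0 \<Longrightarrow> \<exists>D :: nat \<Rightarrow> 'a set.
    (\<forall>c<J. finite (D c) \<and> D c \<subseteq> sphere 0 1 \<and> (\<forall>p\<in>D c. \<forall>q\<in>D c. p \<noteq> q \<longrightarrow> (8 * (R + 1)) * \<kappa> < dist p q)) \<and>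
    (\<forall>u\<in>sphere 0 1. \<exists>c<J. \<exists>p\<in>D c. dist u p \<le> \<kappa>)"
    using coloured_sphere_net[of "8 * (R + 1)", where 'a = 'a] R by auto
  \<comment> \<open>large enough for both \<open>J * r\<^sup>2 \<le> r / 4\<close> and \<open>M \<le> G * (r / 4)\<close>\<close>
  obtain N where N: "real N \<ge> 2 * real J * (4 * \<bar>M\<bar> + 1) + 4 * real J" using real_arch_simple by blast
  have "real J \<ge> 1" using J by simp
  moreover have "2 * real J * (4 * \<bar>M\<bar> + 1) \<ge> 0" by simp
  ultimately have N4: "real N \<ge> 4 * real J" "real N \<ge> 4" using N by linarith+
  define r where "r = 1 / real N"
  have r: "r > 0" "real J * r\<^sup>2 \<le> r / 4" using N4 unfolding r_def by (auto simp: field_simps power2_eq_square)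
  \<comment> \<open>the number of groups; the factor \<open>2\<close> leaves room for the first layer at \<open>R + r\<^sup>2\<close>\<close>
  define G where "G = N\<^sup>2 div (2 * J)"
  have "G * (2 * J) \<le> N\<^sup>2" unfolding G_def by simp
  hence "real G * (2 * real J) \<le> real N ^ 2"
    using of_nat_le_iff[where 'a = real, of "G * (2 * J)" "N\<^sup>2"] by (simp only: of_nat_mult of_nat_numeral of_nat_power)
  moreover have "2 \<le> real N ^ 2" using N4 power_mono[of 4 "real N" 2] by simp
  ultimately have "real G * real J + 1 \<le> real N ^ 2" by linarith
  hence GJ: "(real G * real J + 1) * r\<^sup>2 \<le> 1" using N4 unfolding r_def by (simp add: power_divide)
  have "N\<^sup>2 < (G + 1) * (2 * J)" using J dividend_less_times_div[of "2 * J" "N\<^sup>2"] unfolding G_def by (simp add: algebra_simps)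
  hence "real N ^ 2 < (real G + 1) * (2 * real J)"
    using of_nat_less_iff[where 'a = real, of "N\<^sup>2" "(G + 1) * (2 * J)"] by (simp only: of_nat_mult of_nat_numeral of_nat_power of_nat_add of_nat_1)
  hence "real N * (real N - 2 * real J) < real G * (2 * real J) + 2 * real J - 2 * real J * real N" by (simp add: power2_eq_square algebra_simps)
  also have "\<dots> \<le> real G * (2 * real J)" using N4 J by simp
  finally have "real N * (2 * real J * (4 * \<bar>M\<bar>)) \<le> real G * (2 * real J)"
    using N mult_left_mono[of "2 * real J * (4 * \<bar>M\<bar>)" "real N - 2 * real J" "real N"] by (simp add: algebra_simps)
  hence "real N * (4 * \<bar>M\<bar>) \<le> real G" using J by (simp add: ac_simps)
  moreover have "real N * (4 * M) \<le> real N * (4 * \<bar>M\<bar>)" by (intro mult_left_mono) auto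
  ultimately have "real N * (4 * M) \<le> real G" by linarith
  hence GM: "M \<le> real G * (r / 4)" using N4 unfolding r_def by (simp add: field_simps)
  obtain D :: "nat \<Rightarrow> 'a set" where
    D: "\<And>c. c < J \<Longrightarrow> finite (D c)" "\<And>c. c < J \<Longrightarrow> D c \<subseteq> sphere 0 1"
      "\<And>c p q. c < J \<Longrightarrow> p \<in> D c \<Longrightarrow> q \<in> D c \<Longrightarrow> p \<noteq> q \<Longrightarrow> 2 * r < dist p q"
    and cover: "\<And>u. u \<in> sphere 0 1 \<Longrightarrow> \<exists>c<J. \<exists>p\<in>D c. dist u p \<le> r / (4 * (R + 1))"
  proof -
    have "8 * x * (r / (4 * x)) = 2 * r" if "x > 0" for x using that by (simp add: field_simps)
    from this[of "R + 1"] have "r / (4 * (R + 1)) > 0" "8 * (R + 1) * (r / (4 * (R + 1))) = 2 * r"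
      using r R by simp_all
    thus thesis using net[of "r / (4 * (R + 1))"] that by metis
  qed
  define s where "s = (\<lambda>l :: nat. R + real (l + 1) * r\<^sup>2)"
  have s1: "s l \<ge> 1" for l using R unfolding s_def by (simp add: add_increasing2)
  define L where "L = (\<lambda>n. \<Union>l<n. \<Union>p\<in>D (l mod J). tangent_disc (s l) p r)"
  have L: "stacked (cball 0 R) (L n) \<and> (\<forall>x\<in>cball 0 R \<union> L n. norm x < s n)" for n
  proof (induction n)
    case 0
    then show ?case using r by (auto simp: L_def s_def intro: stacked.empty le_less_trans)
  next
    case (Suc n)
    have c: "n mod J < J" using J by simp
    have Ln: "L (Suc n) = L n \<union> (\<Union>p\<in>D (n mod J). tangent_disc (s n) p r)"
      unfolding L_def lessThan_Suc by (simp add: Un_commute)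
    have sn: "s (Suc n) = s n + r\<^sup>2" unfolding s_def by (simp add: algebra_simps)
    have "stacked (cball 0 R) (L (Suc n))"
      unfolding Ln by (rule stacked_add_layer) (use Suc s1 r D c in auto)
    moreover have "norm x < s (Suc n)" if x: "x \<in> cball 0 R \<union> L (Suc n)" for x
    proof (cases "x \<in> cball 0 R \<union> L n")
      case True
      hence "norm x < s n" using Suc by blast
      thus ?thesis using sn zero_le_power2[of r] by linarith
    next
      case False
      then obtain p where p: "p \<in> D (n mod J)" "x \<in> tangent_disc (s n) p r" using x Ln by auto
      thus ?thesis using tangent_disc_norm_less[OF _ s1 r(1) p(2)] D(2)[OF c] sn by auto
    qed
    ultimately show ?case by blast
  qed
  have sG: "s (G * J) \<le> R + 1" using GJ unfolding s_def by (simp add: algebra_simps)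
  have st: "stacked (cball 0 R) (L (G * J))" using L by blast
  have "norm x \<le> R + 1" if "x \<in> L (G * J)" for x
  proof -
    have "norm x < s (G * J)" using L[of "G * J"] that by blast
    thus ?thesis using sG by linarith
  qed
  hence sub: "L (G * J) \<subseteq> cball 0 (R + 1)" by auto
  have len: "lengthening R M (L (G * J))"
    unfolding lengthening_def
  proof (intro allI impI, elim conjE)
    fix \<gamma> :: "real \<Rightarrow> 'a" and A :: "real \<Rightarrow> real" and b :: real
    assume \<gamma>: "continuous_on {0..b} \<gamma>" and b: "0 \<le> b" and ends: "norm (\<gamma> 0) \<le> R" "R + 1 \<le> norm (\<gamma> b)"
      and avoid: "\<gamma> ` {0..b} \<inter> L (G * J) = {}"
      and dom: "\<forall>t t'. 0 \<le> t \<and> t \<le> t' \<and> t' \<le> b \<longrightarrow> dist (\<gamma> t) (\<gamma> t') \<le> A t' - A t"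
    have A: "dist (\<gamma> t) (\<gamma> t') \<le> A t' - A t" if "0 \<le> t" "t \<le> t'" "t' \<le> b" for t t'
      using dom that by blast
    have mono: "A t \<le> A t'" if "0 \<le> t" "t \<le> t'" "t' \<le> b" for t t'
      using A[OF that] zero_le_dist[of "\<gamma> t" "\<gamma> t'"] by linarith
    have s_le: "s l \<le> R + 1" if "l \<le> G * J" for l
    proof -
      have "real (l + 1) \<le> real (G * J + 1)" using that by (simp only: of_nat_le_iff add_le_cancel_right)
      hence "real (l + 1) * r\<^sup>2 \<le> real (G * J + 1) * r\<^sup>2" by (intro mult_right_mono) auto
      thus ?thesis using sG unfolding s_def by linarith
    qed
    have reach_sphere: "\<exists>\<tau>\<in>{t0..b}. norm (\<gamma> \<tau>) = s l"
      if t0: "t0 \<in> {0..b}" "norm (\<gamma> t0) \<le> s l" and l: "l \<le> G * J" for t0 l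
    proof -
      have "continuous_on {t0..b} (\<lambda>t. norm (\<gamma> t))"
        using t0 by (intro continuous_on_norm continuous_on_subset[OF \<gamma>]) auto
      thus ?thesis using IVT'[of "\<lambda>t. norm (\<gamma> t)" t0 "s l" b] t0 s_le[OF l] ends by auto
    qed
    have "\<exists>\<tau>\<in>{0..b}. norm (\<gamma> \<tau>) = s (g * J) \<and> real g * (r / 4) \<le> A \<tau> - A 0" if "g \<le> G" for g
      using that
    proof (induction g)
      case 0
      have "R \<le> s 0" unfolding s_def by simp
      then obtain \<tau> where "\<tau> \<in> {0..b}" "norm (\<gamma> \<tau>) = s 0" using reach_sphere[of 0 0] ends b by auto
      thus ?case using mono[of 0 \<tau>] by (intro bexI[of _ \<tau>]) auto
    next
      case (Suc g)
      then obtain t0 where t0: "t0 \<in> {0..b}" "norm (\<gamma> t0) = s (g * J)" "real g * (r / 4) \<le> A t0 - A 0" by auto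
      have le: "Suc g * J \<le> G * J" using Suc.prems by (rule mult_le_mono1)
      have sS: "s (Suc g * J) = s (g * J) + real J * r\<^sup>2" unfolding s_def by (simp add: algebra_simps)
      obtain t1 where t1: "t1 \<in> {t0..b}" "norm (\<gamma> t1) = s (Suc g * J)"
        using reach_sphere[OF t0(1) _ le] t0(2) sS by auto
      have "\<exists>t\<in>{t0..t1}. r / 4 \<le> dist (\<gamma> t) (\<gamma> t0)"
      proof (rule path_crossing_discs[where D = D and S = "R + 1"])
        show "continuous_on {t0..t1} \<gamma>" using t0 t1 by (intro continuous_on_subset[OF \<gamma>]) auto
        show "s (g * J) + real J * r\<^sup>2 \<le> R + 1" using s_le[OF le] sS by simp
        show "norm (\<gamma> t1) = s (g * J) + real J * r\<^sup>2" using t1 sS by simp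
        fix t c p assume t: "t \<in> {t0..t1}" and c: "c < J" and p: "p \<in> D c"
        have "s (g * J) + real c * r\<^sup>2 = s (g * J + c)" unfolding s_def by (simp add: algebra_simps)
        moreover have "g * J + c < G * J" using c le by simp
        moreover have "(g * J + c) mod J = c" using c by simp
        ultimately have "tangent_disc (s (g * J) + real c * r\<^sup>2) p r \<subseteq> L (G * J)"
          using p unfolding L_def by (metis (no_types, lifting) UN_upper lessThan_iff subset_trans)
        moreover have "t \<in> {0..b}" using t t0 t1 by auto
        ultimately show "\<gamma> t \<notin> tangent_disc (s (g * J) + real c * r\<^sup>2) p r" using avoid by blast
      qed (use t0 t1 s1 r cover D in auto)
      then obtain t where t: "t \<in> {t0..t1}" "r / 4 \<le> dist (\<gamma> t) (\<gamma> t0)" by blast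
      have "r / 4 \<le> A t - A t0" using A[of t0 t] t t0 t1 by (auto simp: dist_commute)
      also have "\<dots> \<le> A t1 - A t0" using mono[of t t1] t t0 t1 by auto
      finally have "real (Suc g) * (r / 4) \<le> A t1 - A 0"
        using t0(3) unfolding of_nat_Suc distrib_right mult_1 by linarith
      thus ?case using t0 t1 by (intro bexI[of _ t1]) auto
    qed
    from this[of G] obtain \<tau> where "\<tau> \<in> {0..b}" "real G * (r / 4) \<le> A \<tau> - A 0" by blast
    thus "M \<le> A b - A 0" using GM mono[of \<tau> b] by auto
  qed
  show thesis by (rule that[OF st sub len])
qed


section \<open>The infinite composition\<close>

text \<open>The radius \<open>R\<close> of the next labyrinth is chosen after \<open>\<Phi>\<close> so that the ball about \<open>0\<close> of radius \<open>R - 1\<close>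
  contains both the ball of radius \<open>S + 1\<close> and its image under \<open>\<Phi>\<close>. Composing with an
  automorphism that is almost the identity on that ball then changes \<open>\<Phi>\<close> and \<open>\<Psi>\<close> little on the ball of radius
  \<open>S + 1\<close>. The bound \<open>M\<close> may depend on \<open>R\<close>, because the metric is compared with the Euclidean one on a
  ball whose size is only known at this point.\<close>

lemma automorphism_step:
  fixes \<Phi> \<Psi> :: "complex ^ 'n \<Rightarrow> complex ^ 'n" and W :: "(complex ^ 'n) set" and M :: "real \<Rightarrow> real"
  assumes n: "CARD('n) > 1" and pair: "aut_pair \<Phi> \<Psi>" and W: "open W" "\<not> bounded W" and e: "e > 0"
  obtains R \<Gamma> \<Phi>' \<Psi>' where "S + 1 \<le> R" "aut_pair \<Phi>' \<Psi>'" "compact \<Gamma>" "\<Gamma> \<subseteq> cball 0 (R + 1)" "lengthening R (M R) \<Gamma>"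
    "\<And>z. norm z \<le> S + 1 \<Longrightarrow> dist (\<Phi>' z) (\<Phi> z) \<le> e" "\<And>z. norm z \<le> S + 1 \<Longrightarrow> dist (\<Psi>' z) (\<Psi> z) \<le> e"
    "\<Psi>' ` \<Gamma> \<subseteq> W"
proof -
  have "compact (\<Phi> ` cball 0 (S + 1))"
    by (intro compact_continuous_image aut_pair_continuous(1)[OF pair] compact_cball)
  then obtain B where B: "\<And>z. norm z \<le> S + 1 \<Longrightarrow> norm (\<Phi> z) \<le> B"
    using compact_imp_bounded bounded_iff by (metis (no_types, lifting) imageI mem_cball_0)
  define R where "R = \<bar>B\<bar> + \<bar>S\<bar> + 2"
  have R: "R \<ge> 1" "S + 1 \<le> R - 1" "B \<le> R - 1" unfolding R_def by auto
  obtain \<Gamma> :: "(complex ^ 'n) set" where \<Gamma>: "stacked (cball 0 R) \<Gamma>" "\<Gamma> \<subseteq> cball 0 (R + 1)" and len: "lengthening R (M R) \<Gamma>"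
    using labyrinth_exists[OF R(1), of "M R"] .
  have "uniformly_continuous_on (cball 0 R) \<Psi>"
    by (intro compact_uniformly_continuous aut_pair_continuous(2)[OF pair] compact_cball)
  then obtain d where d: "d > 0" "\<And>x y. norm x \<le> R \<Longrightarrow> norm y \<le> R \<Longrightarrow> dist x y < d \<Longrightarrow> dist (\<Psi> x) (\<Psi> y) < e"
    using e unfolding uniformly_continuous_on_def by (metis mem_cball_0)
  define e1 where "e1 = min (min e d) 1"
  have e1: "e1 > 0" "e1 \<le> e" "e1 \<le> d" "e1 \<le> 1" using e d unfolding e1_def by auto
  have "\<exists>\<theta> \<theta>'. aut_pair \<theta> \<theta>' \<and> (\<forall>z\<in>cball 0 (R - 1). dist (\<theta> z) z < e1 \<and> dist (\<theta>' z) z < e1) \<and> \<theta>' ` \<Gamma> \<subseteq> \<Psi> -` W"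
    by (rule push_stack_into_unbounded_open[OF n \<Gamma>(1) aut_pair_vimage_open[OF pair W(1)] aut_pair_vimage_unbounded[OF pair W(2)] e1(1)]) simp
  then obtain \<theta> \<theta>' where \<theta>: "aut_pair \<theta> \<theta>'" "\<And>z. norm z \<le> R - 1 \<Longrightarrow> dist (\<theta> z) z < e1 \<and> dist (\<theta>' z) z < e1"
    "\<theta>' ` \<Gamma> \<subseteq> \<Psi> -` W" by (metis mem_cball_0)
  show thesis
  proof (rule that[of R "\<lambda>z. \<theta> (\<Phi> z)" "\<lambda>z. \<Psi> (\<theta>' z)" \<Gamma>])
    show "aut_pair (\<lambda>z. \<theta> (\<Phi> z)) (\<lambda>z. \<Psi> (\<theta>' z))" by (rule aut_pair_compose[OF pair \<theta>(1)])
    show "compact \<Gamma>" by (rule stacked_compact[OF \<Gamma>(1)])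
    fix z :: "complex ^ 'n" assume z: "norm z \<le> S + 1"
    have "norm (\<Phi> z) \<le> R - 1" using B[OF z] R by linarith
    thus "dist (\<theta> (\<Phi> z)) (\<Phi> z) \<le> e" using \<theta>(2) e1 by fastforce
    have 1: "dist (\<theta>' z) z < e1" using \<theta>(2)[of z] z R by simp
    hence "norm (\<theta>' z) \<le> R" using z R e1 norm_triangle_sub[of "\<theta>' z" z] by (simp add: dist_norm)
    thus "dist (\<Psi> (\<theta>' z)) (\<Psi> z) \<le> e" using d(2)[of "\<theta>' z" z] 1 e1 z R by simp
  qed (use R \<Gamma>(2) len \<theta>(3) in auto)
qed

lemma uniform_limit_of_geometric_steps:
  fixes f :: "nat \<Rightarrow> 'a::real_normed_vector \<Rightarrow> 'b::banach"
  assumes e: "\<And>n. e n > 0" "\<And>n. e (Suc n) \<le> e n / 2" and R: "\<And>n. R n + 1 \<le> R (Suc n)"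
    and f: "\<And>n z. norm z \<le> R n + 1 \<Longrightarrow> dist (f (Suc n) z) (f n z) \<le> e n"
  obtains g where "\<And>r. uniform_limit (cball 0 r) f g sequentially"
    "\<And>n z. norm z \<le> R n + 1 \<Longrightarrow> dist (g z) (f n z) \<le> 2 * e n"
proof -
  have mono: "R n \<le> R m" if "n \<le> m" for n m
    using that
  proof (induction m rule: dec_induct)
    case (step m)
    thus ?case using R[of m] by linarith
  qed simp
  have R_ge: "R 0 + real n \<le> R n" for n
  proof (induction n)
    case (Suc n)
    thus ?case using R[of n] unfolding of_nat_Suc by linarith
  qed simp
  have step: "dist (f m z) (f n z) \<le> 2 * e n - 2 * e m" if z: "norm z \<le> R n + 1" and nm: "n \<le> m" for n m z
    using nm
  proof (induction m rule: dec_induct)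
    case (step m)
    have "dist (f (Suc m) z) (f m z) \<le> e m" using z mono[OF step(1)] by (intro f) auto
    thus ?case using step.IH e(2)[of m] dist_triangle[of "f (Suc m) z" "f n z" "f m z"] by linarith
  qed simp
  have e0: "e n \<le> e 0 * (1/2) ^ n" for n
  proof (induction n)
    case (Suc n)
    thus ?case using e(2)[of n] by simp
  qed simp
  have lim0: "(\<lambda>n. 2 * e n) \<longlonglongrightarrow> 0"
  proof (rule real_tendsto_sandwich[OF _ _ tendsto_const])
    show "(\<lambda>n. 2 * (e 0 * (1/2) ^ n)) \<longlonglongrightarrow> 0" by (intro tendsto_eq_intros LIMSEQ_power_zero | simp)+
    show "\<forall>\<^sub>F n in sequentially. 0 \<le> 2 * e n" using e(1) by (simp add: less_imp_le)
    show "\<forall>\<^sub>F n in sequentially. 2 * e n \<le> 2 * (e 0 * (1/2) ^ n)" using e0 by simp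
  qed
  have "\<exists>l. (\<lambda>n. f n z) \<longlonglongrightarrow> l" for z
  proof -
    obtain N0 :: nat where N0: "norm z - R 0 - 1 \<le> real N0" using real_arch_simple by blast
    have z: "norm z \<le> R n + 1" if "n \<ge> N0" for n using that R_ge[of n] N0 by linarith
    have "Cauchy (\<lambda>n. f n z)"
    proof (rule CauchyI')
      fix \<epsilon> :: real assume "\<epsilon> > 0"
      then obtain N1 where N1: "\<And>n. n \<ge> N1 \<Longrightarrow> 2 * e n < \<epsilon>"
        using order_tendstoD(2)[OF lim0] unfolding eventually_sequentially by blast
      have "dist (f m z) (f n z) < \<epsilon>" if "m \<ge> max N0 N1" "n > m" for m n
        using step[OF z, of m n] e(1)[of n] N1[of m] that by (auto simp: dist_commute)
      thus "\<exists>M. \<forall>m\<ge>M. \<forall>n>m. dist (f m z) (f n z) < \<epsilon>" by blast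
    qed
    thus ?thesis by (meson Cauchy_convergent convergent_def)
  qed
  then obtain g where g: "\<And>z. (\<lambda>n. f n z) \<longlonglongrightarrow> g z" by metis
  have close: "dist (g z) (f n z) \<le> 2 * e n" if z: "norm z \<le> R n + 1" for n z
  proof (rule tendsto_upperbound[OF tendsto_dist[OF g tendsto_const]])
    have "dist (f m z) (f n z) \<le> 2 * e n" if "m \<ge> n" for m
      using step[OF z that] e(1)[of m] by linarith
    thus "\<forall>\<^sub>F m in sequentially. dist (f m z) (f n z) \<le> 2 * e n" unfolding eventually_sequentially by blast
  qed simp
  have "uniform_limit (cball 0 r) f g sequentially" for r
  proof (rule uniform_limitI)
    fix \<epsilon> :: real assume "\<epsilon> > 0"
    then obtain N1 where N1: "\<And>n. n \<ge> N1 \<Longrightarrow> 2 * e n < \<epsilon>"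
      using order_tendstoD(2)[OF lim0] unfolding eventually_sequentially by blast
    obtain N0 :: nat where N0: "r - R 0 - 1 \<le> real N0" using real_arch_simple by blast
    have "dist (f n z) (g z) < \<epsilon>" if "n \<ge> max N0 N1" "z \<in> cball 0 r" for n z
    proof -
      have "norm z \<le> R n + 1" using that R_ge[of n] N0 by simp
      from close[OF this] show ?thesis using N1[of n] that by (simp add: dist_commute)
    qed
    thus "\<forall>\<^sub>F n in sequentially. \<forall>z\<in>cball 0 r. dist (f n z) (g z) < \<epsilon>" unfolding eventually_sequentially by blast
  qed
  thus thesis using that close by blast
qed

text \<open>At step \<open>n\<close> a margin \<open>e n\<close> is recorded such that even the \<open>2 * e n\<close>-neighbourhood of the image of \<open>\<Gamma> n\<close> lies in
  \<open>W n\<close>. The margins at least halve at each step and bound the change made by the next step, so all later changes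
  together amount to at most \<open>2 * e n\<close> and the inclusion holds in the limit.\<close>

lemma automorphism_pulling_labyrinths:
  fixes W :: "nat \<Rightarrow> (complex ^ 'n) set" and M :: "nat \<Rightarrow> real \<Rightarrow> real"
  assumes n: "CARD('n) > 1" and W: "\<And>n. open (W n)" "\<And>n. \<not> bounded (W n)"
  obtains \<Phi> \<Psi> R \<Gamma> where "aut_pair \<Phi> \<Psi>" "\<And>n. real n \<le> R n" "\<And>n. lengthening (R n) (M n (R n)) (\<Gamma> n)"
    "\<And>n. \<Psi> ` \<Gamma> n \<subseteq> W n"
proof -
  define P where "P = (\<lambda>n (\<Phi> :: complex ^ 'n \<Rightarrow> complex ^ 'n, \<Psi>, R, \<Gamma>, e :: real).
     aut_pair \<Phi> \<Psi> \<and> real n \<le> R \<and> \<Gamma> \<subseteq> cball 0 (R + 1) \<and> lengthening R (M n R) \<Gamma> \<and> e > 0 \<and>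
     (\<Union>z\<in>\<Gamma>. cball (\<Psi> z) (2 * e)) \<subseteq> W n)"
  define Q where "Q = (\<lambda>n :: nat. \<lambda>(\<Phi> :: complex ^ 'n \<Rightarrow> complex ^ 'n, \<Psi> :: complex ^ 'n \<Rightarrow> complex ^ 'n, R, \<Gamma> :: (complex ^ 'n) set, e :: real)
       (\<Phi>', \<Psi>', R', \<Gamma>' :: (complex ^ 'n) set, e').
     R + 1 \<le> R' \<and> e' \<le> e / 2 \<and> (\<forall>z. norm z \<le> R + 1 \<longrightarrow> dist (\<Phi>' z) (\<Phi> z) \<le> e \<and> dist (\<Psi>' z) (\<Psi> z) \<le> e))"
  have step: "\<exists>y. P m y \<and> (\<forall>k. Q k (\<Phi>, \<Psi>, R, \<Gamma>, e) y)" if pair: "aut_pair \<Phi> \<Psi>" and e: "e > 0" and R: "real m \<le> R + 1" for m \<Phi> \<Psi> R \<Gamma> e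
  proof -
    obtain R' \<Gamma>' \<Phi>' \<Psi>' where 1: "R + 1 \<le> R'" "aut_pair \<Phi>' \<Psi>'" "compact \<Gamma>'" "\<Gamma>' \<subseteq> cball 0 (R' + 1)" "lengthening R' (M m R') \<Gamma>'"
      "\<And>z. norm z \<le> R + 1 \<Longrightarrow> dist (\<Phi>' z) (\<Phi> z) \<le> e" "\<And>z. norm z \<le> R + 1 \<Longrightarrow> dist (\<Psi>' z) (\<Psi> z) \<le> e"
      "\<Psi>' ` \<Gamma>' \<subseteq> W m"
      using automorphism_step[OF n pair W e, of R "M m"] by metis
    have "compact (\<Psi>' ` \<Gamma>')" by (intro compact_continuous_image aut_pair_continuous(2)[OF 1(2)] 1)
    then obtain d where d: "d > 0" "(\<Union>x\<in>\<Psi>' ` \<Gamma>'. cball x d) \<subseteq> W m" using compact_open_margin[OF _ W(1) 1(8)] by blast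
    define e' where "e' = min (e/2) (d/2)"
    have e': "e' > 0" "e' \<le> e/2" "2 * e' \<le> d" using e d unfolding e'_def by auto
    have "cball (\<Psi>' z) (2 * e') \<subseteq> W m" if "z \<in> \<Gamma>'" for z
    proof -
      have "cball (\<Psi>' z) (2 * e') \<subseteq> cball (\<Psi>' z) d" using e' by (intro subset_cball)
      thus ?thesis using d(2) that by blast
    qed
    hence "P m (\<Phi>', \<Psi>', R', \<Gamma>', e')" unfolding P_def using 1 e' R by auto
    moreover have "Q k (\<Phi>, \<Psi>, R, \<Gamma>, e) (\<Phi>', \<Psi>', R', \<Gamma>', e')" for k unfolding Q_def using 1 e' by auto
    ultimately show ?thesis by blast
  qed
  have "\<exists>x. \<forall>n. P n (x n) \<and> Q n (x n) (x (Suc n))"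
  proof (rule dependent_nat_choice)
    have "real 0 \<le> 0 + (1 :: real)" by simp
    from step[OF aut_pair_id zero_less_one this, of "{}"] show "\<exists>x. P 0 x" by blast
    fix x m assume x: "P m x"
    obtain \<Phi> \<Psi> R \<Gamma> e where xx: "x = (\<Phi>, \<Psi>, R, \<Gamma>, e)" by (cases x) auto
    have "aut_pair \<Phi> \<Psi>" "e > 0" "real (Suc m) \<le> R + 1" using x unfolding xx P_def by auto
    from step[OF this] show "\<exists>y. P (Suc m) y \<and> Q m x y" unfolding xx by blast
  qed
  then obtain x where x: "\<And>n. P n (x n)" "\<And>n. Q n (x n) (x (Suc n))" by blast
  define \<Phi>s where "\<Phi>s = (\<lambda>n. fst (x n))"
  define \<Psi>s where "\<Psi>s = (\<lambda>n. fst (snd (x n)))"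
  define R where "R = (\<lambda>n. fst (snd (snd (x n))))"
  define \<Gamma> where "\<Gamma> = (\<lambda>n. fst (snd (snd (snd (x n)))))"
  define e where "e = (\<lambda>n. snd (snd (snd (snd (x n)))))"
  have xn: "x n = (\<Phi>s n, \<Psi>s n, R n, \<Gamma> n, e n)" for n
    unfolding \<Phi>s_def \<Psi>s_def R_def \<Gamma>_def e_def by simp
  have P: "aut_pair (\<Phi>s n) (\<Psi>s n)" "real n \<le> R n" "\<Gamma> n \<subseteq> cball 0 (R n + 1)" "lengthening (R n) (M n (R n)) (\<Gamma> n)" "e n > 0"
    "(\<Union>z\<in>\<Gamma> n. cball (\<Psi>s n z) (2 * e n)) \<subseteq> W n" for n
    using x(1)[of n] unfolding xn P_def by auto
  have Q: "R n + 1 \<le> R (Suc n)" "e (Suc n) \<le> e n / 2"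
    "\<And>z. norm z \<le> R n + 1 \<Longrightarrow> dist (\<Phi>s (Suc n) z) (\<Phi>s n z) \<le> e n"
    "\<And>z. norm z \<le> R n + 1 \<Longrightarrow> dist (\<Psi>s (Suc n) z) (\<Psi>s n z) \<le> e n" for n
    using x(2)[of n] unfolding xn Q_def by auto
  obtain \<Phi> where \<Phi>: "\<And>r. uniform_limit (cball 0 r) \<Phi>s \<Phi> sequentially"
    by (rule uniform_limit_of_geometric_steps[of e R \<Phi>s]) (use P(5) Q in auto)
  obtain \<Psi> where \<Psi>: "\<And>r. uniform_limit (cball 0 r) \<Psi>s \<Psi> sequentially"
    "\<And>n z. norm z \<le> R n + 1 \<Longrightarrow> dist (\<Psi> z) (\<Psi>s n z) \<le> 2 * e n"
    by (rule uniform_limit_of_geometric_steps[of e R \<Psi>s]) (use P(5) Q in auto)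
  show thesis
  proof (rule that[of \<Phi> \<Psi> R \<Gamma>])
    show "aut_pair \<Phi> \<Psi>" by (rule aut_pair_limit[OF P(1) \<Phi> \<Psi>(1)])
    show "\<Psi> ` \<Gamma> n \<subseteq> W n" for n
    proof (rule image_subsetI)
      fix z assume z: "z \<in> \<Gamma> n"
      hence "norm z \<le> R n + 1" using P(3)[of n] by auto
      hence "\<Psi> z \<in> cball (\<Psi>s n z) (2 * e n)" using \<Psi>(2) by (simp add: dist_commute)
      thus "\<Psi> z \<in> W n" using P(6)[of n] z by blast
    qed
  qed (use P in auto)
qed


section \<open>Completeness of the image leaves\<close>

lemma aut_pair_has_derivative:
  assumes "aut_pair \<Phi> \<Psi>"
  shows "(\<Phi> has_derivative frechet_derivative \<Phi> (at z)) (at z)"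
    and "(\<Psi> has_derivative frechet_derivative \<Psi> (at z)) (at z)"
proof -
  have "\<Phi> differentiable at z" "\<Psi> differentiable at z"
    using assms holo_map_on_derivative[of _ UNIV z] unfolding aut_pair_def differentiable_def
    by (metis UNIV_I)+
  thus "(\<Phi> has_derivative frechet_derivative \<Phi> (at z)) (at z)" "(\<Psi> has_derivative frechet_derivative \<Psi> (at z)) (at z)"
    by (simp_all add: frechet_derivative_works[symmetric])
qed

lemma aut_pair_derivative_inverse:
  assumes "aut_pair \<Phi> \<Psi>"
  shows "frechet_derivative \<Psi> (at (\<Phi> z)) (frechet_derivative \<Phi> (at z) v) = v"
proof -
  have "((\<lambda>z. \<Psi> (\<Phi> z)) has_derivative (\<lambda>v. frechet_derivative \<Psi> (at (\<Phi> z)) (frechet_derivative \<Phi> (at z) v))) (at z)"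
    using has_derivative_compose[OF aut_pair_has_derivative(1)[OF assms] aut_pair_has_derivative(2)[OF assms]] .
  moreover have "(\<lambda>z. \<Psi> (\<Phi> z)) = (\<lambda>z. z)" using assms unfolding aut_pair_def by auto
  ultimately have "((\<lambda>z. z) has_derivative (\<lambda>v. frechet_derivative \<Psi> (at (\<Phi> z)) (frechet_derivative \<Phi> (at z) v))) (at z)" by simp
  from has_derivative_unique[OF this has_derivative_ident] show ?thesis by meson
qed

lemma has_vector_derivative_compose_differentiable:
  assumes "(\<gamma> has_vector_derivative v) (at t within S)" "(f has_derivative D) (at (\<gamma> t))"
  shows "((\<lambda>t. f (\<gamma> t)) has_vector_derivative D v) (at t within S)"
proof -
  have "((\<lambda>t. f (\<gamma> t)) has_derivative (\<lambda>h. D (h *\<^sub>R v))) (at t within S)"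

    using has_derivative_compose[where f = \<gamma> and g = f and g' = D and x = t and s = S] assms
    unfolding has_vector_derivative_def by blast
  moreover have "linear D" using assms(2) by (rule has_derivative_linear)
  ultimately show ?thesis unfolding has_vector_derivative_def by (simp add: linear_scale)
qed

text \<open>\<open>\<Phi>\<close> and its inverse map integral curves of sections to integral curves of the transported sections.\<close>

lemma leaf_image_foliation:
  fixes \<Phi> \<Psi> :: "complex ^ 'n \<Rightarrow> complex ^ 'n"
  assumes pair: "aut_pair \<Phi> \<Psi>"
  shows "leaf (image_foliation \<Phi> F) (\<Phi> z) = \<Phi> ` leaf F z"
proof -
  have inv: "\<Psi> (\<Phi> z) = z" "\<Phi> (\<Psi> z) = z" for z using pair unfolding aut_pair_def by auto
  have fwd: "flow_step (image_foliation \<Phi> F) (\<Phi> x) (\<Phi> y)" if xy: "flow_step F x y" for x y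
  proof -
    obtain U V \<gamma> where U: "open U" "V \<in> F U" and \<gamma>: "\<gamma> (0::real) = x" "\<gamma> 1 = y"
      "\<And>t. t \<in> {0..1} \<Longrightarrow> \<gamma> t \<in> U \<and> (\<gamma> has_vector_derivative V (\<gamma> t)) (at t within {0..1})"
      using xy unfolding flow_step_def by blast
    define V' where "V' = (\<lambda>w. frechet_derivative \<Phi> (at (\<Psi> w)) (V (\<Psi> w)))"
    have "\<Phi> -` (\<Psi> -` U) = U" using inv by auto
    hence "V' \<in> image_foliation \<Phi> F (\<Psi> -` U)"
      unfolding image_foliation_def V'_def using U(2) inv by auto
    moreover have "open (\<Psi> -` U)" by (rule aut_pair_vimage_open[OF pair U(1)])
    moreover have "\<Phi> (\<gamma> t) \<in> \<Psi> -` U \<and> ((\<lambda>t. \<Phi> (\<gamma> t)) has_vector_derivative V' (\<Phi> (\<gamma> t))) (at t within {0..1})"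
      if "t \<in> {0..1}" for t
      using \<gamma>(3)[OF that] has_vector_derivative_compose_differentiable[OF _ aut_pair_has_derivative(1)[OF pair]]
      unfolding V'_def by (simp add: inv)
    ultimately show ?thesis unfolding flow_step_def using \<gamma>(1,2)
      by (intro exI[of _ "\<Psi> -` U"] exI[of _ V'] exI[of _ "\<lambda>t. \<Phi> (\<gamma> t)"]) auto
  qed
  have bwd: "flow_step F (\<Psi> x) (\<Psi> y)" if xy: "flow_step (image_foliation \<Phi> F) x y" for x y
  proof -
    obtain U V' \<gamma> where U: "open U" "V' \<in> image_foliation \<Phi> F U" and \<gamma>: "\<gamma> (0::real) = x" "\<gamma> 1 = y"
      "\<And>t. t \<in> {0..1} \<Longrightarrow> \<gamma> t \<in> U \<and> (\<gamma> has_vector_derivative V' (\<gamma> t)) (at t within {0..1})"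
      using xy unfolding flow_step_def by blast
    obtain V where V: "V \<in> F (\<Phi> -` U)" "\<And>z. z \<in> \<Phi> -` U \<Longrightarrow> V' (\<Phi> z) = frechet_derivative \<Phi> (at z) (V z)"
      using U(2) unfolding image_foliation_def by blast
    have "open (\<Phi> -` U)" by (rule aut_pair_vimage_open[OF aut_pair_sym[OF pair] U(1)])
    moreover have "\<Psi> (\<gamma> t) \<in> \<Phi> -` U \<and> ((\<lambda>t. \<Psi> (\<gamma> t)) has_vector_derivative V (\<Psi> (\<gamma> t))) (at t within {0..1})"
      if "t \<in> {0..1}" for t
    proof -
      have mem: "\<Psi> (\<gamma> t) \<in> \<Phi> -` U" using \<gamma>(3)[OF that] by (simp add: inv)
      have "frechet_derivative \<Psi> (at (\<gamma> t)) (V' (\<gamma> t)) = V (\<Psi> (\<gamma> t))"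
        using V(2)[OF mem] aut_pair_derivative_inverse[OF pair, of "\<Psi> (\<gamma> t)"] by (simp add: inv)
      moreover have "((\<lambda>t. \<Psi> (\<gamma> t)) has_vector_derivative frechet_derivative \<Psi> (at (\<gamma> t)) (V' (\<gamma> t))) (at t within {0..1})"
        by (rule has_vector_derivative_compose_differentiable[OF _ aut_pair_has_derivative(2)[OF pair]])
          (use \<gamma>(3)[OF that] in blast)
      ultimately show ?thesis using mem by simp
    qed
    ultimately show ?thesis unfolding flow_step_def using \<gamma>(1,2) V(1)
      by (intro exI[of _ "\<Phi> -` U"] exI[of _ V] exI[of _ "\<lambda>t. \<Psi> (\<gamma> t)"]) auto
  qed
  have "\<Phi> y \<in> leaf (image_foliation \<Phi> F) (\<Phi> z)" if "y \<in> leaf F z" for y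
  proof -
    have "(flow_step F)\<^sup>*\<^sup>* z y" using that unfolding leaf_def by simp
    hence "(flow_step (image_foliation \<Phi> F))\<^sup>*\<^sup>* (\<Phi> z) (\<Phi> y)"
      by (induction rule: rtranclp_induct) (auto intro: fwd rtranclp.rtrancl_into_rtrancl)
    thus ?thesis unfolding leaf_def by simp
  qed
  moreover have "w \<in> \<Phi> ` leaf F z" if "w \<in> leaf (image_foliation \<Phi> F) (\<Phi> z)" for w
  proof -
    have "(flow_step (image_foliation \<Phi> F))\<^sup>*\<^sup>* (\<Phi> z) w" using that unfolding leaf_def by simp
    hence "(flow_step F)\<^sup>*\<^sup>* (\<Psi> (\<Phi> z)) (\<Psi> w)"
      by (induction rule: rtranclp_induct) (auto intro: bwd rtranclp.rtrancl_into_rtrancl)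
    hence "\<Psi> w \<in> leaf F z" unfolding leaf_def by (simp add: inv)
    thus ?thesis using inv(2)[of w] by (metis imageI)
  qed
  ultimately show ?thesis by blast
qed

text \<open>Compactness of \<open>K \<times> sphere 0 1\<close>. Joint continuity of \<open>g p v v\<close> follows from
  continuity in \<open>p\<close> by expanding the bilinear form in a basis.\<close>

lemma riemannian_metric_lower_bound:
  fixes g :: "complex ^ 'n \<Rightarrow> complex ^ 'n \<Rightarrow> complex ^ 'n \<Rightarrow> real"
  assumes g: "riemannian_metric g" and K: "compact K"
  obtains \<epsilon> where "\<epsilon> > 0" "\<And>p v. p \<in> K \<Longrightarrow> \<epsilon> * norm v \<le> sqrt (g p v v)"
proof (cases "K = {}")
  case True
  thus thesis using that[of 1] by auto
next
  case False
  have bil: "bilinear (g p)" and pos: "v \<noteq> 0 \<Longrightarrow> g p v v > 0" for p v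
    using g unfolding riemannian_metric_def by auto
  have cont: "continuous_on UNIV (\<lambda>p. g p v w)" for v w
  proof -
    have "Ck 0 (\<lambda>p. g p v w)" using g unfolding riemannian_metric_def smooth_def by blast
    thus ?thesis by simp
  qed
  have expand: "g p v v = (\<Sum>b\<in>Basis. \<Sum>b'\<in>Basis. (v \<bullet> b) * ((v \<bullet> b') * g p b b'))" for p v
  proof -
    have "g p v v = g p (\<Sum>b\<in>Basis. (v \<bullet> b) *\<^sub>R b) (\<Sum>b\<in>Basis. (v \<bullet> b) *\<^sub>R b)" by (simp add: euclidean_representation)
    also have "\<dots> = (\<Sum>(b,b')\<in>Basis \<times> Basis. g p ((v \<bullet> b) *\<^sub>R b) ((v \<bullet> b') *\<^sub>R b'))" by (rule bilinear_sum[OF bil])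
    also have "\<dots> = (\<Sum>b\<in>Basis. \<Sum>b'\<in>Basis. (v \<bullet> b) * ((v \<bullet> b') * g p b b'))"
      by (simp add: sum.cartesian_product bilinear_lmul[OF bil] bilinear_rmul[OF bil] mult.left_commute)
    finally show ?thesis .
  qed
  define h where "h = (\<lambda>x :: (complex ^ 'n) \<times> (complex ^ 'n). g (fst x) (snd x) (snd x))"
  have cg: "continuous_on S (\<lambda>x. g (fst x) b b')" for b b' and S :: "((complex ^ 'n) \<times> (complex ^ 'n)) set"
    using continuous_on_compose2[OF cont[of b b'] continuous_on_fst[OF continuous_on_id]] by simp
  have cs: "continuous_on S (\<lambda>x. snd x \<bullet> b)" for b and S :: "((complex ^ 'n) \<times> (complex ^ 'n)) set"
    by (intro continuous_intros)
  have "continuous_on (K \<times> sphere 0 1) h"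
    unfolding h_def expand by (rule continuous_on_sum, rule continuous_on_sum, rule continuous_on_mult[OF cs continuous_on_mult[OF cs cg]])
  moreover have "(axis undefined 1 :: complex ^ 'n) \<in> sphere 0 1" by simp
  hence "K \<times> sphere (0 :: complex ^ 'n) 1 \<noteq> {}" using False by blast
  moreover have "compact (K \<times> sphere (0 :: complex ^ 'n) 1)" by (intro compact_Times K compact_sphere)
  ultimately obtain x0 where x0: "x0 \<in> K \<times> sphere 0 1" "\<And>x. x \<in> K \<times> sphere 0 1 \<Longrightarrow> h x0 \<le> h x"
    using continuous_attains_inf[of "K \<times> sphere 0 1" h] by metis
  have m: "h x0 > 0" using x0(1) unfolding h_def by (intro pos) auto
  show thesis
  proof (rule that[of "sqrt (h x0)"])
    show "sqrt (h x0) > 0" using m by simp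
    fix p v :: "complex ^ 'n" assume p: "p \<in> K"
    show "sqrt (h x0) * norm v \<le> sqrt (g p v v)"
    proof (cases "v = 0")
      case True
      have "g p 0 0 = 0" by (rule bilinear_lzero[OF bil])
      thus ?thesis using True by simp
    next
      case False
      define u where "u = v /\<^sub>R norm v"
      have "h x0 \<le> h (p, u)" using p False unfolding u_def by (intro x0(2)) auto
      moreover have "v = norm v *\<^sub>R u" using False unfolding u_def by simp
      hence "g p v v = norm v * (norm v * g p u u)"
        using bilinear_lmul[OF bil, of p "norm v" u] bilinear_rmul[OF bil, of p] by (metis real_scaleR_def)
      ultimately have "norm v * (norm v * h x0) \<le> g p v v" unfolding h_def by (simp add: mult_left_mono)
      hence "sqrt (h x0 * (norm v)\<^sup>2) \<le> sqrt (g p v v)" by (simp add: power2_eq_square ac_simps)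
      thus ?thesis by (simp add: real_sqrt_mult)
    qed
  qed
qed

text \<open>\<open>A\<close> is the Euclidean arc length, up to an additive constant.\<close>

lemma metric_length_lower_bound:
  fixes \<gamma> :: "real \<Rightarrow> complex ^ 'n"
  assumes \<gamma>: "smooth_path \<gamma>" and b: "0 \<le> b" "b < 1" and \<epsilon>: "\<epsilon> \<ge> 0"
    and lower: "\<And>t v. t \<in> {0..b} \<Longrightarrow> \<epsilon> * norm v \<le> sqrt (g (\<gamma> t) v v)"
  obtains A where "\<And>t t'. 0 \<le> t \<Longrightarrow> t \<le> t' \<Longrightarrow> t' \<le> b \<Longrightarrow> dist (\<gamma> t) (\<gamma> t') \<le> A t' - A t"
    and "ennreal (\<epsilon> * (A b - A 0)) \<le> metric_length g \<gamma>"
proof -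
  obtain D where D: "D (0::nat) = \<gamma>"
    "\<And>k t. t \<in> {0..<1} \<Longrightarrow> (D k has_vector_derivative D (Suc k) t) (at t within {0..<1})"
    using \<gamma> unfolding smooth_path_def by blast
  define \<gamma>' where "\<gamma>' = D 1"
  have der: "(\<gamma> has_vector_derivative \<gamma>' t) (at t within {0..<1})" if "t \<in> {0..<1}" for t
    using D(2)[of t 0] that D(1) unfolding \<gamma>'_def by simp
  have cont: "continuous_on {0..<1} \<gamma>'"
    unfolding \<gamma>'_def continuous_on_eq_continuous_within
    using D(2)[of _ 1] has_vector_derivative_continuous by blast
  \<comment> \<open>truncating the parameter extends the speed to a continuous function on the whole line; starting the integral at \<open>-1\<close> makes \<open>0\<close> an interior point, so that two-sided derivatives are available\<close>
  define c where "c = (\<lambda>t. max 0 (min b t))"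
  define f where "f = (\<lambda>t. norm (\<gamma>' (c t)))"
  have "continuous_on UNIV (\<lambda>t. \<gamma>' (c t))"
    by (rule continuous_on_compose2[OF cont]) (use b in \<open>auto simp: c_def intro!: continuous_intros\<close>)
  hence fc: "continuous_on S f" for S unfolding f_def by (intro continuous_on_norm) (rule continuous_on_subset, auto)
  have f_eq: "f t = norm (\<gamma>' t)" if "t \<in> {0..b}" for t using that unfolding f_def c_def by simp
  define A where "A = (\<lambda>t. integral {-1..t} f)"
  have int: "f integrable_on {s..t}" for s t by (intro integrable_continuous_interval fc)
  have dist_le: "dist (\<gamma> t) (\<gamma> t') \<le> A t' - A t" if t: "0 \<le> t" "t \<le> t'" "t' \<le> b" for t t'
  proof -
    have sub: "{t..t'} \<subseteq> {0..<1}" using t b by auto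
    have "(\<gamma> has_vector_derivative \<gamma>' x) (at x within {t..t'})" if "x \<in> {t..t'}" for x
      using der[of x] that sub has_vector_derivative_within_subset by blast
    hence hi: "(\<gamma>' has_integral (\<gamma> t' - \<gamma> t)) {t..t'}" using t by (intro fundamental_theorem_of_calculus)
    have "norm (integral {t..t'} \<gamma>') \<le> integral {t..t'} f"
      using hi f_eq t by (intro Henstock_Kurzweil_Integration.integral_norm_bound_integral int) auto
    also have "integral {t..t'} f = A t' - A t"

      using Henstock_Kurzweil_Integration.integral_combine[OF _ t(2) int, of "-1"] t(1) unfolding A_def by simp
    finally show ?thesis using integral_unique[OF hi] by (simp add: dist_norm norm_minus_commute)
  qed
  have "(\<integral>\<^sup>+ t. ennreal (\<epsilon> * f t) * indicator {0..b} t \<partial>lborel) = \<epsilon> * A b - \<epsilon> * A 0"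
  proof (rule nn_integral_FTC_Icc)
    show "(\<lambda>t. \<epsilon> * f t) \<in> borel_measurable borel"
      by (intro borel_measurable_continuous_onI continuous_intros fc)
    fix t assume "t \<in> {0..b}"
    hence t: "t \<in> {-1<..<b+1}" by auto
    have "(A has_real_derivative f t) (at t within {-1..b+1})"
      unfolding A_def by (rule integral_has_real_derivative[OF fc]) (use t in auto)
    moreover have "at t within {-1..b+1} = at t" using t by (intro at_within_interior) auto
    ultimately show "((\<lambda>t. \<epsilon> * A t) has_real_derivative \<epsilon> * f t) (at t)"
      by (intro DERIV_cmult) simp
  qed (use \<epsilon> b in \<open>auto simp: f_def\<close>)
  moreover have "(\<integral>\<^sup>+ t. ennreal (\<epsilon> * f t) * indicator {0..b} t \<partial>lborel) \<le> metric_length g \<gamma>"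
    unfolding metric_length_def
  proof (rule nn_integral_mono)
    fix t :: real
    show "ennreal (\<epsilon> * f t) * indicator {0..b} t \<le> ennreal (sqrt (g (\<gamma> t)
        (vector_derivative \<gamma> (at t within {0..<1})) (vector_derivative \<gamma> (at t within {0..<1})))) * indicator {0..<1} t"
    proof (cases "t \<in> {0..b}")
      case True
      hence t: "t \<in> {0..<1}" using b by auto
      have "at t within {0..<1} \<noteq> bot"
        using t by (simp add: trivial_limit_within)
      hence "vector_derivative \<gamma> (at t within {0..<1}) = \<gamma>' t"
        by (rule vector_derivative_within[OF _ der[OF t]])
      thus ?thesis using lower[OF True, of "\<gamma>' t"] f_eq[OF True] t True by (simp add: ennreal_leI)
    qed simp
  qed
  ultimately have "ennreal (\<epsilon> * (A b - A 0)) \<le> metric_length g \<gamma>" by (simp add: right_diff_distrib)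
  thus thesis using that dist_le by blast
qed

text \<open>On \<open>[0, b]\<close> the path stays in the ball of radius \<open>r\<close>, where the comparison between the metric and the
  Euclidean one is available.\<close>

lemma first_exit_time:
  fixes \<gamma> :: "real \<Rightarrow> 'a::real_normed_vector"
  assumes \<gamma>: "continuous_on {0..a} \<gamma>" and a: "0 \<le> a" and n: "norm (\<gamma> 0) \<le> r" "r \<le> norm (\<gamma> a)"
  obtains b where "0 \<le> b" "b \<le> a" "norm (\<gamma> b) = r" "\<And>t. t \<in> {0..b} \<Longrightarrow> norm (\<gamma> t) \<le> r"
proof -
  have cn: "continuous_on {0..a} (\<lambda>t. norm (\<gamma> t))" using \<gamma> by (intro continuous_on_norm)
  define T where "T = {t \<in> {0..a}. norm (\<gamma> t) = r}"
  have "closed T" unfolding T_def by (rule continuous_closed_preimage_constant[OF cn]) simp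
  hence "compact T" unfolding T_def by (metis (no_types, lifting) bounded_closed_interval bounded_subset compact_eq_bounded_closed mem_Collect_eq subsetI)
  moreover have "T \<noteq> {}" using IVT'[of "\<lambda>t. norm (\<gamma> t)" 0 r a] n a cn unfolding T_def by auto
  ultimately obtain b where b: "b \<in> T" "\<And>t. t \<in> T \<Longrightarrow> b \<le> t"
    using compact_attains_inf by metis
  show thesis
  proof (rule that)
    show "0 \<le> b" "b \<le> a" "norm (\<gamma> b) = r" using b(1) unfolding T_def by auto
    fix t assume t: "t \<in> {0..b}"
    show "norm (\<gamma> t) \<le> r"
    proof (rule ccontr)
      assume "\<not> norm (\<gamma> t) \<le> r"
      hence gt: "r < norm (\<gamma> t)" by simp
      have ta: "t \<le> a" using t \<open>b \<le> a\<close> by simp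
      have "continuous_on {0..t} (\<lambda>t. norm (\<gamma> t))" using ta by (intro continuous_on_subset[OF cn]) auto
      then obtain s where s: "0 \<le> s" "s \<le> t" "norm (\<gamma> s) = r"
        using IVT'[of "\<lambda>t. norm (\<gamma> t)" 0 r t] n gt t by auto
      hence "b \<le> s" using ta by (intro b(2)) (auto simp: T_def)
      hence "s = t" using s t by auto
      thus False using s gt by simp
    qed
  qed
qed

lemma smooth_path_continuous: "smooth_path \<gamma> \<Longrightarrow> continuous_on {0..<1} \<gamma>"
  unfolding smooth_path_def continuous_on_eq_continuous_within
  using has_vector_derivative_continuous by metis

text \<open>Since \<open>Y\<close> is closed, its intersections with closed balls are compact subsets of \<open>Y\<close>, so a path divergent in
  \<open>Y\<close> also leaves every ball.\<close>

lemma divergent_path_unbounded: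
  fixes Y :: "(complex ^ 'n) set"
  assumes "divergent_path_in Y \<gamma>" "closed Y"
  obtains a where "0 \<le> a" "a < 1" "r < norm (\<gamma> a)"
proof -
  have "compact (cball 0 r \<inter> Y)" using assms(2) by (simp add: compact_Int_closed)
  hence "\<forall>\<^sub>F t in at_left 1. \<gamma> t \<notin> cball 0 r \<inter> Y"
    using assms(1) unfolding divergent_path_in_def by blast
  moreover have "\<forall>\<^sub>F t in at_left (1::real). t \<in> {0<..<1}"
    by (rule eventually_at_leftI[of 0]) auto
  ultimately have "\<forall>\<^sub>F t in at_left 1. \<gamma> t \<notin> cball 0 r \<inter> Y \<and> t \<in> {0<..<1}" by (rule eventually_conj)
  then obtain a where a: "\<gamma> a \<notin> cball 0 r \<inter> Y" "a \<in> {0<..<1}"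
    using eventually_happens' trivial_limit_at_left_real by blast
  moreover have "\<gamma> a \<in> Y" using a(2) assms(1) unfolding divergent_path_in_def by fastforce
  ultimately show thesis using that[of a] by auto
qed

text \<open>A path divergent in an image leaf crosses, for every large \<open>n\<close>, the shell that contains \<open>\<Gamma> n\<close> and avoids \<open>\<Gamma> n\<close>.
  With \<open>M = n / \<epsilon> R\<close> this crossing alone has \<open>g\<close>-length at least \<open>n\<close>.\<close>

theorem theorem1p5:
  fixes g :: "complex ^ 'n \<Rightarrow> complex ^ 'n \<Rightarrow> complex ^ 'n \<Rightarrow> real"
    and F :: "'n::finite vsheaf"
  assumes "CARD('n) > 1"
    and "riemannian_metric g"
    and "proper_foliation F"
  shows "\<exists>\<Phi>. holo_automorphism \<Phi> \<and>
           (\<forall>z. leaf (image_foliation \<Phi> F) (\<Phi> z) = \<Phi> ` leaf F z) \<and>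
           complete_foliation g (image_foliation \<Phi> F)"
proof -
  define W where "W = (\<lambda>n. - leaf_hull F (cball 0 (real n)))"
  have W: "open (W n)" "\<not> bounded (W n)" for n
  proof -
    show "open (W n)" unfolding W_def leaf_hull_def by auto
    have "\<not> compact (closure (W n))"
      using assms(3) unfolding W_def proper_foliation_def by (meson compact_cball)
    thus "\<not> bounded (W n)" by simp
  qed
  have "\<exists>\<epsilon>>0. \<forall>p\<in>cball 0 (R + 1). \<forall>v. \<epsilon> * norm v \<le> sqrt (g p v v)" for R
    using riemannian_metric_lower_bound[OF assms(2) compact_cball] by metis
  then obtain \<epsilon> where \<epsilon>: "\<And>R. \<epsilon> R > 0" "\<And>R p v. p \<in> cball 0 (R + 1) \<Longrightarrow> \<epsilon> R * norm v \<le> sqrt (g p v v)" by metis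
  obtain \<Phi> \<Psi> R \<Gamma> where pair: "aut_pair \<Phi> \<Psi>" and R: "\<And>n. real n \<le> R n"
    and len: "\<And>n. lengthening (R n) (real n / \<epsilon> (R n)) (\<Gamma> n)" and \<Gamma>: "\<And>n. \<Psi> ` \<Gamma> n \<subseteq> W n"

  proof (rule automorphism_pulling_labyrinths[where W = W and M = "\<lambda>n R. real n / \<epsilon> R", OF assms(1) W])
    fix \<Phi> \<Psi> R \<Gamma>
    assume *: "aut_pair \<Phi> \<Psi>" "\<And>n. real n \<le> R n" "\<And>n. lengthening (R n) (real n / \<epsilon> (R n)) (\<Gamma> n)"
      "\<And>n. \<Psi> ` \<Gamma> n \<subseteq> W n"
    show thesis by (rule that[OF *])
  qed
  have inv: "\<Psi> (\<Phi> z) = z" "\<Phi> (\<Psi> z) = z" for z using pair unfolding aut_pair_def by auto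
  have leaves: "leaf (image_foliation \<Phi> F) (\<Phi> z) = \<Phi> ` leaf F z" for z by (rule leaf_image_foliation[OF pair])
  have "metric_length g \<gamma> = \<infinity>"
    if sm: "smooth_path \<gamma>" and div: "divergent_path_in (leaf (image_foliation \<Phi> F) x) \<gamma>" for x \<gamma>
  proof -
    define Y where "Y = leaf (image_foliation \<Phi> F) x"
    have "Y = \<Phi> ` leaf F (\<Psi> x)" using leaves[of "\<Psi> x"] unfolding Y_def by (simp add: inv)
    hence Y: "Y = \<Psi> -` leaf F (\<Psi> x)" using inv by (auto simp: image_iff) metis
    have "closed (leaf F (\<Psi> x))" using assms(3) unfolding proper_foliation_def by blast
    hence clY: "closed Y" unfolding Y using aut_pair_continuous(2)[OF pair, of UNIV] by (simp add: closed_vimage)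
    have div': "divergent_path_in Y \<gamma>" using div unfolding Y_def .
    have path: "\<gamma> t \<in> Y" if "t \<in> {0..<1}" for t using div' that unfolding divergent_path_in_def by blast
    have big: "of_nat n \<le> metric_length g \<gamma>" if n: "norm (\<Psi> x) \<le> real n" "norm (\<gamma> 0) \<le> real n" for n
    proof -
      have "Y \<inter> \<Gamma> n = {}"
      proof (rule ccontr)
        assume "Y \<inter> \<Gamma> n \<noteq> {}"
        then obtain w where "w \<in> Y" "w \<in> \<Gamma> n" by blast
        hence w: "\<Psi> w \<in> leaf F (\<Psi> x)" "\<Psi> w \<in> W n" using Y \<Gamma>[of n] by auto
        have "leaf F (\<Psi> x) \<subseteq> leaf_hull F (cball 0 (real n))"
          unfolding leaf_hull_def using n(1) by (intro order_trans[OF _ closure_subset]) auto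
        thus False using w unfolding W_def by blast
      qed
      obtain a where a: "0 \<le> a" "a < 1" "R n + 1 < norm (\<gamma> a)" using divergent_path_unbounded[OF div' clY] .
      have ca: "continuous_on {0..a} \<gamma>" using smooth_path_continuous[OF sm] a by (auto intro: continuous_on_subset)
      obtain b where b: "0 \<le> b" "b \<le> a" "norm (\<gamma> b) = R n + 1" "\<And>t. t \<in> {0..b} \<Longrightarrow> norm (\<gamma> t) \<le> R n + 1"
        using first_exit_time[OF ca a(1), of "R n + 1"] a(3) n(2) R[of n] by auto
      obtain A where A: "\<And>t t'. 0 \<le> t \<Longrightarrow> t \<le> t' \<Longrightarrow> t' \<le> b \<Longrightarrow> dist (\<gamma> t) (\<gamma> t') \<le> A t' - A t"
        "ennreal (\<epsilon> (R n) * (A b - A 0)) \<le> metric_length g \<gamma>"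
      proof (rule metric_length_lower_bound[where g = g and \<epsilon> = "\<epsilon> (R n)", OF sm b(1)])
        fix A :: "real \<Rightarrow> real"
        assume *: "\<And>t t'. 0 \<le> t \<Longrightarrow> t \<le> t' \<Longrightarrow> t' \<le> b \<Longrightarrow> dist (\<gamma> t) (\<gamma> t') \<le> A t' - A t"
          "ennreal (\<epsilon> (R n) * (A b - A 0)) \<le> metric_length g \<gamma>"
        show thesis by (rule that[OF *])
      next
        show "b < 1" "0 \<le> \<epsilon> (R n)" using a b \<epsilon>(1)[of "R n"] by auto
        show "\<epsilon> (R n) * norm v \<le> sqrt (g (\<gamma> t) v v)" if "t \<in> {0..b}" for t v
          using b(4)[OF that] by (intro \<epsilon>(2)) simp
      qed
      have "\<gamma> ` {0..b} \<inter> \<Gamma> n = {}" using path a b \<open>Y \<inter> \<Gamma> n = {}\<close> by fastforce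
      moreover have "continuous_on {0..b} \<gamma>" using b by (intro continuous_on_subset[OF ca]) auto
      ultimately have "real n / \<epsilon> (R n) \<le> A b - A 0"
        using b n(2) R[of n] A(1) by (intro lengtheningD[OF len]) auto
      hence "real n \<le> \<epsilon> (R n) * (A b - A 0)" using \<epsilon>(1)[of "R n"] by (simp add: field_simps)
      hence "ennreal (real n) \<le> metric_length g \<gamma>" using A(2) by (meson ennreal_leI order_trans)
      thus ?thesis by (simp add: ennreal_of_nat_eq_real_of_nat)
    qed
    show ?thesis
    proof (rule ccontr)
      assume "metric_length g \<gamma> \<noteq> \<infinity>"
      then obtain m where m: "metric_length g \<gamma> < of_nat m"
        using ennreal_Ex_less_of_nat by (metis infinity_ennreal_def top.not_eq_extremum)
      obtain n where n: "max (real m) (max (norm (\<Psi> x)) (norm (\<gamma> 0))) \<le> real n" using real_arch_simple by blast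
      hence "of_nat n \<le> metric_length g \<gamma>" by (intro big) auto
      moreover have "(of_nat m :: ennreal) \<le> of_nat n" using n by (intro of_nat_mono) auto
      ultimately show False using m by (meson leD order_trans)
    qed
  qed
  hence "complete_foliation g (image_foliation \<Phi> F)" unfolding complete_foliation_def metric_complete_def by blast
  thus ?thesis using aut_pair_imp_automorphism[OF pair] leaves by blast
qed

end
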